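(* Let $\Delta$ be a simplicial complex that is a near-cone, and let $F$ be an arbitrary field. Then $\Delta$ is $r$-EKR for every positive integer $r$ with $r\leq\frac{\operatorname{depth}_{F}\Delta+1}{2}$.
   Context: A (finite, abstract) simplicial complex $\Delta$ is a system of sets (faces) on a finite vertex set $V(\Delta)$, closed under taking subsets, such that every vertex lies in some face. The dimension of a face $\sigma$ is $|\sigma|-1$. An $r$-face is a face of cardinality $r$, and $f_r(\Delta)$ is the number of $r$-faces (faces of cardinality $r$) of $\Delta$. For a face $\sigma$, $\operatorname{link}_\Delta\sigma=\{\tau : \tau\cup\sigma \text{ is a face of }\Delta,\ \tau\cap\sigma=\emptyset\}$; for a vertex $v$, $\operatorname{link}_\Delta v=\operatorname{link}_\Delta\{v\}$. A family of sets is intersecting if every pair of its members has non-empty intersection; it is an $r$-family if every member has cardinality $r$. $\Delta$ is $r$-EKR if every intersecting $r$-family $\mathcal{A}$ of faces of $\Delta$ satisfies $|\mathcal{A}|\leq\max_{v\in V(\Delta)}f_{r-1}(\operatorname{link}_\Delta v)$. $\Delta$ is a near-cone (with respect to an apex vertex $v\in V(\Delta)$) if for every face $\sigma$ and every $w\in\sigma$, the set $(\sigma\setminus\{w\})\cup\{v\}$ is also a face. The $d$-skeleton $\Delta^{(d)}$ consists of all faces of $\Delta$ of dimension at most $d$. $\Delta$ is Cohen-Macaulay over $F$ if $\tilde{H}_i(\operatorname{link}_\Delta\sigma;F)=0$ for all faces $\sigma$ of $\Delta$ (including $\sigma=\emptyset$) and all $i<\dim(\operatorname{link}_\Delta\sigma)$.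 Define $\operatorname{depth}_F\Delta=\max\{d\leq\dim\Delta : \Delta^{(d)}\text{ is Cohen-Macaulay over }F\}$. *)

theory Defs
  imports Complex_Main
begin

section \<open>Simplicial complexes\<close>

text \<open>A complex is given by its set of faces. Every vertex lies in a face, so the vertex set is
  the union of the faces.\<close>

definition vertices :: "'a set set \<Rightarrow> 'a set" where
  "vertices K = \<Union>K"

definition simplicial_complex :: "'a set set \<Rightarrow> bool" where
  "simplicial_complex K \<longleftrightarrow> finite (vertices K) \<and> (\<forall>\<sigma>\<in>K. \<forall>\<tau>\<subseteq>\<sigma>. \<tau> \<in> K)"

definition face_dim :: "'a set \<Rightarrow> int" where
  "face_dim \<sigma> = int (card \<sigma>) - 1"

text \<open>The complex whose only face is the empty set has dimension -1; the dimension of the complex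
  without any faces is unspecified.\<close>

definition complex_dim :: "'a set set \<Rightarrow> int" where
  "complex_dim K = Max (face_dim ` K)"

definition r_faces :: "'a set set \<Rightarrow> nat \<Rightarrow> 'a set set" where
  "r_faces K r = {\<sigma>\<in>K. card \<sigma> = r}"

definition num_faces :: "nat \<Rightarrow> 'a set set \<Rightarrow> nat" where
  "num_faces r K = card (r_faces K r)"

definition link :: "'a set set \<Rightarrow> 'a set \<Rightarrow> 'a set set" where
  "link K \<sigma> = {\<tau>. \<tau> \<union> \<sigma> \<in> K \<and> \<tau> \<inter> \<sigma> = {}}"

definition skeleton :: "int \<Rightarrow> 'a set set \<Rightarrow> 'a set set" where
  "skeleton d K = {\<sigma>\<in>K. face_dim \<sigma> \<le> d}"

definition near_cone_apex :: "'a set set \<Rightarrow> 'a \<Rightarrow> bool" where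
  "near_cone_apex K v \<longleftrightarrow> v \<in> vertices K \<and> (\<forall>\<sigma>\<in>K. \<forall>w\<in>\<sigma>. (\<sigma> - {w}) \<union> {v} \<in> K)"

definition near_cone :: "'a set set \<Rightarrow> bool" where
  "near_cone K \<longleftrightarrow> (\<exists>v. near_cone_apex K v)"

section \<open>The Erdos-Ko-Rado property\<close>

definition intersecting :: "'a set set \<Rightarrow> bool" where
  "intersecting \<A> \<longleftrightarrow> (\<forall>A\<in>\<A>. \<forall>B\<in>\<A>. A \<inter> B \<noteq> {})"

text \<open>Intended for \<^term>\<open>r > 0\<close>, where the subtraction is exact, and for complexes with at least
  one vertex, where the maximum is taken over a nonempty set.\<close>

definition r_EKR :: "nat \<Rightarrow> 'a set set \<Rightarrow> bool" where
  "r_EKR r K \<longleftrightarrow>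
     (\<forall>\<A>. \<A> \<subseteq> r_faces K r \<and> intersecting \<A> \<longrightarrow>
        card \<A> \<le> Max ((\<lambda>v. num_faces (r - 1) (link K {v})) ` vertices K))"

section \<open>Reduced simplicial homology\<close>

text \<open>Oriented chains, without a choice of a vertex order: a chain of dimension \<open>i\<close> assigns to each
  ordered face \<open>[v\<^sub>0, \<dots>, v\<^sub>i]\<close> its coefficient, and exchanging two neighbouring vertices reverses the
  orientation and hence changes the sign. Dimension -1 consists of the multiples of the empty
  face, so the chain complex is the augmented one.\<close>

definition chains :: "'a set set \<Rightarrow> int \<Rightarrow> ('a list \<Rightarrow> 'f::field) set" where
  "chains K i = {c.
     (\<forall>xs. c xs \<noteq> 0 \<longrightarrow> distinct xs \<and> set xs \<in> K \<and> int (length xs) = i + 1) \<and>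
     (\<forall>xs a b ys. c (xs @ a # b # ys) = - c (xs @ b # a # ys))}"

text \<open>The face \<open>[v\<^sub>0, \<dots>, v\<^sub>i]\<close> without \<open>v\<^sub>k\<close> has coefficient \<open>(-1)\<^sup>k\<close> in the boundary of
  \<open>[v\<^sub>0, \<dots>, v\<^sub>i]\<close>, which is also the sign relating \<open>[v\<^sub>0, \<dots>, v\<^sub>i]\<close> to the ordering with \<open>v\<^sub>k\<close> moved
  to the front. See \<open>boundary_insert_at\<close> for the formula with explicit signs.\<close>

definition boundary :: "'a set set \<Rightarrow> ('a list \<Rightarrow> 'f::field) \<Rightarrow> 'a list \<Rightarrow> 'f" where
  "boundary K c = (\<lambda>ys. \<Sum>v\<in>vertices K. c (v # ys))"

definition cycles :: "'a set set \<Rightarrow> int \<Rightarrow> ('a list \<Rightarrow> 'f::field) set" where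
  "cycles K i = {c \<in> chains K i. boundary K c = (\<lambda>_. 0)}"

definition boundaries :: "'a set set \<Rightarrow> int \<Rightarrow> ('a list \<Rightarrow> 'f::field) set" where
  "boundaries K i = boundary K ` chains K (i + 1)"

definition homologous :: "'a set set \<Rightarrow> int \<Rightarrow> (('a list \<Rightarrow> 'f::field) \<times> ('a list \<Rightarrow> 'f)) set" where
  "homologous K i =
     {(z, w). z \<in> cycles K i \<and> w \<in> cycles K i \<and> (\<lambda>xs. z xs - w xs) \<in> boundaries K i}"

definition reduced_homology :: "'a set set \<Rightarrow> int \<Rightarrow> ('a list \<Rightarrow> 'f::field) set set" where
  "reduced_homology K i = cycles K i // homologous K i"

text \<open>The class of the zero cycle is the set of all boundaries.\<close>

definition reduced_homology_zero :: "'f::field itself \<Rightarrow> 'a set set \<Rightarrow> int \<Rightarrow> bool" where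
  "reduced_homology_zero F K i \<longleftrightarrow>
     (reduced_homology K i :: ('a list \<Rightarrow> 'f) set set) = {boundaries K i}"

lemma chains_nonzero:
  assumes "c \<in> chains K i" "c xs \<noteq> 0"
  shows "distinct xs" "set xs \<in> K" "int (length xs) = i + 1"
  using assms by (auto simp: chains_def)

lemma chains_swap:
  assumes "c \<in> chains K i"
  shows "c (xs @ a # b # ys) = - c (xs @ b # a # ys)"
  using assms unfolding chains_def by blast

lemma chains_move:
  assumes "c \<in> chains K i"
  shows "c (xs @ v # ys) = (- 1) ^ length xs * c (v # xs @ ys)"
proof (induction xs arbitrary: ys rule: rev_induct)
  case (snoc x xs)
  have "c ((xs @ [x]) @ v # ys) = - c (xs @ v # x # ys)"
    unfolding append_assoc append_Cons append_Nil by (rule chains_swap[OF assms])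
  also have "\<dots> = - ((- 1) ^ length xs * c (v # xs @ x # ys))"
    by (simp only: snoc)
  finally show ?case by simp
qed simp

lemma boundary_insert_at:
  assumes "c \<in> chains K i" "k \<le> length ys"
  shows "boundary K c ys = (\<Sum>v\<in>vertices K. (- 1) ^ k * c (take k ys @ v # drop k ys))"
proof -
  have "c (v # ys) = (- 1) ^ k * c (take k ys @ v # drop k ys)" for v
  proof -
    have "c (take k ys @ v # drop k ys) = (- 1) ^ k * c (v # ys)"
      using chains_move[OF assms(1), of "take k ys" v "drop k ys"] assms(2)
      by (simp add: min_absorb2)
    then show ?thesis by simp
  qed
  then show ?thesis by (simp add: boundary_def)
qed

lemma boundary_in_chains:
  assumes K: "simplicial_complex K" and c: "c \<in> chains K i"
  shows "boundary K c \<in> chains K (i - 1)"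
  unfolding chains_def
proof (intro CollectI conjI allI impI)
  fix ys
  assume "boundary K c ys \<noteq> 0"
  then obtain v where v: "c (v # ys) \<noteq> 0"
    unfolding boundary_def by (rule sum.not_neutral_contains_not_neutral)
  show "distinct ys"
    using chains_nonzero(1)[OF c v] by simp
  show "int (length ys) = i - 1 + 1"
    using chains_nonzero(3)[OF c v] by simp
  have "set ys \<subseteq> set (v # ys)"
    by auto
  with K chains_nonzero(2)[OF c v] show "set ys \<in> K"
    unfolding simplicial_complex_def by blast
next
  fix xs a b ys
  have "c (v # xs @ a # b # ys) = - c (v # xs @ b # a # ys)" for v
    using chains_swap[OF c, of "v # xs" a b ys] unfolding append_Cons .
  then show "boundary K c (xs @ a # b # ys) = - boundary K c (xs @ b # a # ys)"
    unfolding boundary_def sum_negf[symmetric] by (intro sum.cong refl)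
qed

lemma sum_antisym_eq_0:
  fixes g :: "'a \<Rightarrow> 'a \<Rightarrow> 'f::ab_group_add"
  assumes "finite A" "\<And>u v. g u v = - g v u" "\<And>u. g u u = 0"
  shows "(\<Sum>u\<in>A. \<Sum>v\<in>A. g u v) = 0"
  using assms(1)
proof induction
  case (insert x A)
  have "(\<Sum>v\<in>A. g x v) = - (\<Sum>u\<in>A. g u x)"
    unfolding sum_negf[symmetric] by (intro sum.cong refl assms(2))
  with insert show ?case by (simp add: sum.distrib assms(3))
qed simp

lemma boundary_boundary:
  assumes K: "simplicial_complex K" and c: "c \<in> chains K i"
  shows "boundary K (boundary K c) = (\<lambda>_. 0)"
proof
  fix ys
  show "boundary K (boundary K c) ys = 0"
    unfolding boundary_def
  proof (rule sum_antisym_eq_0)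
    show "finite (vertices K)"
      using K by (simp add: simplicial_complex_def)
    show "c (v # u # ys) = - c (u # v # ys)" for u v
      using chains_swap[OF c, of "[]" v u ys] unfolding append_Nil .
    show "c (u # u # ys) = 0" for u
      using chains_nonzero(1)[OF c, of "u # u # ys"] by auto
  qed
qed

section \<open>Cohen-Macaulay complexes and depth\<close>

definition cohen_macaulay :: "'f::field itself \<Rightarrow> 'a set set \<Rightarrow> bool" where
  "cohen_macaulay F K \<longleftrightarrow>
     (\<forall>\<sigma>\<in>K. \<forall>i. i < complex_dim (link K \<sigma>) \<longrightarrow> reduced_homology_zero F (link K \<sigma>) i)"

text \<open>The dimension -1 is the least one for which a skeleton of a nonempty complex has a face.\<close>

definition depth :: "'f::field itself \<Rightarrow> 'a set set \<Rightarrow> int" where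
  "depth F K = Max {d. - 1 \<le> d \<and> d \<le> complex_dim K \<and> cohen_macaulay F (skeleton d K)}"

end

theory Submission
  imports Defs "HOL-Library.Poly_Mapping" "HOL-Library.Nat_Bijection"
begin

text \<open>The proof uses exterior algebraic shifting with respect to linear forms with algebraically
  independent coefficients. Shifting replaces an intersecting family \<open>A\<close> of \<open>r\<close>-faces by a family \<open>A'\<close>
  of the same size that is shifted and again intersecting, because \<open>x \<and> y = 0\<close> for chains \<open>x\<close>, \<open>y\<close>
  supported on \<open>A\<close>, and it replaces the complex by a complex \<open>K'\<close> containing \<open>A'\<close>. The Cohen-Macaulay
  property of the skeleton makes the multiplications with the generic forms successively exact, so
  that the smallest missing number can be added to each face of \<open>K'\<close> with at most \<open>depth\<close> elements.
  Reflecting a set of \<open>A'\<close> without \<open>0\<close>, read as a lattice path, at its last return to the axis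
  therefore gives injectively an \<open>r\<close>-face of \<open>K'\<close> that contains \<open>0\<close> and is not in \<open>A'\<close>. Hence \<open>|A|\<close> is at
  most the number of \<open>r\<close>-faces of \<open>K'\<close> containing \<open>0\<close>, which is the rank of the boundary map on
  \<open>r\<close>-faces, and in a near-cone this is at most the number of \<open>r\<close>-faces containing the apex.\<close>

section \<open>Linear algebra over integral domains\<close>

text \<open>The field is arbitrary and may be finite, so it need not contain algebraically
  independent coefficients. They are taken to be the variables of a polynomial ring, one for each
  row and vertex. This ring is only a domain: linear algebra is done by cross-multiplication, and a
  nonzero scalar replaces division. In return, the exponents give a multigrading that cuts the
  multiplication with one generic form into coboundaries of links with coefficients in the field
  itself, so that the Cohen-Macaulay condition applies without any change of field. Exactness on the
  joint kernel of several forms then rests on an induction on the degree in the variables.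

  The bound on \<open>r\<close> comes from the reflection. If a set of \<open>r\<close> elements
  last returns to the axis at \<open>2 * k\<close>, then its union with all numbers below
  \<open>2 * k\<close> has \<open>r + k \<le> 2 * r\<close> elements and contains the reflected set.
  This union is reached by adding missing numbers one at a time, which is possible up to
  \<open>depth + 1\<close> elements.\<close>

lemma homogeneous_system_nontrivial:
  fixes \<psi> :: "'e \<Rightarrow> 'x \<Rightarrow> 'r::idom"
  assumes "finite E" "finite X" "card E < card X"
  shows "\<exists>\<alpha>. (\<exists>x\<in>X. \<alpha> x \<noteq> 0) \<and> (\<forall>e\<in>E. (\<Sum>x\<in>X. \<alpha> x * \<psi> e x) = 0)"
  using assms
proof (induction E arbitrary: X \<psi> rule: finite_induct)
  case empty
  then have "X \<noteq> {}" by auto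
  then show ?case by (intro exI[of _ "\<lambda>_. 1"]) auto
next
  case (insert e E)
  show ?case
  proof (cases "\<forall>x\<in>X. \<psi> e x = 0")
    case True
    obtain \<alpha> where "\<exists>x\<in>X. \<alpha> x \<noteq> 0" "\<forall>e\<in>E. (\<Sum>x\<in>X. \<alpha> x * \<psi> e x) = 0"
      using insert.IH[of X \<psi>] insert.prems insert.hyps by auto
    with True show ?thesis by (intro exI[of _ \<alpha>]) auto
  next
    case False
    then obtain x0 where x0: "x0 \<in> X" "\<psi> e x0 \<noteq> 0" by auto
    \<comment> \<open>Elimination of \<open>x0\<close> by cross-multiplication with the pivot; the
      row of \<open>e\<close> itself becomes zero.\<close>
    define \<psi>' where "\<psi>' e' x = \<psi> e x0 * \<psi> e' x - \<psi> e x * \<psi> e' x0" for e' x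
    have "card E < card (X - {x0})"
      using insert.prems insert.hyps x0 by simp
    then obtain \<beta> where \<beta>: "\<exists>x\<in>X - {x0}. \<beta> x \<noteq> 0"
      "\<forall>e'\<in>E. (\<Sum>x\<in>X - {x0}. \<beta> x * \<psi>' e' x) = 0"
      using insert.IH[of "X - {x0}" \<psi>'] insert.prems by auto
    define \<alpha> where
      "\<alpha> x = (if x = x0 then - (\<Sum>x\<in>X - {x0}. \<beta> x * \<psi> e x) else \<psi> e x0 * \<beta> x)" for x
    have sum: "(\<Sum>x\<in>X. \<alpha> x * \<psi> e' x) = (\<Sum>x\<in>X - {x0}. \<beta> x * \<psi>' e' x)" for e'
    proof -
      have "(\<Sum>x\<in>X. \<alpha> x * \<psi> e' x) = \<alpha> x0 * \<psi> e' x0 + (\<Sum>x\<in>X - {x0}. \<alpha> x * \<psi> e' x)"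
        by (rule sum.remove) (use insert.prems x0 in auto)
      also have "(\<Sum>x\<in>X - {x0}. \<alpha> x * \<psi> e' x) = (\<Sum>x\<in>X - {x0}. \<psi> e x0 * \<beta> x * \<psi> e' x)"
        by (intro sum.cong) (auto simp: \<alpha>_def)
      finally show ?thesis
        by (simp add: \<alpha>_def \<psi>'_def sum_distrib_right sum_distrib_left right_diff_distrib
            sum_subtractf algebra_simps)
    qed
    have "(\<Sum>x\<in>X - {x0}. \<beta> x * \<psi>' e x) = 0"
      by (simp add: \<psi>'_def algebra_simps)
    with \<beta>(2) have "\<forall>e'\<in>insert e E. (\<Sum>x\<in>X. \<alpha> x * \<psi> e' x) = 0"
      by (simp add: sum)
    moreover obtain x where "x \<in> X - {x0}" "\<beta> x \<noteq> 0" using \<beta>(1) by blast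
    then have "x \<in> X" "\<alpha> x \<noteq> 0" using x0 by (auto simp: \<alpha>_def)
    ultimately show ?thesis by blast
  qed
qed

text \<open>The Fredholm alternative without division: membership in the span holds only up to the
  nonzero factor \<open>d\<close>. It transfers exactness between cochains and chains.\<close>

lemma span_or_separating_functional:
  fixes u :: "'k \<Rightarrow> 'x \<Rightarrow> 'r::idom"
  assumes "finite P" "finite N"
  shows "(\<exists>d \<beta>. d \<noteq> 0 \<and> (\<forall>x\<in>N. d * y x = (\<Sum>k\<in>P. \<beta> k * u k x))) \<or>
    (\<exists>\<phi>. (\<forall>k\<in>P. (\<Sum>x\<in>N. \<phi> x * u k x) = 0) \<and> (\<Sum>x\<in>N. \<phi> x * y x) \<noteq> 0)"
  using assms(1)
proof (induction P arbitrary: y rule: finite_induct)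
  case empty
  show ?case
  proof (cases "\<forall>x\<in>N. y x = 0")
    case True
    then show ?thesis by (intro disjI1 exI[of _ 1]) auto
  next
    case False
    then obtain x where "x \<in> N" "y x \<noteq> 0" by auto
    then have "(\<Sum>z\<in>N. (if z = x then 1 else 0) * y z) \<noteq> 0"
      using assms(2) by (simp add: if_distrib[of "\<lambda>c. c * _"] cong: if_cong)
    then show ?thesis by (intro disjI2 exI[of _ "\<lambda>z. if z = x then 1 else 0"]) auto
  qed
next
  case (insert p P)
  define pr where "pr \<phi> z = (\<Sum>x\<in>N. \<phi> x * z x)" for \<phi> z :: "'x \<Rightarrow> 'r"
  have pr_lin: "pr \<phi> (\<lambda>x. a * z x - b * w x) = a * pr \<phi> z - b * pr \<phi> w" for \<phi> z w a b
    by (simp add: pr_def sum_distrib_left sum_subtractf algebra_simps)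
  have pr_lin2: "pr (\<lambda>x. a * \<phi> x - b * \<phi>' x) z = a * pr \<phi> z - b * pr \<phi>' z" for \<phi> \<phi>' z a b
    by (simp add: pr_def sum_distrib_left sum_subtractf algebra_simps)
  from insert.IH[of "u p"] show ?case
  proof (elim disjE exE conjE)
    fix d \<beta> assume d: "d \<noteq> 0" "\<forall>x\<in>N. d * u p x = (\<Sum>k\<in>P. \<beta> k * u k x)"
    from insert.IH[of y] show ?thesis
    proof (elim disjE exE conjE)
      fix d' \<beta>' assume *: "d' \<noteq> 0" "\<forall>x\<in>N. d' * y x = (\<Sum>k\<in>P. \<beta>' k * u k x)"
      have "(\<Sum>k\<in>insert p P. (\<beta>'(p := 0)) k * u k x) = (\<Sum>k\<in>P. \<beta>' k * u k x)" for x
      proof -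
        have "(\<Sum>k\<in>insert p P. (\<beta>'(p := 0)) k * u k x) = (\<Sum>k\<in>P. (\<beta>'(p := 0)) k * u k x)"
          using insert.hyps by simp
        also have "\<dots> = (\<Sum>k\<in>P. \<beta>' k * u k x)"
          using insert.hyps by (intro sum.cong) auto
        finally show ?thesis .
      qed
      then show ?thesis using * by (intro disjI1 exI[of _ d'] exI[of _ "\<beta>'(p := 0)"]) auto
    next
      fix \<phi> assume *: "\<forall>k\<in>P. (\<Sum>x\<in>N. \<phi> x * u k x) = 0" "(\<Sum>x\<in>N. \<phi> x * y x) \<noteq> 0"
      have "d * pr \<phi> (u p) = pr \<phi> (\<lambda>x. d * u p x)"
        by (simp add: pr_def sum_distrib_left algebra_simps)
      also have "\<dots> = (\<Sum>x\<in>N. \<Sum>k\<in>P. \<beta> k * (\<phi> x * u k x))"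
        unfolding pr_def using d by (intro sum.cong) (auto simp: sum_distrib_left algebra_simps)
      also have "\<dots> = (\<Sum>k\<in>P. \<beta> k * (\<Sum>x\<in>N. \<phi> x * u k x))"
        by (subst sum.swap) (simp add: sum_distrib_left)
      also have "\<dots> = 0" using * by simp
      finally have "pr \<phi> (u p) = 0" using d by simp
      then show ?thesis using * by (intro disjI2 exI[of _ \<phi>]) (auto simp: pr_def)
    qed
  next
    fix \<phi>0 assume \<phi>0: "\<forall>k\<in>P. (\<Sum>x\<in>N. \<phi>0 x * u k x) = 0" "(\<Sum>x\<in>N. \<phi>0 x * u p x) \<noteq> 0"
    \<comment> \<open>Since \<open>\<phi>0\<close> separates \<open>u p\<close>, a multiple of
      \<open>u p\<close> can be subtracted to make \<open>y'\<close> orthogonal to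
      \<open>\<phi>0\<close>.\<close>
    define y' where "y' x = pr \<phi>0 (u p) * y x - pr \<phi>0 y * u p x" for x
    from insert.IH[of y'] show ?thesis
    proof (elim disjE exE conjE)
      fix d \<beta> assume *: "d \<noteq> 0" "\<forall>x\<in>N. d * y' x = (\<Sum>k\<in>P. \<beta> k * u k x)"
      define \<beta>' where "\<beta>' = \<beta>(p := d * pr \<phi>0 y)"
      have "(d * pr \<phi>0 (u p)) * y x = (\<Sum>k\<in>insert p P. \<beta>' k * u k x)" if "x \<in> N" for x
      proof -
        have "(\<Sum>k\<in>insert p P. \<beta>' k * u k x) = d * pr \<phi>0 y * u p x + (\<Sum>k\<in>P. \<beta>' k * u k x)"
          using insert.hyps by (simp add: \<beta>'_def)
        also have "(\<Sum>k\<in>P. \<beta>' k * u k x) = (\<Sum>k\<in>P. \<beta> k * u k x)"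
          using insert.hyps by (intro sum.cong) (auto simp: \<beta>'_def)
        also have "\<dots> = d * y' x" using * that by simp
        finally show ?thesis by (simp add: y'_def algebra_simps)
      qed
      moreover have "d * pr \<phi>0 (u p) \<noteq> 0" using * \<phi>0 by (simp add: pr_def)
      ultimately show ?thesis by blast
    next
      fix \<phi> assume *: "\<forall>k\<in>P. (\<Sum>x\<in>N. \<phi> x * u k x) = 0" "(\<Sum>x\<in>N. \<phi> x * y' x) \<noteq> 0"
      \<comment> \<open>The dual correction: \<open>\<phi>'\<close> kills \<open>u p\<close> and
        takes on \<open>y\<close> the value that \<phi> takes on \<open>y'\<close>.\<close>
      define \<phi>' where "\<phi>' x = pr \<phi>0 (u p) * \<phi> x - pr \<phi> (u p) * \<phi>0 x" for x
      have "pr \<phi>' (u k) = 0" if "k \<in> insert p P" for k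
        unfolding \<phi>'_def pr_lin2 using that * \<phi>0 by (auto simp: pr_def)
      moreover have "pr \<phi>' y \<noteq> 0"
      proof -
        have "pr \<phi> y' = pr \<phi>0 (u p) * pr \<phi> y - pr \<phi>0 y * pr \<phi> (u p)"
          unfolding y'_def by (rule pr_lin)
        then have "pr \<phi>' y = pr \<phi> y'"
          unfolding \<phi>'_def pr_lin2 by (simp add: algebra_simps)
        then show ?thesis using * by (simp add: pr_def)
      qed
      ultimately show ?thesis by (intro disjI2 exI[of _ \<phi>']) (auto simp: pr_def)
    qed
  qed
qed

section \<open>Shifted families of sets\<close>

text \<open>On sets of equal size this is the lexicographic order of the increasing
  enumerations.\<close>

definition lexless :: "nat set \<Rightarrow> nat set \<Rightarrow> bool" where
  "lexless R S \<longleftrightarrow> (\<exists>p. p \<in> R \<and> p \<notin> S \<and> (\<forall>q<p. q \<in> R \<longleftrightarrow> q \<in> S))"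

text \<open>The family may be infinite. A minimal member has to contain the least number
  \<open>p\<close> that occurs anywhere, and the recursion runs on the members through
  \<open>p\<close> with \<open>p\<close> removed.\<close>

lemma lexless_minimal:
  assumes "\<And>S. S \<in> \<F> \<Longrightarrow> finite S \<and> card S = r" "\<F> \<noteq> {}"
  shows "\<exists>S\<in>\<F>. \<forall>R\<in>\<F>. \<not> lexless R S"
  using assms
proof (induction r arbitrary: \<F>)
  case 0
  then have "S = {}" if "S \<in> \<F>" for S using that by fastforce
  with 0 have "\<F> = {{}}" by blast
  then show ?case by (auto simp: lexless_def)
next
  case (Suc r)
  define p where "p = (LEAST p. \<exists>S\<in>\<F>. p \<in> S)"
  have ex: "\<exists>p. \<exists>S\<in>\<F>. p \<in> S"
    using Suc.prems by (metis card.empty equals0I nat.distinct(1))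
  have p: "\<exists>S\<in>\<F>. p \<in> S" unfolding p_def by (rule LeastI_ex[OF ex])
  have pmin: "p \<le> q" if "q \<in> S" "S \<in> \<F>" for q S
    unfolding p_def by (rule Least_le) (use that in blast)
  define \<G> where "\<G> = {S - {p} | S. S \<in> \<F> \<and> p \<in> S}"
  have "\<exists>S\<in>\<G>. \<forall>R\<in>\<G>. \<not> lexless R S"
    by (rule Suc.IH) (use Suc.prems(1) p in \<open>auto simp: \<G>_def\<close>)
  then obtain S where S: "S \<in> \<F>" "p \<in> S" "\<forall>R\<in>\<G>. \<not> lexless R (S - {p})"
    unfolding \<G>_def by blast
  have "\<not> lexless R S" if R: "R \<in> \<F>" for R
  proof
    assume "lexless R S"
    then obtain q where q: "q \<in> R" "q \<notin> S" "\<forall>x<q. x \<in> R \<longleftrightarrow> x \<in> S"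
      by (auto simp: lexless_def)
    then have "p < q" using S pmin[OF _ R] by (metis le_neq_implies_less)
    then have "p \<in> R" using q S by blast
    then have "\<not> lexless (R - {p}) (S - {p})" using S(3) R by (auto simp: \<G>_def)
    moreover have "lexless (R - {p}) (S - {p})"
      unfolding lexless_def using q \<open>p < q\<close> by (intro exI[of _ q]) auto
    ultimately show False by contradiction
  qed
  with S(1) show ?case by blast
qed

text \<open>The transposition maps \<open>T\<close> to \<open>insert i (T - {j})\<close>. So when
  two rows are exchanged, a coordinate before the new set can only come from a coordinate before
  \<open>T\<close>.\<close>

lemma lexless_transpose:
  assumes "i < j" "j \<in> T" "i \<notin> T" and R: "lexless R (insert i (T - {j}))"
  shows "lexless (id(i := j, j := i) ` R) T"
proof -
  let ?s = "id(i := j, j := i)"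
  let ?S = "insert i (T - {j})"
  have mem: "x \<in> ?s ` R \<longleftrightarrow> ?s x \<in> R" for x
    using assms(1) by (auto simp: image_iff)
  obtain p where p: "p \<in> R" "p \<notin> ?S" "\<And>q. q < p \<Longrightarrow> q \<in> R \<longleftrightarrow> q \<in> ?S"
    using R by (auto simp: lexless_def)
  have pi: "p \<noteq> i" using p by auto
  consider "p < i" | "i < p" "j \<in> R" | "i < p" "j \<notin> R" using pi by linarith
  then show ?thesis
  proof cases
    case 1
    show ?thesis unfolding lexless_def mem
      by (rule exI[of _ p]) (use 1 p assms in auto)
  next
    \<comment> \<open>Here the swap puts \<open>i\<close> into the image of \<open>R\<close>, so the
      first difference from \<open>T\<close> is already at \<open>i\<close>.\<close>
    case 2
    have "i \<in> R" using p 2 by auto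
    show ?thesis unfolding lexless_def mem
    proof (rule exI[of _ i], intro conjI allI impI)
      show "?s i \<in> R" using 2 assms by auto
      show "i \<notin> T" by fact
      fix q assume "q < i"
      then show "(?s q \<in> R) = (q \<in> T)" using p(3)[of q] 2 assms by auto
    qed
  next
    case 3
    have pj: "p \<noteq> j" using p 3 by auto
    have iR: "i \<in> R" using p(3)[of i] 3 by auto
    show ?thesis unfolding lexless_def mem
    proof (rule exI[of _ p], intro conjI allI impI)
      show "?s p \<in> R" using p pi pj by auto
      show "p \<notin> T" using p pi pj by auto
      fix q assume "q < p"
      then show "(?s q \<in> R) = (q \<in> T)" using p(3)[of q] 3 assms iR by auto
    qed
  qed
qed

text \<open>Moving elements down: the prefix counts of \<open>X\<close> are dominated by those of \<open>Y\<close>, so that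
  the elements of \<open>X\<close> can be exchanged for smaller elements of \<open>Y\<close>, starting with the largest.\<close>

lemma shifted_exchange:
  fixes P :: "nat set set"
  assumes shift: "\<And>T i j. T \<in> P \<Longrightarrow> j \<in> T \<Longrightarrow> i \<notin> T \<Longrightarrow> i < j \<Longrightarrow> insert i (T - {j}) \<in> P"
    and "finite X" "finite Y" "X \<inter> Y = {}" "C \<inter> (X \<union> Y) = {}" "C \<union> X \<in> P"
    and "\<And>m. card (X \<inter> {..<m}) \<le> card (Y \<inter> {..<m})"
  shows "\<exists>Y'\<subseteq>Y. C \<union> Y' \<in> P"
  using assms(2-)
proof (induction "card X" arbitrary: X Y C)
  case 0
  then have "X = {}" by simp
  with 0 have "C \<in> P" by simp
  then show ?case by (intro exI[of _ "{}"]) simp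
next
  case (Suc k)
  then have "X \<noteq> {}" by auto
  define x where "x = Max X"
  have x: "x \<in> X" "\<And>z. z \<in> X \<Longrightarrow> z \<le> x"
    using Suc.prems \<open>X \<noteq> {}\<close> by (auto simp: x_def)
  have Xx: "X \<inter> {..<Suc x} = X" using x by (auto simp: less_Suc_eq_le)
  have cY: "card X \<le> card (Y \<inter> {..<x})"
  proof -
    have "Y \<inter> {..<Suc x} = Y \<inter> {..<x}" using x Suc.prems by (auto simp: less_Suc_eq)
    then show ?thesis using Suc.prems(6)[of "Suc x"] Xx by simp
  qed
  then have ne: "Y \<inter> {..<x} \<noteq> {}" using Suc.hyps by auto
  \<comment> \<open>The largest choice keeps the domination: prefixes up to \<open>y\<close> do not
    change, and longer ones contain all of \<open>Y\<close> below \<open>x\<close>, which is at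
    least as large as \<open>X\<close>.\<close>
  define y where "y = Max (Y \<inter> {..<x})"
  have "y \<in> Y \<inter> {..<x}" unfolding y_def by (rule Max_in) (use ne in auto)
  then have y: "y \<in> Y" "y < x" by auto
  have ymax: "z \<le> y" if "z \<in> Y" "z < x" for z
    unfolding y_def by (rule Max_ge) (use that in auto)
  have cond: "card ((X - {x}) \<inter> {..<m}) \<le> card ((Y - {y}) \<inter> {..<m})" for m
  proof (cases "m \<le> y")
    case True
    then have "(X - {x}) \<inter> {..<m} = X \<inter> {..<m}" "(Y - {y}) \<inter> {..<m} = Y \<inter> {..<m}"
      using y by auto
    then show ?thesis using Suc.prems(6)[of m] by simp
  next
    case False
    have "card ((X - {x}) \<inter> {..<m}) \<le> card (X - {x})"
      by (rule card_mono) (use Suc.prems in auto)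
    also have "\<dots> = card X - 1" using x Suc.prems by simp
    also have "\<dots> \<le> card (Y \<inter> {..<x}) - 1" using cY by simp
    also have "\<dots> = card (Y \<inter> {..<x} - {y})" using y by simp
    also have "\<dots> \<le> card ((Y - {y}) \<inter> {..<m})"
      by (rule card_mono) (use False ymax in \<open>force+\<close>)
    finally show ?thesis .
  qed
  have "insert y (C \<union> X - {x}) \<in> P"
    by (rule shift) (use Suc.prems x y in auto)
  moreover have "insert y (C \<union> X - {x}) = insert y C \<union> (X - {x})"
    using Suc.prems x by auto
  ultimately have "insert y C \<union> (X - {x}) \<in> P" by simp
  moreover have "k = card (X - {x})" using Suc.hyps(2) x Suc.prems(1) by simp
  moreover have "(X - {x}) \<inter> (Y - {y}) = {}" "insert y C \<inter> (X - {x} \<union> (Y - {y})) = {}"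
    using Suc.prems(3,4) y by auto
  ultimately have "\<exists>Y'\<subseteq>Y - {y}. insert y C \<union> Y' \<in> P"
    using Suc.hyps(1)[of "X - {x}" "Y - {y}" "insert y C"] Suc.prems(1,2) cond by simp
  then obtain Y' where "Y' \<subseteq> Y - {y}" "insert y C \<union> Y' \<in> P" by blast
  with y show ?case by (intro exI[of _ "insert y Y'"]) auto
qed

text \<open>A set \<open>S\<close> is read as a lattice path that goes up at the elements of \<open>S\<close> and down elsewhere. Its
  last return to the axis is at \<open>2 * last_balance S\<close>, and \<open>reflect\<close> flips the path up to this point.\<close>

definition last_balance :: "nat set \<Rightarrow> nat" where
  "last_balance S = (GREATEST k. k \<le> card (S \<inter> {..<2 * k}))"

definition reflect :: "nat set \<Rightarrow> nat set" where
  "reflect S = ({..<2 * last_balance S} - S) \<union> (S - {..<2 * last_balance S})"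

text \<open>The greatest \<open>k\<close> exists because the condition forces
  \<open>k \<le> card S\<close>. Equality holds there since counts only grow, and two positions
  later the count is still at most \<open>last_balance S\<close>.\<close>

lemma last_balance:
  assumes "finite S"
  shows "card (S \<inter> {..<2 * last_balance S}) = last_balance S"
    and "\<And>k. last_balance S < k \<Longrightarrow> card (S \<inter> {..<2 * k}) < k"
    and "last_balance S \<le> card S"
proof -
  have bound: "k \<le> card S" if "k \<le> card (S \<inter> {..<2 * k})" for k
    using that card_mono[of S "S \<inter> {..<2 * k}"] assms by auto
  have ge: "last_balance S \<le> card (S \<inter> {..<2 * last_balance S})"
    unfolding last_balance_def by (rule GreatestI_nat[of _ 0 "card S"]) (use bound in auto)
  show less: "card (S \<inter> {..<2 * k}) < k" if "last_balance S < k" for k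
  proof (rule ccontr)
    assume "\<not> ?thesis"
    then have "k \<le> last_balance S"
      unfolding last_balance_def by (intro Greatest_le_nat[of _ _ "card S"]) (use bound in auto)
    with that show False by simp
  qed
  have "card (S \<inter> {..<2 * last_balance S}) \<le> card (S \<inter> {..<2 * Suc (last_balance S)})"
    by (intro card_mono) (use assms in auto)
  with less[of "Suc (last_balance S)"] ge
  show "card (S \<inter> {..<2 * last_balance S}) = last_balance S" by simp
  show "last_balance S \<le> card S" by (rule bound) (rule ge)
qed

lemma last_balance_unique:
  assumes "finite S" "k \<le> card (S \<inter> {..<2 * k})" "\<And>l. k < l \<Longrightarrow> card (S \<inter> {..<2 * l}) < l"
  shows "last_balance S = k"
proof (rule antisym)
  show "last_balance S \<le> k"
    using assms(3)[of "last_balance S"] last_balance(1)[OF assms(1)] by linarith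
  show "k \<le> last_balance S"
    using last_balance(2)[OF assms(1), of k] assms(2) by linarith
qed

context
  fixes S :: "nat set"
  assumes fin: "finite S"
begin

private abbreviation "k \<equiv> last_balance S"

lemma finite_reflect: "finite (reflect S)"
  using fin by (simp add: reflect_def)

lemma card_prefix_diff: "card ({..<2 * k} - S) = k"
proof -
  have "card ({..<2 * k} - S) = card {..<2 * k} - card ({..<2 * k} \<inter> S)"
    by (rule card_Diff_subset_Int) auto
  then show ?thesis using last_balance(1)[OF fin] by (simp add: Int_commute)
qed

text \<open>Exactly half of the numbers below \<open>2 * k\<close> lie in \<open>S\<close>, so
  complementing this block preserves its count, and later positions stay as they are.\<close>

lemma card_reflect_prefix:
  assumes "k \<le> l"
  shows "card (reflect S \<inter> {..<2 * l}) = card (S \<inter> {..<2 * l})"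
proof -
  have "card (reflect S \<inter> {..<2 * l}) = card ({..<2 * k} - S) + card ((S - {..<2 * k}) \<inter> {..<2 * l})"
    by (subst card_Un_disjoint[symmetric])
      (use fin assms in \<open>auto simp: reflect_def intro!: arg_cong[of _ _ card]\<close>)
  also have "\<dots> = card (S \<inter> {..<2 * k}) + card ((S - {..<2 * k}) \<inter> {..<2 * l})"
    using card_prefix_diff last_balance(1)[OF fin] by simp
  also have "\<dots> = card (S \<inter> {..<2 * l})"
    by (subst card_Un_disjoint[symmetric])
      (use fin assms in \<open>auto intro!: arg_cong[of _ _ card]\<close>)
  finally show ?thesis .
qed

lemma card_reflect: "card (reflect S) = card S"
proof -
  obtain m where m: "\<forall>x\<in>S \<union> reflect S. x < m"
    using fin finite_reflect finite_nat_set_iff_bounded by blast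
  let ?l = "m + k"
  have "S \<inter> {..<2 * ?l} = S" "reflect S \<inter> {..<2 * ?l} = reflect S"
    using m by (auto 0 3 dest: bspec)
  with card_reflect_prefix[of ?l] show ?thesis by simp
qed

lemma last_balance_reflect: "last_balance (reflect S) = k"
proof (rule last_balance_unique[OF finite_reflect])
  show "k \<le> card (reflect S \<inter> {..<2 * k})"
    by (simp add: card_reflect_prefix last_balance(1)[OF fin])
  show "card (reflect S \<inter> {..<2 * l}) < l" if "k < l" for l
    using that by (simp add: card_reflect_prefix last_balance(2)[OF fin])
qed

text \<open>The reflected path has its last return at the same place, so the same block is flipped
  back. This gives injectivity of the reflection.\<close>

lemma reflect_reflect: "reflect (reflect S) = S"
  unfolding reflect_def[of "reflect S"] last_balance_reflect
  by (auto simp: reflect_def)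

lemma reflect_subset: "reflect S \<subseteq> S \<union> {..<2 * k}"
  by (auto simp: reflect_def)

lemma card_Un_prefix: "card (S \<union> {..<2 * k}) = card S + k"
proof -
  have "card (S \<union> {..<2 * k}) = card (S \<union> ({..<2 * k} - S))" by simp
  also have "\<dots> = card S + k"
    by (subst card_Un_disjoint) (use fin card_prefix_diff in auto)
  finally show ?thesis .
qed

end

text \<open>After the last return, every segment starting at \<open>2 * k\<close> has at least as
  many gaps as elements of \<open>S\<close>. Shiftedness therefore moves the tail \<open>X\<close>
  of \<open>S\<close> into the gaps \<open>Y\<close>, which would give a member of \<open>P\<close>
  disjoint from the reflection.\<close>

lemma reflect_notin_shifted_intersecting:
  assumes shift: "\<And>T i j. T \<in> P \<Longrightarrow> j \<in> T \<Longrightarrow> i \<notin> T \<Longrightarrow> i < j \<Longrightarrow> insert i (T - {j}) \<in> P"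
    and inter: "\<And>S T. S \<in> P \<Longrightarrow> T \<in> P \<Longrightarrow> S \<inter> T \<noteq> {}"
    and S: "S \<in> P" "finite S"
  shows "reflect S \<notin> P"
proof
  assume P: "reflect S \<in> P"
  define k where "k = last_balance S"
  define X where "X = S - {..<2 * k}"
  obtain M where M: "\<forall>x\<in>S. x < M" using S(2) finite_nat_set_iff_bounded by blast
  \<comment> \<open>\<open>shifted_exchange\<close> needs a finite set of gaps; beyond a bound
    \<open>M\<close> of \<open>S\<close> none are required.\<close>
  define Y where "Y = {2 * k..<M} - S"
  have lt: "card (S \<inter> {..<2 * l}) < l" if "k < l" for l
    using last_balance(2)[OF S(2)] that by (simp add: k_def)
  have split: "card (S \<inter> {..<m}) = k + card (X \<inter> {..<m})" if "2 * k \<le> m" for m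
  proof -
    have "S \<inter> {..<m} = (S \<inter> {..<2 * k}) \<union> (X \<inter> {..<m})" using that by (auto simp: X_def)
    moreover have "card ((S \<inter> {..<2 * k}) \<union> (X \<inter> {..<m})) = card (S \<inter> {..<2 * k}) + card (X \<inter> {..<m})"
      by (rule card_Un_disjoint) (use S in \<open>auto simp: X_def\<close>)
    ultimately show ?thesis using last_balance(1)[OF S(2)] by (simp add: k_def)
  qed
  \<comment> \<open>\<open>last_balance\<close> controls even prefixes only. An odd one is compared
    with the next even one, where strictness makes up for the extra position.\<close>
  have half: "2 * card (X \<inter> {..<m}) \<le> m - 2 * k" if m: "2 * k \<le> m" for m
  proof -
    define l where "l = m div 2"
    have l: "m = 2 * l \<or> m = 2 * l + 1" "k \<le> l" using m unfolding l_def by presburger+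
    show ?thesis
    proof (cases "m = 2 * l")
      case True
      show ?thesis
      proof (cases "k = l")
        case True
        then show ?thesis using \<open>m = 2 * l\<close> by (auto simp: X_def)
      next
        case False
        then show ?thesis using lt[of l] split[OF m] True l by simp
      qed
    next
      case False
      then have m': "m = 2 * l + 1" using l by simp
      have "card (X \<inter> {..<m}) \<le> card (X \<inter> {..<2 * Suc l})"
        by (rule card_mono) (use S m' in \<open>auto simp: X_def\<close>)
      also have "\<dots> \<le> l - k" using lt[of "Suc l"] split[of "2 * Suc l"] l by simp
      finally show ?thesis using m' l by simp
    qed
  qed
  have dom: "card (X \<inter> {..<m}) \<le> card (Y \<inter> {..<m})" for m
  proof -
    consider "m < 2 * k" | "2 * k \<le> m" "m \<le> M" | "2 * k \<le> m" "M < m" by linarith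
    then show ?thesis
    proof cases
      case 1
      then have "X \<inter> {..<m} = {}" by (auto simp: X_def)
      then show ?thesis by simp
    next
      case 2
      have "Y \<inter> {..<m} = {2 * k..<m} - X \<inter> {..<m}" using 2 by (auto simp: X_def Y_def)
      moreover have "card ({2 * k..<m} - X \<inter> {..<m}) = m - 2 * k - card (X \<inter> {..<m})"
        by (subst card_Diff_subset) (use S in \<open>auto simp: X_def\<close>)
      ultimately show ?thesis using half[OF 2(1)] by simp
    next
      case 3
      show ?thesis
      proof (cases "X = {}")
        case False
        then have kM: "2 * k \<le> M" using M by (force simp: X_def)
        have "Y = {2 * k..<M} - X \<inter> {..<M}" by (auto simp: X_def Y_def)
        moreover have "card ({2 * k..<M} - X \<inter> {..<M}) = M - 2 * k - card (X \<inter> {..<M})"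
          by (subst card_Diff_subset) (use S in \<open>auto simp: X_def\<close>)
        moreover have "Y \<inter> {..<m} = Y" "X \<inter> {..<m} = X \<inter> {..<M}"
          using 3 M by (auto simp: Y_def X_def)
        ultimately show ?thesis using half[OF kM] by simp
      qed simp
    qed
  qed
  have "\<exists>Y'\<subseteq>Y. (S \<inter> {..<2 * k}) \<union> Y' \<in> P"
  proof (rule shifted_exchange[where X = X])
    show "insert i (T - {j}) \<in> P" if "T \<in> P" "j \<in> T" "i \<notin> T" "i < j" for T i j
      by (rule shift) fact+
    have "(S \<inter> {..<2 * k}) \<union> X = S" by (auto simp: X_def)
    then show "(S \<inter> {..<2 * k}) \<union> X \<in> P" using S by simp
  qed (use S dom in \<open>auto simp: X_def Y_def\<close>)
  then obtain Y' where Y': "Y' \<subseteq> Y" "(S \<inter> {..<2 * k}) \<union> Y' \<in> P" by blast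
  have "reflect S \<inter> ((S \<inter> {..<2 * k}) \<union> Y') = {}"
    using Y'(1) by (auto simp: reflect_def Y_def k_def)
  with inter[OF P Y'(2)] show False by contradiction
qed

section \<open>Chains and cochains on vertex sets\<close>

lemma sum_offdiag_swap:
  fixes F :: "'a \<Rightarrow> 'a \<Rightarrow> 'r::comm_monoid_add"
  assumes "finite A"
  shows "(\<Sum>u\<in>A. \<Sum>v\<in>A - {u}. F u v) = (\<Sum>u\<in>A. \<Sum>v\<in>A - {u}. F v u)"
proof -
  have *: "(\<Sum>u\<in>A. \<Sum>v\<in>A - {u}. G u v) = (\<Sum>u\<in>A. \<Sum>v\<in>A. if v \<noteq> u then G u v else 0)"
    for G :: "'a \<Rightarrow> 'a \<Rightarrow> 'r"
    by (intro sum.cong sum.mono_neutral_cong_left) (use assms in auto)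
  show ?thesis
    unfolding * by (subst sum.swap) (intro sum.cong, auto)
qed

lemma sum_offdiag_antisym:
  fixes F :: "'a \<Rightarrow> 'a \<Rightarrow> 'r::ab_group_add"
  assumes "finite A" "\<And>u v. u \<in> A \<Longrightarrow> v \<in> A \<Longrightarrow> u \<noteq> v \<Longrightarrow> F u v = - F v u"
  shows "(\<Sum>u\<in>A. \<Sum>v\<in>A - {u}. F u v) = 0"
proof -
  define g where "g u v = (if u \<in> A \<and> v \<in> A \<and> u \<noteq> v then F u v else 0)" for u v
  have "(\<Sum>u\<in>A. \<Sum>v\<in>A. g u v) = 0"
  proof (rule sum_antisym_eq_0)
    show "g u v = - g v u" for u v
      using assms(2)[of u v] by (auto simp: g_def)
  qed (auto simp: g_def assms(1))
  moreover have "(\<Sum>v\<in>A - {u}. F u v) = (\<Sum>v\<in>A. g u v)" if "u \<in> A" for u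
    by (rule sum.mono_neutral_cong_left) (use assms(1) that in \<open>auto simp: g_def\<close>)
  ultimately show ?thesis by (simp cong: sum.cong)
qed

locale vertex_set =
  fixes V :: "'a set" and e :: "'a \<Rightarrow> nat"
  assumes finite_V [simp]: "finite V" and inj_e: "inj_on e V"
begin

text \<open>The sign of sorting \<open>v\<close> into the increasingly ordered \<tau>, that is, the
  incidence number of \<tau> in \<open>insert v \<tau>\<close>.\<close>

definition sg :: "'a \<Rightarrow> 'a set \<Rightarrow> 'r::comm_ring_1" where
  "sg v \<tau> = (- 1) ^ card {u \<in> \<tau> \<inter> V. e u < e v}"

lemma sg_sq [simp]: "sg v \<tau> * sg v \<tau> = 1"
  by (simp add: sg_def flip: power_mult_distrib)

lemma sg_sq_left [simp]: "sg v \<tau> * (sg v \<tau> * x) = x"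
  by (simp flip: mult.assoc)

lemma sg_empty [simp]: "sg v {} = 1"
  by (simp add: sg_def)

lemma sg_insert:
  assumes "u \<in> V" "u \<notin> \<tau>"
  shows "sg v (insert u \<tau>) = (if e u < e v then - sg v \<tau> else sg v \<tau>)"
proof (cases "e u < e v")
  case True
  then have "{w \<in> insert u \<tau> \<inter> V. e w < e v} = insert u {w \<in> \<tau> \<inter> V. e w < e v}"
    using assms by auto
  then have "card {w \<in> insert u \<tau> \<inter> V. e w < e v} = Suc (card {w \<in> \<tau> \<inter> V. e w < e v})"
    using assms by simp
  then show ?thesis using True by (simp only: sg_def) simp
next
  case False
  then have "{w \<in> insert u \<tau> \<inter> V. e w < e v} = {w \<in> \<tau> \<inter> V. e w < e v}" by auto
  then show ?thesis using False by (simp add: sg_def)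
qed

lemma e_neq: "u \<in> V \<Longrightarrow> v \<in> V \<Longrightarrow> u \<noteq> v \<Longrightarrow> e u < e v \<or> e v < e u"
  using inj_e by (auto simp: inj_on_def neq_iff[symmetric])

lemma sg_swap:
  assumes "u \<in> V" "v \<in> V" "u \<noteq> v" "u \<notin> \<tau>" "v \<notin> \<tau>"
  shows "sg u \<tau> * sg v (insert u \<tau>) = - (sg v \<tau> * sg u (insert v \<tau>))"
  using e_neq[OF assms(1-3)] assms by (auto simp: sg_insert mult.commute)

lemma sg_Un:
  assumes "\<tau> \<inter> \<rho> = {}"
  shows "sg v (\<tau> \<union> \<rho>) = sg v \<tau> * sg v \<rho>"
proof -
  have "{u \<in> (\<tau> \<union> \<rho>) \<inter> V. e u < e v} = {u \<in> \<tau> \<inter> V. e u < e v} \<union> {u \<in> \<rho> \<inter> V. e u < e v}"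
    by auto
  moreover have "{u \<in> \<tau> \<inter> V. e u < e v} \<inter> {u \<in> \<rho> \<inter> V. e u < e v} = {}" using assms by auto
  ultimately show ?thesis by (simp add: sg_def card_Un_disjoint power_add)
qed

text \<open>A chain assigns a coefficient to each face, oriented by the order \<open>e\<close> of the vertices. The
  operator \<open>bd f\<close> is the contraction of the exterior algebra with the linear form \<open>f\<close>; its transpose
  \<open>om K f\<close> is the multiplication with \<open>f\<close> in the exterior face algebra of \<open>K\<close>.\<close>

definition bd :: "('a \<Rightarrow> 'r::comm_ring_1) \<Rightarrow> ('a set \<Rightarrow> 'r) \<Rightarrow> 'a set \<Rightarrow> 'r" where
  "bd f c \<tau> = (if \<tau> \<subseteq> V then \<Sum>v\<in>V - \<tau>. sg v \<tau> * (f v * c (insert v \<tau>)) else 0)"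

definition om :: "'a set set \<Rightarrow> ('a \<Rightarrow> 'r::comm_ring_1) \<Rightarrow> ('a set \<Rightarrow> 'r) \<Rightarrow> 'a set \<Rightarrow> 'r" where
  "om K f \<phi> \<sigma> = (if \<sigma> \<in> K then \<Sum>v\<in>\<sigma>. sg v (\<sigma> - {v}) * (f v * \<phi> (\<sigma> - {v})) else 0)"

definition chain :: "'a set set \<Rightarrow> nat \<Rightarrow> ('a set \<Rightarrow> 'r::zero) \<Rightarrow> bool" where
  "chain K p c \<longleftrightarrow> (\<forall>\<sigma>. c \<sigma> \<noteq> 0 \<longrightarrow> \<sigma> \<in> K \<and> card \<sigma> = p)"

lemma chainD: "chain K p c \<Longrightarrow> c \<sigma> \<noteq> 0 \<Longrightarrow> \<sigma> \<in> K \<and> card \<sigma> = p"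
  by (auto simp: chain_def)

lemma chain_mono: "chain K p c \<Longrightarrow> K \<subseteq> L \<Longrightarrow> chain L p c"
  by (auto simp: chain_def)

lemma chain_zero [simp]: "chain K p (\<lambda>_. 0)"
  by (simp add: chain_def)

lemma bd_anticommute: "bd f (bd g c) = (\<lambda>\<tau>. - bd g (bd f c) \<tau>)"
proof
  fix \<tau> :: "'a set"
  show "bd f (bd g c) \<tau> = - bd g (bd f c) \<tau>"
  proof (cases "\<tau> \<subseteq> V")
    case True
    have expand: "bd f (bd g c) \<tau> = (\<Sum>u\<in>V - \<tau>. \<Sum>v\<in>V - \<tau> - {u}.
        sg u \<tau> * sg v (insert u \<tau>) * (f u * g v * c (insert v (insert u \<tau>))))" for f g
    proof -
      have "V - insert u \<tau> = V - \<tau> - {u}" for u by auto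
      then show ?thesis
        using True by (auto simp: bd_def sum_distrib_left mult_ac intro!: sum.cong)
    qed
    show ?thesis
      unfolding expand sum_negf[symmetric]
    proof (subst sum_offdiag_swap, simp, intro sum.cong refl)
      fix u v assume "u \<in> V - \<tau>" "v \<in> V - \<tau> - {u}"
      then have sw: "sg v \<tau> * sg u (insert v \<tau>) = - (sg u \<tau> * sg v (insert u \<tau>))"
        by (intro sg_swap) auto
      have ins: "insert u (insert v \<tau>) = insert v (insert u \<tau>)" by auto
      show "sg v \<tau> * sg u (insert v \<tau>) * (f v * g u * c (insert u (insert v \<tau>))) =
          - (sg u \<tau> * sg v (insert u \<tau>) * (g u * f v * c (insert v (insert u \<tau>))))"
        unfolding sw ins by (simp add: mult.commute)
    qed
  qed (simp add: bd_def)
qed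

text \<open>Anticommutation would only show that twice the value is zero, which says nothing in
  characteristic two; hence the direct cancellation in pairs.\<close>

lemma bd_bd: "bd f (bd f c) = (\<lambda>_. 0)"
proof
  fix \<tau> :: "'a set"
  show "bd f (bd f c) \<tau> = 0"
  proof (cases "\<tau> \<subseteq> V")
    case True
    have "V - insert u \<tau> = V - \<tau> - {u}" for u by auto
    then have "bd f (bd f c) \<tau> = (\<Sum>u\<in>V - \<tau>. \<Sum>v\<in>V - \<tau> - {u}.
        sg u \<tau> * sg v (insert u \<tau>) * (f u * f v * c (insert v (insert u \<tau>))))"
      using True by (auto simp: bd_def sum_distrib_left mult_ac intro!: sum.cong)
    also have "\<dots> = 0"
    proof (rule sum_offdiag_antisym)
      fix u v assume "u \<in> V - \<tau>" "v \<in> V - \<tau>" "u \<noteq> v"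
      then have sw: "sg v \<tau> * sg u (insert v \<tau>) = - (sg u \<tau> * sg v (insert u \<tau>))"
        by (intro sg_swap) auto
      have ins: "insert u (insert v \<tau>) = insert v (insert u \<tau>)" by auto
      show "sg u \<tau> * sg v (insert u \<tau>) * (f u * f v * c (insert v (insert u \<tau>))) =
          - (sg v \<tau> * sg u (insert v \<tau>) * (f v * f u * c (insert u (insert v \<tau>))))"
        unfolding sw ins by (simp add: mult.commute)
    qed simp
    finally show ?thesis .
  qed (simp add: bd_def)
qed

lemma bd_chain:
  assumes "\<And>\<sigma> \<tau>. \<sigma> \<in> K \<Longrightarrow> \<tau> \<subseteq> \<sigma> \<Longrightarrow> \<tau> \<in> K" "chain K p c"
  shows "chain K (p - 1) (bd f c)" and "p = 0 \<Longrightarrow> bd f c = (\<lambda>_. 0)"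
proof -
  have *: "\<tau> \<in> K \<and> Suc (card \<tau>) = p" if nz: "bd f c \<tau> \<noteq> 0" for \<tau>
  proof -
    have "\<tau> \<subseteq> V" using nz by (auto simp: bd_def split: if_splits)
    then have "(\<Sum>v\<in>V - \<tau>. sg v \<tau> * (f v * c (insert v \<tau>))) \<noteq> 0"
      using nz by (simp add: bd_def)
    then obtain v where v: "v \<in> V - \<tau>" "sg v \<tau> * (f v * c (insert v \<tau>)) \<noteq> 0"
      by (rule sum.not_neutral_contains_not_neutral)
    then have "c (insert v \<tau>) \<noteq> 0" by auto
    with v have "insert v \<tau> \<in> K" "card (insert v \<tau>) = p" using chainD[OF assms(2)] by auto
    moreover have "finite \<tau>" using \<open>\<tau> \<subseteq> V\<close> finite_V by (rule finite_subset)
    ultimately show ?thesis using v assms(1)[of "insert v \<tau>" \<tau>] by auto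
  qed
  show "chain K (p - 1) (bd f c)" using * by (fastforce simp: chain_def)
  show "bd f c = (\<lambda>_. 0)" if "p = 0" using * that by fastforce
qed

lemma bd_sum: "bd f (\<lambda>\<tau>. \<Sum>k\<in>A. \<beta> k * c k \<tau>) = (\<lambda>\<tau>. \<Sum>k\<in>A. \<beta> k * bd f (c k) \<tau>)"
proof
  fix \<tau> :: "'a set"
  show "bd f (\<lambda>\<tau>. \<Sum>k\<in>A. \<beta> k * c k \<tau>) \<tau> = (\<Sum>k\<in>A. \<beta> k * bd f (c k) \<tau>)"
    by (cases "\<tau> \<subseteq> V", simp_all add: bd_def sum_distrib_left)
      (subst sum.swap, simp add: mult_ac)
qed

lemma bd_scale: "bd f (\<lambda>\<tau>. a * c \<tau>) = (\<lambda>\<tau>. a * bd f c \<tau>)"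
  using bd_sum[of f "\<lambda>_. a" "\<lambda>_::unit. c" UNIV] by simp

text \<open>Incident pairs are counted in two ways: a face with one of its vertices, or the smaller
  face with the vertex to be added. The support of \<open>c\<close> has to lie in \<open>K\<close>
  because \<open>om K\<close> vanishes off \<open>K\<close>.\<close>

lemma pairing_bd:
  assumes "\<And>\<sigma>. c \<sigma> \<noteq> 0 \<Longrightarrow> \<sigma> \<in> K"
  shows "(\<Sum>\<sigma>\<in>Pow V. om K f \<phi> \<sigma> * c \<sigma>) = (\<Sum>\<tau>\<in>Pow V. \<phi> \<tau> * bd f c \<tau>)"
proof -
  define F where "F \<tau> v = sg v \<tau> * (f v * \<phi> \<tau>) * c (insert v \<tau>)" for \<tau> v
  have "(\<Sum>\<sigma>\<in>Pow V. om K f \<phi> \<sigma> * c \<sigma>) = (\<Sum>\<sigma>\<in>Pow V. \<Sum>v\<in>\<sigma>. F (\<sigma> - {v}) v)"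
  proof (intro sum.cong refl)
    fix \<sigma> assume "\<sigma> \<in> Pow V"
    show "om K f \<phi> \<sigma> * c \<sigma> = (\<Sum>v\<in>\<sigma>. F (\<sigma> - {v}) v)"
    proof (cases "c \<sigma> = 0")
      case True
      then show ?thesis by (simp add: F_def insert_absorb)
    next
      case False
      then show ?thesis using assms
        by (simp add: F_def om_def sum_distrib_right insert_absorb)
    qed
  qed
  also have "\<dots> = (\<Sum>(\<sigma>, v)\<in>(SIGMA \<sigma>:Pow V. \<sigma>). F (\<sigma> - {v}) v)"
    by (rule sum.Sigma) (use finite_subset[OF _ finite_V] in auto)
  also have "\<dots> = (\<Sum>(\<tau>, v)\<in>(SIGMA \<tau>:Pow V. V - \<tau>). F \<tau> v)"
    by (rule sum.reindex_bij_witness[where i = "\<lambda>(\<tau>, v). (insert v \<tau>, v)" and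
          j = "\<lambda>(\<sigma>, v). (\<sigma> - {v}, v)"]) auto
  also have "\<dots> = (\<Sum>\<tau>\<in>Pow V. \<Sum>v\<in>V - \<tau>. F \<tau> v)"
    by (rule sum.Sigma[symmetric]) auto
  also have "\<dots> = (\<Sum>\<tau>\<in>Pow V. \<phi> \<tau> * bd f c \<tau>)"
    by (intro sum.cong) (auto simp: bd_def F_def sum_distrib_left mult_ac)
  finally show ?thesis .
qed

section \<open>The wedge product and the Leibniz rule\<close>

definition shuffle_sign :: "'a set \<Rightarrow> 'a set \<Rightarrow> 'r::comm_ring_1" where
  "shuffle_sign \<alpha> \<beta> = (\<Prod>a\<in>\<alpha>. sg a \<beta>)"

definition wedge :: "('a set \<Rightarrow> 'r::comm_ring_1) \<Rightarrow> ('a set \<Rightarrow> 'r) \<Rightarrow> 'a set \<Rightarrow> 'r" where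
  "wedge x y \<tau> = (if \<tau> \<subseteq> V then
     \<Sum>\<alpha>\<in>Pow \<tau>. shuffle_sign \<alpha> (\<tau> - \<alpha>) * (x \<alpha> * y (\<tau> - \<alpha>)) else 0)"

text \<open>\<open>shuffle_sign\<close> sorts \<alpha> followed by \<beta>. Each element of \<alpha>
  meets \<open>v\<close> once in \<open>sg v \<alpha>\<close> and once in the product, and exactly
  one of these two meetings is an inversion, so it contributes one factor -1.\<close>

lemma shuffle_sign_insert_right:
  assumes "\<alpha> \<subseteq> V" "v \<in> V" "v \<notin> \<alpha>" "v \<notin> \<beta>"
  shows "sg v \<alpha> * shuffle_sign \<alpha> (insert v \<beta>) = (- 1) ^ card \<alpha> * (shuffle_sign \<alpha> \<beta> :: 'r::comm_ring_1)"
proof -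
  have "finite \<alpha>" using assms finite_subset finite_V by blast
  then show ?thesis using assms
  proof (induction \<alpha>)
    case (insert a \<alpha>)
    have 1: "shuffle_sign (insert a \<alpha>) \<gamma> = sg a \<gamma> * (shuffle_sign \<alpha> \<gamma> :: 'r)" for \<gamma>
      using insert.hyps by (simp add: shuffle_sign_def)
    have 2: "sg v (insert a \<alpha>) * sg a (insert v \<beta>) = - sg v \<alpha> * (sg a \<beta> :: 'r)"
      using insert.prems insert.hyps e_neq[of a v] by (auto simp: sg_insert)
    have "sg v (insert a \<alpha>) * shuffle_sign (insert a \<alpha>) (insert v \<beta>)
        = - sg a \<beta> * (sg v \<alpha> * (shuffle_sign \<alpha> (insert v \<beta>) :: 'r))"
      unfolding 1 mult.assoc[symmetric] 2 by (simp add: mult.commute)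
    also have "\<dots> = - sg a \<beta> * ((- 1) ^ card \<alpha> * shuffle_sign \<alpha> \<beta>)"
      by (subst insert.IH) (use insert.prems in auto)
    finally show ?case
      using insert.hyps by (simp add: shuffle_sign_def mult_ac)
  qed (simp add: shuffle_sign_def)
qed

text \<open>Contraction is an antiderivation. On the left the contracted vertex is outside \<tau>;
  on the right it may also lie in the argument of the other factor, and these surplus terms cancel
  in pairs.\<close>

lemma bd_wedge:
  assumes x: "chain (Pow V) p x"
  shows "bd f (wedge x y) = (\<lambda>\<tau>. wedge (bd f x) y \<tau> + (- 1) ^ p * wedge x (bd f y) \<tau>)"
proof
  fix \<tau> :: "'a set"
  show "bd f (wedge x y) \<tau> = wedge (bd f x) y \<tau> + (- 1) ^ p * wedge x (bd f y) \<tau>"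
  proof (cases "\<tau> \<subseteq> V")
    case \<tau>: True
    have fin: "finite \<alpha>" if "\<alpha> \<subseteq> \<tau>" for \<alpha>
      using that \<tau> finite_subset[OF _ finite_V] by blast
    define G where "G v \<alpha> = sg v \<tau> * (f v *
        (shuffle_sign \<alpha> (insert v \<tau> - \<alpha>) * (x \<alpha> * y (insert v \<tau> - \<alpha>))))" for v \<alpha>
    define L where "L \<alpha> v = shuffle_sign \<alpha> (\<tau> - \<alpha>) * (sg v \<alpha> * (f v * x (insert v \<alpha>)) * y (\<tau> - \<alpha>))"
      for \<alpha> v
    define R where "R \<alpha> v = shuffle_sign \<alpha> (\<tau> - \<alpha>) * (x \<alpha> * (sg v (\<tau> - \<alpha>) * (f v * y (insert v (\<tau> - \<alpha>)))))"
      for \<alpha> v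
    have split: "(\<Sum>\<alpha>\<in>Pow (insert v \<tau>). G v \<alpha>) =
        (\<Sum>\<alpha>\<in>Pow \<tau>. G v (insert v \<alpha>)) + (\<Sum>\<alpha>\<in>Pow \<tau>. G v \<alpha>)" if "v \<notin> \<tau>" for v
    proof -
      have "(\<Sum>\<alpha>\<in>Pow (insert v \<tau>). G v \<alpha>) =
          (\<Sum>\<alpha>\<in>Pow \<tau>. G v \<alpha>) + (\<Sum>\<alpha>\<in>insert v ` Pow \<tau>. G v \<alpha>)"
        unfolding Pow_insert by (rule sum.union_disjoint) (use that fin in auto)
      also have "(\<Sum>\<alpha>\<in>insert v ` Pow \<tau>. G v \<alpha>) = (\<Sum>\<alpha>\<in>Pow \<tau>. G v (insert v \<alpha>))"
        by (subst sum.reindex) (use that in \<open>auto simp: inj_on_def\<close>)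
      finally show ?thesis by (simp add: add.commute)
    qed
    have "bd f (wedge x y) \<tau> = (\<Sum>v\<in>V - \<tau>. \<Sum>\<alpha>\<in>Pow (insert v \<tau>). G v \<alpha>)"
      using \<tau> by (auto simp: bd_def wedge_def G_def sum_distrib_left intro!: sum.cong)
    also have "\<dots> = (\<Sum>v\<in>V - \<tau>. \<Sum>\<alpha>\<in>Pow \<tau>. G v (insert v \<alpha>)) + (\<Sum>v\<in>V - \<tau>. \<Sum>\<alpha>\<in>Pow \<tau>. G v \<alpha>)"
      by (subst sum.distrib[symmetric]) (intro sum.cong refl split, simp)
    also have "(\<Sum>v\<in>V - \<tau>. \<Sum>\<alpha>\<in>Pow \<tau>. G v (insert v \<alpha>)) = (\<Sum>\<alpha>\<in>Pow \<tau>. \<Sum>v\<in>V - \<tau>. L \<alpha> v)"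
    proof (subst sum.swap, intro sum.cong refl)
      fix \<alpha> v assume *: "\<alpha> \<in> Pow \<tau>" "v \<in> V - \<tau>"
      have 1: "sg v \<tau> = sg v \<alpha> * sg v (\<tau> - \<alpha>)"
        using sg_Un[of \<alpha> "\<tau> - \<alpha>" v] * by (simp add: Un_absorb1)
      have 2: "shuffle_sign (insert v \<alpha>) \<beta> = sg v \<beta> * shuffle_sign \<alpha> \<beta>" for \<beta>
        unfolding shuffle_sign_def by (rule prod.insert) (use * fin in auto)
      have 3: "insert v \<tau> - insert v \<alpha> = \<tau> - \<alpha>" using * by auto
      have "G v (insert v \<alpha>) = L \<alpha> v * (sg v (\<tau> - \<alpha>) * sg v (\<tau> - \<alpha>))"
        unfolding G_def L_def 1 2 3 by (simp only: mult_ac)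
      then show "G v (insert v \<alpha>) = L \<alpha> v" by simp
    qed
    also have "(\<Sum>v\<in>V - \<tau>. \<Sum>\<alpha>\<in>Pow \<tau>. G v \<alpha>) = (\<Sum>\<alpha>\<in>Pow \<tau>. \<Sum>v\<in>V - \<tau>. (- 1) ^ p * R \<alpha> v)"
    proof (subst sum.swap, intro sum.cong refl)
      fix \<alpha> v assume *: "\<alpha> \<in> Pow \<tau>" "v \<in> V - \<tau>"
      show "G v \<alpha> = (- 1) ^ p * R \<alpha> v"
      proof (cases "x \<alpha> = 0")
        case False
        then have p: "p = card \<alpha>" using chainD[OF x] by auto
        have 1: "sg v \<tau> = sg v (\<tau> - \<alpha>) * sg v \<alpha>"
          using sg_Un[of "\<tau> - \<alpha>" \<alpha> v] * by (auto simp: Un_absorb2)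
        have 2: "sg v \<alpha> * shuffle_sign \<alpha> (insert v (\<tau> - \<alpha>)) = (- 1) ^ p * shuffle_sign \<alpha> (\<tau> - \<alpha>)"
          unfolding p by (rule shuffle_sign_insert_right) (use * \<tau> in auto)
        have 3: "insert v \<tau> - \<alpha> = insert v (\<tau> - \<alpha>)" using * by auto
        have "G v \<alpha> = sg v (\<tau> - \<alpha>) * f v * x \<alpha> * y (insert v (\<tau> - \<alpha>)) *
            (sg v \<alpha> * shuffle_sign \<alpha> (insert v (\<tau> - \<alpha>)))"
          unfolding G_def 1 3 by (simp only: mult_ac)
        also have "\<dots> = (- 1) ^ p * R \<alpha> v"
          unfolding 2 R_def by (simp only: mult_ac)
        finally show ?thesis .
      qed (simp add: G_def R_def)
    qed
    also have "(\<Sum>\<alpha>\<in>Pow \<tau>. \<Sum>v\<in>V - \<tau>. L \<alpha> v) + (\<Sum>\<alpha>\<in>Pow \<tau>. \<Sum>v\<in>V - \<tau>. (- 1) ^ p * R \<alpha> v)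
        = wedge (bd f x) y \<tau> + (- 1) ^ p * wedge x (bd f y) \<tau>"
    proof -
      have "wedge (bd f x) y \<tau> = (\<Sum>\<alpha>\<in>Pow \<tau>. \<Sum>v\<in>V - \<alpha>. L \<alpha> v)"
        using \<tau> by (auto simp: wedge_def bd_def L_def sum_distrib_left sum_distrib_right mult_ac
            intro!: sum.cong)
      also have "\<dots> = (\<Sum>\<alpha>\<in>Pow \<tau>. (\<Sum>v\<in>V - \<tau>. L \<alpha> v) + (\<Sum>v\<in>\<tau> - \<alpha>. L \<alpha> v))"
      proof (intro sum.cong refl)
        fix \<alpha> assume "\<alpha> \<in> Pow \<tau>"
        then have "V - \<alpha> = (V - \<tau>) \<union> (\<tau> - \<alpha>)" using \<tau> by auto
        then show "(\<Sum>v\<in>V - \<alpha>. L \<alpha> v) = (\<Sum>v\<in>V - \<tau>. L \<alpha> v) + (\<Sum>v\<in>\<tau> - \<alpha>. L \<alpha> v)"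
          using fin by (simp only:) (rule sum.union_disjoint, auto)
      qed
      finally have L: "wedge (bd f x) y \<tau> = (\<Sum>\<alpha>\<in>Pow \<tau>. \<Sum>v\<in>V - \<tau>. L \<alpha> v) +
          (\<Sum>\<alpha>\<in>Pow \<tau>. \<Sum>v\<in>\<tau> - \<alpha>. L \<alpha> v)" by (simp add: sum.distrib)
      have "wedge x (bd f y) \<tau> = (\<Sum>\<alpha>\<in>Pow \<tau>. \<Sum>v\<in>V - (\<tau> - \<alpha>). R \<alpha> v)"
        using \<tau> by (auto simp: wedge_def bd_def R_def sum_distrib_left sum_distrib_right mult_ac
            intro!: sum.cong)
      also have "\<dots> = (\<Sum>\<alpha>\<in>Pow \<tau>. (\<Sum>v\<in>V - \<tau>. R \<alpha> v) + (\<Sum>v\<in>\<alpha>. R \<alpha> v))"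
      proof (intro sum.cong refl)
        fix \<alpha> assume \<alpha>: "\<alpha> \<in> Pow \<tau>"
        then have "V - (\<tau> - \<alpha>) = (V - \<tau>) \<union> \<alpha>" using \<tau> by auto
        then show "(\<Sum>v\<in>V - (\<tau> - \<alpha>). R \<alpha> v) = (\<Sum>v\<in>V - \<tau>. R \<alpha> v) + (\<Sum>v\<in>\<alpha>. R \<alpha> v)"
          using fin \<alpha> by (simp only:) (rule sum.union_disjoint, auto)
      qed
      finally have R: "wedge x (bd f y) \<tau> = (\<Sum>\<alpha>\<in>Pow \<tau>. \<Sum>v\<in>V - \<tau>. R \<alpha> v) +
          (\<Sum>\<alpha>\<in>Pow \<tau>. \<Sum>v\<in>\<alpha>. R \<alpha> v)" by (simp add: sum.distrib)
      have fin\<tau>: "finite \<tau>" using fin by auto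
      \<comment> \<open>In a surplus term \<open>v\<close> occurs in both arguments; the term of
        \<open>(insert v \<alpha>, v)\<close> in the second sum cancels that of
        \<open>(\<alpha>, v)\<close> in the first.\<close>
      have "(\<Sum>\<alpha>\<in>Pow \<tau>. \<Sum>v\<in>\<alpha>. (- 1) ^ p * R \<alpha> v) = (\<Sum>(\<alpha>, v)\<in>(SIGMA \<alpha>:Pow \<tau>. \<alpha>). (- 1) ^ p * R \<alpha> v)"
        by (rule sum.Sigma) (use fin fin\<tau> in auto)
      also have "\<dots> = (\<Sum>(\<alpha>, v)\<in>(SIGMA \<alpha>:Pow \<tau>. \<tau> - \<alpha>). (- 1) ^ p * R (insert v \<alpha>) v)"
        by (rule sum.reindex_bij_witness[where i = "\<lambda>(\<alpha>, v). (insert v \<alpha>, v)" and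
            j = "\<lambda>(\<alpha>, v). (\<alpha> - {v}, v)"]) (auto simp: insert_absorb)
      also have "\<dots> = (\<Sum>(\<alpha>, v)\<in>(SIGMA \<alpha>:Pow \<tau>. \<tau> - \<alpha>). - L \<alpha> v)"
      proof (intro sum.cong refl, clarify)
        fix \<alpha> v assume *: "\<alpha> \<subseteq> \<tau>" "v \<in> \<tau>" "v \<notin> \<alpha>"
        define \<beta> where "\<beta> = \<tau> - \<alpha> - {v}"
        have sets: "\<tau> - \<alpha> = insert v \<beta>" "\<tau> - insert v \<alpha> = \<beta>" using * by (auto simp: \<beta>_def)
        show "(- 1) ^ p * R (insert v \<alpha>) v = - L \<alpha> v"
        proof (cases "x (insert v \<alpha>) = 0")
          case False
          then have p: "p = Suc (card \<alpha>)" using chainD[OF x, of "insert v \<alpha>"] * fin by auto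
          have 1: "sg v \<alpha> * shuffle_sign \<alpha> (insert v \<beta>) = (- 1) ^ card \<alpha> * shuffle_sign \<alpha> \<beta>"
            by (rule shuffle_sign_insert_right) (use * \<tau> in \<open>auto simp: \<beta>_def\<close>)
          have 2: "sg v \<beta> * shuffle_sign (insert v \<alpha>) \<beta> = shuffle_sign \<alpha> \<beta>"
            using * fin[of \<alpha>] by (simp add: shuffle_sign_def)
          have "L \<alpha> v = f v * x (insert v \<alpha>) * y (insert v \<beta>) * (sg v \<alpha> * shuffle_sign \<alpha> (insert v \<beta>))"
            unfolding L_def sets by (simp only: mult_ac)
          moreover have "R (insert v \<alpha>) v = f v * x (insert v \<alpha>) * y (insert v \<beta>) *
              (sg v \<beta> * shuffle_sign (insert v \<alpha>) \<beta>)"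
            unfolding R_def sets by (simp only: mult_ac)
          ultimately show ?thesis unfolding 1 2 p by (simp add: mult_ac)
        qed (simp add: R_def L_def)
      qed
      also have "\<dots> = (\<Sum>\<alpha>\<in>Pow \<tau>. \<Sum>v\<in>\<tau> - \<alpha>. - L \<alpha> v)"
        by (rule sum.Sigma[symmetric]) (use fin\<tau> in auto)
      finally show ?thesis unfolding L R
        by (simp add: sum_negf sum_distrib_left distrib_left)
    qed
    finally show ?thesis .
  qed (simp add: bd_def wedge_def)
qed

section \<open>Iterated contractions and coordinates\<close>

fun con :: "(nat \<Rightarrow> 'a \<Rightarrow> 'r::comm_ring_1) \<Rightarrow> nat list \<Rightarrow> ('a set \<Rightarrow> 'r) \<Rightarrow> 'a set \<Rightarrow> 'r" where
  "con X [] c = c"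
| "con X (i # L) c = con X L (bd (X i) c)"

text \<open>Up to sign, the pairing of \<open>c\<close> with the product of the forms
  \<open>X i\<close> for \<open>i \<in> S\<close>. Evaluation at the empty face makes it vanish on
  homogeneous chains of degree other than \<open>card S\<close>.\<close>

definition coord :: "(nat \<Rightarrow> 'a \<Rightarrow> 'r::comm_ring_1) \<Rightarrow> nat set \<Rightarrow> ('a set \<Rightarrow> 'r) \<Rightarrow> 'r" where
  "coord X S c = con X (sorted_list_of_set S) c {}"

lemma con_append: "con X (L @ M) c = con X M (con X L c)"
  by (induction L arbitrary: c) auto

lemma con_sum: "con X L (\<lambda>\<tau>. \<Sum>k\<in>A. \<beta> k * c k \<tau>) = (\<lambda>\<tau>. \<Sum>k\<in>A. \<beta> k * con X L (c k) \<tau>)"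
  by (induction L arbitrary: c) (auto simp: bd_sum)

lemma con_scale: "con X L (\<lambda>\<tau>. a * c \<tau>) = (\<lambda>\<tau>. a * con X L c \<tau>)"
  by (induction L arbitrary: c) (auto simp: bd_scale)

lemma con_uminus: "con X L (\<lambda>\<tau>. - c \<tau>) = (\<lambda>\<tau>. - con X L c \<tau>)"
  using con_scale[of X L "- 1" c] by simp

lemma con_zero [simp]: "con X L (\<lambda>_. 0) = (\<lambda>_. 0)"
  using con_scale[of X L 0] by simp

lemma coord_zero [simp]: "coord X S (\<lambda>_. 0) = 0"
  by (simp add: coord_def)

lemma coord_sum: "coord X S (\<lambda>\<tau>. \<Sum>k\<in>A. \<beta> k * c k \<tau>) = (\<Sum>k\<in>A. \<beta> k * coord X S (c k))"
  by (simp add: coord_def con_sum)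

lemma coord_scale: "coord X S (\<lambda>\<tau>. a * c \<tau>) = a * coord X S c"
  by (simp add: coord_def con_scale)

lemma con_chain:
  assumes K: "\<And>\<sigma> \<tau>. \<sigma> \<in> K \<Longrightarrow> \<tau> \<subseteq> \<sigma> \<Longrightarrow> \<tau> \<in> K" and "chain K p c"
  shows "chain K (p - length L) (con X L c)" and "p < length L \<Longrightarrow> con X L c = (\<lambda>_. 0)"
proof -
  show "chain K (p - length L) (con X L c)"
    using assms(2)
  proof (induction L arbitrary: p c)
    case (Cons i L)
    have "chain K (p - 1) (bd (X i) c)" using bd_chain(1)[OF K Cons.prems] .
    from Cons.IH[OF this] show ?case by simp
  qed simp
  show "con X L c = (\<lambda>_. 0)" if "p < length L"
    using assms(2) that
  proof (induction L arbitrary: p c)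
    case (Cons i L)
    show ?case
    proof (cases "p = 0")
      case True
      then show ?thesis using bd_chain(2)[OF K Cons.prems(1)] by simp
    next
      case False
      have "chain K (p - 1) (bd (X i) c)" using bd_chain(1)[OF K Cons.prems(1)] .
      with Cons.IH[OF this] Cons.prems False show ?thesis by simp
    qed
  qed simp
qed

lemma coord_card:
  assumes "chain (Pow V) p c" "finite S" "card S \<noteq> p"
  shows "coord X S c = 0"
proof (cases "p < card S")
  case True
  then show ?thesis
    using con_chain(2)[OF _ assms(1), of "sorted_list_of_set S" X] by (simp add: coord_def)
next
  case False
  have "chain (Pow V) (p - card S) (con X (sorted_list_of_set S) c)"
    using con_chain(1)[OF _ assms(1), of "sorted_list_of_set S" X] by simp
  then show ?thesis using False assms(3) by (force simp: chain_def coord_def)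
qed

lemma con_swap: "con X (i # j # L) c = (\<lambda>\<tau>. - con X (j # i # L) c \<tau>)"
  by (simp add: bd_anticommute[of "X j" "X i"] con_uminus)

lemma con_repeat:
  assumes "i \<in> set L"
  shows "con X (i # L) c = (\<lambda>_. 0)"
  using assms
proof (induction L arbitrary: c)
  case (Cons j L)
  show ?case
  proof (cases "i = j")
    case True
    then show ?thesis by (simp add: bd_bd)
  next
    case False
    then have "con X (i # L) (bd (X j) c) = (\<lambda>_. 0)" using Cons by auto
    then show ?thesis unfolding con_swap[of X i j] by simp
  qed
qed simp

lemma con_not_distinct:
  assumes "\<not> distinct L"
  shows "con X L c = (\<lambda>_. 0)"
  using assms
proof (induction L arbitrary: c)
  case (Cons i L)
  show ?case
  proof (cases "i \<in> set L")
    case True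
    then show ?thesis by (rule con_repeat)
  next
    case False
    then show ?thesis using Cons by simp
  qed
qed simp

text \<open>Of the sign only \<open>s * s = 1\<close> is kept; it makes \<open>s\<close> invertible,
  which is enough to transport vanishing.\<close>

lemma con_insort: "\<exists>s. s * s = 1 \<and> con X (i # L) c = (\<lambda>\<tau>. s * con X (insort i L) c \<tau>)"
proof (induction L arbitrary: c)
  case Nil
  show ?case by (intro exI[of _ 1]) simp
next
  case (Cons j L)
  show ?case
  proof (cases "i \<le> j")
    case True
    then show ?thesis by (intro exI[of _ 1]) simp
  next
    case False
    obtain s where "s * s = 1" "con X (i # L) (bd (X j) c) = (\<lambda>\<tau>. s * con X (insort i L) (bd (X j) c) \<tau>)"
      using Cons.IH by blast
    with False show ?thesis
      unfolding con_swap[of X i j] by (intro exI[of _ "- s"]) simp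
  qed
qed

lemma con_sort: "\<exists>s. s * s = 1 \<and> con X L c = (\<lambda>\<tau>. s * con X (sort L) c \<tau>)"
proof (induction L arbitrary: c)
  case Nil
  show ?case by (intro exI[of _ 1]) simp
next
  case (Cons i L)
  obtain s where s: "s * s = 1" "con X L (bd (X i) c) = (\<lambda>\<tau>. s * con X (sort L) (bd (X i) c) \<tau>)"
    using Cons.IH by blast
  obtain s' where s': "s' * s' = 1" "con X (i # sort L) c = (\<lambda>\<tau>. s' * con X (insort i (sort L)) c \<tau>)"
    using con_insort by blast
  have "(s * s') * (s * s') = 1" using s s' by (simp add: mult.left_commute mult.assoc)
  moreover have "con X (i # L) c = (\<lambda>\<tau>. (s * s') * con X (sort (i # L)) c \<tau>)"
    using s s' by (simp add: mult.assoc)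
  ultimately show ?case by blast
qed

lemma con_eq_0_iff_coord:
  assumes "distinct L"
  shows "con X L c {} = 0 \<longleftrightarrow> coord X (set L) c = 0"
proof -
  obtain s where s: "s * s = 1" "con X L c = (\<lambda>\<tau>. s * con X (sort L) c \<tau>)"
    using con_sort by blast
  have "sort L = sorted_list_of_set (set L)"
    using assms by (simp add: sorted_list_of_set_sort_remdups distinct_remdups_id)
  then have 1: "con X L c {} = s * coord X (set L) c" using s by (simp add: coord_def)
  then have "s * con X L c {} = coord X (set L) c" using s by (simp flip: mult.assoc)
  with 1 show ?thesis by auto
qed

lemma con_perm:
  assumes "distinct L" "distinct M" "set L = set M"
  shows "\<exists>s. s * s = 1 \<and> con X L c = (\<lambda>\<tau>. s * con X M c \<tau>)"
proof -
  obtain s where s: "s * s = 1" "con X L c = (\<lambda>\<tau>. s * con X (sort L) c \<tau>)"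
    using con_sort by blast
  obtain t where t: "t * t = 1" "con X M c = (\<lambda>\<tau>. t * con X (sort M) c \<tau>)"
    using con_sort by blast
  have "sort L = sort M"
    by (rule sorted_distinct_set_unique) (use assms in auto)
  then have "con X L c = (\<lambda>\<tau>. (s * t) * con X M c \<tau>)"
    using s t by (simp add: mult.assoc mult.left_commute[of _ t t] flip: mult.assoc[of t t])
  moreover have "(s * t) * (s * t) = 1" using s t by (simp add: mult.left_commute mult.assoc)
  ultimately show ?thesis by blast
qed

lemma coord_insert_min:
  assumes "finite R" "\<And>q. q \<in> R \<Longrightarrow> u < q"
  shows "coord X (insert u R) c = coord X R (bd (X u) c)"
proof -
  have "u \<notin> R" using assms(2) by blast
  then have "sorted_list_of_set (insert u R) = u # sorted_list_of_set R"
    using assms by (simp add: sorted_list_of_set_insert insort_is_Cons less_imp_le)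
  then show ?thesis by (simp add: coord_def)
qed

lemma coord_prefix:
  assumes "finite R" "\<And>q. q \<in> R \<Longrightarrow> j \<le> q"
  shows "coord X ({..<j} \<union> R) c = coord X R (con X [0..<j] c)"
proof -
  have "sorted_list_of_set ({..<j} \<union> R) = [0..<j] @ sorted_list_of_set R"
    by (rule sorted_distinct_set_unique) (use assms(1) in \<open>auto simp: sorted_append dest!: assms(2)\<close>)
  then show ?thesis by (simp add: coord_def con_append)
qed

lemma coord_bd_insert:
  assumes "finite R"
  shows "coord X R (bd (X i) c) = 0 \<longleftrightarrow> i \<in> R \<or> coord X (insert i R) c = 0"
proof (cases "i \<in> R")
  case True
  then have "con X (i # sorted_list_of_set R) c = (\<lambda>_. 0)"
    using assms by (intro con_repeat) simp
  then show ?thesis using True by (simp add: coord_def)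
next
  case False
  then have "con X (i # sorted_list_of_set R) c {} = 0 \<longleftrightarrow> coord X (insert i R) c = 0"
    using con_eq_0_iff_coord[of "i # sorted_list_of_set R" X c] assms by simp
  then show ?thesis using False by (simp add: coord_def)
qed

text \<open>A ring endomorphism that permutes the rows commutes with contraction up to renaming
  rows. The exchange of two rows will yield shiftedness.\<close>

lemma con_map_hom:
  fixes \<Phi> :: "'r::comm_ring_1 \<Rightarrow> 'r"
  assumes add: "\<And>x y. \<Phi> (x + y) = \<Phi> x + \<Phi> y" and mult: "\<And>x y. \<Phi> (x * y) = \<Phi> x * \<Phi> y"
    and one: "\<Phi> 1 = 1" and X: "\<And>k v. \<Phi> (X k v) = X (\<pi> k) v"
  shows "con X (map \<pi> L) (\<lambda>\<tau>. \<Phi> (c \<tau>)) = (\<lambda>\<tau>. \<Phi> (con X L c \<tau>))"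
proof -
  have zero: "\<Phi> 0 = 0" using add[of 0 0] by simp
  have neg: "\<Phi> (- x) = - \<Phi> x" for x using add[of x "- x"] by (simp add: zero eq_neg_iff_add_eq_0 add.commute)
  have sg: "\<Phi> (sg v \<tau>) = sg v \<tau>" for v \<tau>
  proof -
    have "\<Phi> ((- 1) ^ n) = (- 1) ^ n" for n by (induction n) (auto simp: one mult neg)
    then show ?thesis by (simp add: sg_def)
  qed
  have sum: "\<Phi> (sum f A) = (\<Sum>a\<in>A. \<Phi> (f a))" for f :: "'a \<Rightarrow> 'r" and A
    by (induction A rule: infinite_finite_induct) (auto simp: zero add)
  have bd: "bd (X (\<pi> k)) (\<lambda>\<tau>. \<Phi> (c \<tau>)) = (\<lambda>\<tau>. \<Phi> (bd (X k) c \<tau>))" for k c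
    by (auto simp: bd_def fun_eq_iff zero sum mult sg X)
  show ?thesis by (induction L arbitrary: c) (auto simp: bd)
qed

text \<open>By the Leibniz rule, the coordinate on \<open>U\<close> expands into products of a
  coordinate of \<open>x\<close> on some \<open>R \<subseteq> U\<close> and one of \<open>y\<close>
  on the rest; the induction peels off the smallest row.\<close>

lemma coord_wedge_eq_0:
  assumes x: "chain (Pow V) p x" and "finite U"
    and "(\<forall>R\<subseteq>U. coord X R x = 0) \<or> (\<forall>R\<subseteq>U. coord X R y = 0)"
  shows "coord X U (wedge x y) = 0"
  using assms(2,1,3)
proof (induction U arbitrary: p x y rule: finite_linorder_min_induct)
  case empty
  then show ?case by (auto simp: coord_def wedge_def shuffle_sign_def)
next
  case (insert u U)
  have min: "coord X (insert u R) z = coord X R (bd (X u) z)" if "R \<subseteq> U" for R and z :: "'a set \<Rightarrow> 'b"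
    by (rule coord_insert_min) (use finite_subset[OF that insert.hyps(1)] insert.hyps(2) that in auto)
  have chain: "chain (Pow V) (p - 1) (bd (X u) x)"
    by (rule bd_chain[OF _ insert.prems(1)]) auto
  have vanish: "\<forall>R\<subseteq>U. coord X R (bd (X u) z) = 0" if "\<forall>R\<subseteq>insert u U. coord X R z = 0" for z :: "'a set \<Rightarrow> 'b"
    using that min by (metis insert_mono)
  have sub: "\<forall>R\<subseteq>U. coord X R z = 0" if "\<forall>R\<subseteq>insert u U. coord X R z = 0" for z :: "'a set \<Rightarrow> 'b"
    using that by blast
  have 1: "coord X U (wedge (bd (X u) x) y) = 0"
    by (rule insert.IH[OF chain], rule disj_forward[OF insert.prems(2)], erule vanish, erule sub)
  have 2: "coord X U (wedge x (bd (X u) y)) = 0"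
    by (rule insert.IH[OF insert.prems(1)], rule disj_forward[OF insert.prems(2)], erule sub, erule vanish)
  \<comment> \<open>The two Leibniz terms become a sum over a two-element index set, so that
    \<open>coord_sum\<close> applies.\<close>
  have "coord X (insert u U) (wedge x y) = coord X U
      (\<lambda>\<tau>. \<Sum>k\<in>{0::nat, 1}. (if k = 0 then 1 else (- 1) ^ p) *
        (if k = 0 then wedge (bd (X u) x) y else wedge x (bd (X u) y)) \<tau>)"
    unfolding min[OF order_refl] bd_wedge[OF insert.prems(1)] by simp
  also have "\<dots> = 0" unfolding coord_sum using 1 2 by simp
  finally show ?case .
qed

text \<open>In the expansion of \<open>coord (S \<union> T) (x \<and> y)\<close> over all splittings \<open>R \<union> R'\<close> of \<open>S \<union> T\<close>, the set
  \<open>R\<close> is lexicographically before \<open>S\<close> or \<open>R'\<close> is before \<open>T\<close>, unless \<open>R = S\<close>.\<close>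

lemma coord_wedge:
  assumes x: "chain (Pow V) p x" and "finite U" "S \<union> T = U" "S \<inter> T = {}"
    and "\<And>R. R \<subseteq> U \<Longrightarrow> lexless R S \<Longrightarrow> coord X R x = 0"
    and "\<And>R. R \<subseteq> U \<Longrightarrow> lexless R T \<Longrightarrow> coord X R y = 0"
  shows "\<exists>s. s * s = 1 \<and> coord X U (wedge x y) = s * (coord X S x * coord X T y)"
  using assms(2,1,3-)
proof (induction U arbitrary: p x y S T rule: finite_linorder_min_induct)
  case empty
  then show ?case by (intro exI[of _ 1]) (auto simp: coord_def wedge_def shuffle_sign_def)
next
  case (insert u U)
  have min: "coord X (insert u R) z = coord X R (bd (X u) z)" if "R \<subseteq> U" for R and z :: "'a set \<Rightarrow> 'b"
    by (rule coord_insert_min) (use finite_subset[OF that insert.hyps(1)] insert.hyps(2) that in auto)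
  have chain: "chain (Pow V) (p - 1) (bd (X u) x)"
    by (rule bd_chain[OF _ insert.prems(1)]) auto
  have uU: "u \<notin> U" using insert.hyps by blast
  have expand: "coord X (insert u U) (wedge x y) =
      coord X U (wedge (bd (X u) x) y) + (- 1) ^ p * coord X U (wedge x (bd (X u) y))"
  proof -
    have "coord X (insert u U) (wedge x y) = coord X U
      (\<lambda>\<tau>. \<Sum>k\<in>{0::nat, 1}. (if k = 0 then 1 else (- 1) ^ p) *
        (if k = 0 then wedge (bd (X u) x) y else wedge x (bd (X u) y)) \<tau>)"
      unfolding min[OF order_refl] bd_wedge[OF insert.prems(1)] by simp
    then show ?thesis unfolding coord_sum by simp
  qed
  have less: "lexless (insert u R) W" if "R \<subseteq> U" "W \<subseteq> U" for R W
    unfolding lexless_def using that uU insert.hyps by (intro exI[of _ u]) (auto dest: order.strict_trans)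
  have less2: "lexless (insert u R) (insert u W)" if l: "lexless R W" and sub: "R \<subseteq> U" "W \<subseteq> U" for R W
  proof -
    obtain q where q: "q \<in> R" "q \<notin> W" "\<forall>x<q. x \<in> R \<longleftrightarrow> x \<in> W" using l by (auto simp: lexless_def)
    then have "q \<noteq> u" using sub uU by auto
    then show ?thesis unfolding lexless_def using q by (intro exI[of _ q]) auto
  qed
  show ?case
  proof (cases "u \<in> S")
    case True
    define S' where "S' = S - {u}"
    have S': "S = insert u S'" "S' \<subseteq> U" "u \<notin> S'" "T \<subseteq> U" "S' \<union> T = U" "S' \<inter> T = {}"
      using True insert.prems(2,3) uU by (auto simp: S'_def)
    \<comment> \<open>As \<open>T\<close> lacks the smallest row \<open>u\<close>, every
      \<open>insert u R\<close> precedes \<open>T\<close>; so \<open>u\<close> has to be spent on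
      \<open>x\<close>.\<close>
    have "coord X U (wedge x (bd (X u) y)) = 0"
    proof (rule coord_wedge_eq_0[OF insert.prems(1)])
      have "coord X R (bd (X u) y) = 0" if "R \<subseteq> U" for R
        using insert.prems(5)[of "insert u R"] less[OF that S'(4)] that min[OF that] by auto
      then show "(\<forall>R\<subseteq>U. coord X R x = 0) \<or> (\<forall>R\<subseteq>U. coord X R (bd (X u) y) = 0)" by blast
    qed (use insert in auto)
    moreover have "\<exists>s. s * s = 1 \<and>
        coord X U (wedge (bd (X u) x) y) = s * (coord X S' (bd (X u) x) * coord X T y)"
    proof (rule insert.IH[OF chain S'(5,6)])
      fix R assume R: "R \<subseteq> U" "lexless R S'"
      then show "coord X R (bd (X u) x) = 0"
        using insert.prems(4)[of "insert u R"] less2[OF R(2,1) S'(2)] S'(1) min[OF R(1)] by auto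
    qed (use insert.prems(5) in blast)
    ultimately show ?thesis unfolding expand S'(1) min[OF S'(2)] by simp
  next
    case False
    define T' where "T' = T - {u}"
    have T': "T = insert u T'" "T' \<subseteq> U" "u \<notin> T'" "S \<subseteq> U" "S \<union> T' = U" "S \<inter> T' = {}"
      using False insert.prems(2,3) uU by (auto simp: T'_def)
    have "coord X U (wedge (bd (X u) x) y) = 0"
    proof (rule coord_wedge_eq_0[OF chain])
      have "coord X R (bd (X u) x) = 0" if "R \<subseteq> U" for R
        using insert.prems(4)[of "insert u R"] less[OF that T'(4)] that min[OF that] by auto
      then show "(\<forall>R\<subseteq>U. coord X R (bd (X u) x) = 0) \<or> (\<forall>R\<subseteq>U. coord X R y = 0)" by blast
    qed (use insert in auto)
    moreover have "\<exists>s. s * s = 1 \<and>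
        coord X U (wedge x (bd (X u) y)) = s * (coord X S x * coord X T' (bd (X u) y))"
    proof (rule insert.IH[OF insert.prems(1) T'(5,6)])
      fix R assume R: "R \<subseteq> U" "lexless R T'"
      then show "coord X R (bd (X u) y) = 0"
        using insert.prems(5)[of "insert u R"] less2[OF R(2,1) T'(2)] T'(1) min[OF R(1)] by auto
    qed (use insert.prems(4) in blast)
    then obtain s where s: "s * s = 1"
      "coord X U (wedge x (bd (X u) y)) = s * (coord X S x * coord X T' (bd (X u) y))" by blast
    have "((- 1) ^ p * s) * ((- 1) ^ p * s) = 1"
      using s(1) by (simp add: mult_ac flip: power_mult_distrib)
    ultimately show ?thesis unfolding expand T'(1) min[OF T'(2)] s(2)
      by (intro exI[of _ "(- 1) ^ p * s"]) (simp add: mult_ac)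
  qed
qed

end

section \<open>Generic linear forms\<close>

abbreviation coef :: "('m \<Rightarrow>\<^sub>0 'f::zero) \<Rightarrow> 'm \<Rightarrow> 'f" where
  "coef \<equiv> Poly_Mapping.lookup"

lemma lookup_single_times:
  fixes p :: "('m::cancel_comm_monoid_add) \<Rightarrow>\<^sub>0 'f::comm_semiring_1"
  shows "coef (Poly_Mapping.single m 1 * p) (m + k) = coef p k"
    and "(\<And>k. \<mu> \<noteq> m + k) \<Longrightarrow> coef (Poly_Mapping.single m 1 * p) \<mu> = 0"
proof -
  have *: "coef (Poly_Mapping.single m 1 * p) \<mu> =
      (\<Sum>q. coef p q when \<mu> = m + q)" for \<mu>
    by (simp add: lookup_mult lookup_single when_mult)
  show "coef (Poly_Mapping.single m 1 * p) (m + k) = coef p k"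
    unfolding * by simp
  show "coef (Poly_Mapping.single m 1 * p) \<mu> = 0" if "\<And>k. \<mu> \<noteq> m + k"
    unfolding * using that by simp
qed

lemma map_key_mult:
  fixes p q :: "('m::comm_monoid_add) \<Rightarrow>\<^sub>0 'f::comm_semiring_1"
  assumes "bij w" and add: "\<And>a b. w (a + b) = w a + w b"
  shows "Poly_Mapping.map_key w (p * q) = Poly_Mapping.map_key w p * Poly_Mapping.map_key w q"
proof (rule poly_mapping_eqI)
  fix m
  have inj: "inj w" using assms(1) by (rule bij_is_inj)
  have eq: "w m = w l + w k \<longleftrightarrow> m = l + k" for l k
    using inj by (metis add injD)
  have "(\<Sum>k. coef q k when w m = w l + k) =
      (\<Sum>k. coef q (w k) when m = l + k)" for l
    by (rule Sum_any.reindex_cong[OF assms(1)]) (auto simp: fun_eq_iff eq)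
  then have "(\<Sum>l. coef p l * (\<Sum>k. coef q k when w m = l + k)) =
      (\<Sum>l. coef p (w l) * (\<Sum>k. coef q (w k) when m = l + k))"
    by (intro Sum_any.reindex_cong[OF assms(1)]) (auto simp: fun_eq_iff)
  then show "coef (Poly_Mapping.map_key w (p * q)) m =
      coef (Poly_Mapping.map_key w p * Poly_Mapping.map_key w q) m"
    by (simp add: lookup_mult map_key.rep_eq[OF inj])
qed

type_synonym 'f mpoly = "(nat \<Rightarrow>\<^sub>0 nat) \<Rightarrow>\<^sub>0 'f"

context vertex_set begin

text \<open>Row and vertex are coded into one number, so that a single polynomial ring has variables
  for infinitely many rows.\<close>

definition var :: "nat \<Rightarrow> 'a \<Rightarrow> nat" where
  "var i v = prod_encode (i, e v)"

definition mon :: "nat \<Rightarrow> 'a \<Rightarrow> nat \<Rightarrow>\<^sub>0 nat" where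
  "mon i v = Poly_Mapping.single (var i v) 1"

definition X :: "nat \<Rightarrow> 'a \<Rightarrow> 'f::field mpoly" where
  "X i v = Poly_Mapping.single (mon i v) 1"

abbreviation expo :: "(nat \<Rightarrow>\<^sub>0 nat) \<Rightarrow> nat \<Rightarrow> 'a \<Rightarrow> nat" where
  "expo \<mu> i v \<equiv> coef \<mu> (var i v)"

lemma var_eq_iff: "u \<in> V \<Longrightarrow> v \<in> V \<Longrightarrow> var i u = var j v \<longleftrightarrow> i = j \<and> u = v"
  using inj_e by (auto simp: var_def inj_on_def)

lemma expo_mon: "u \<in> V \<Longrightarrow> v \<in> V \<Longrightarrow> expo (mon j u) i v = (if i = j \<and> u = v then 1 else 0)"
  by (auto simp: mon_def lookup_single var_eq_iff)

lemma mon_add_diff: "0 < expo \<mu> i v \<Longrightarrow> \<mu> = mon i v + (\<mu> - mon i v)"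
  by (rule poly_mapping_eqI) (auto simp: mon_def lookup_add lookup_minus lookup_single when_def)

lemma lookup_X_times:
  "coef (X i v * p) \<mu> =
     (if 0 < expo \<mu> i v then coef p (\<mu> - mon i v) else 0)"
proof (cases "0 < expo \<mu> i v")
  case True
  show ?thesis
    using lookup_single_times(1)[of "mon i v" p "\<mu> - mon i v"] mon_add_diff[OF True] True
    by (simp add: X_def)
next
  case False
  have "\<mu> \<noteq> mon i v + k" for k using False by (auto simp: mon_def lookup_add)
  then show ?thesis using False lookup_single_times(2)[of \<mu> "mon i v" p] by (simp add: X_def)
qed

lemma X_nonzero: "X i v \<noteq> 0"
  unfolding X_def by (metis lookup_single_eq lookup_zero zero_neq_one)

lemma lookup_sg_times: "coef (sg v \<tau> * p) \<mu> = sg v \<tau> * coef p \<mu>"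
proof -
  have "(- 1 :: 'b mpoly) ^ n * p = (if even n then p else - p)"
    "(- 1 :: 'b) ^ n * x = (if even n then x else - x)" for n and p :: "'b mpoly" and x :: 'b
    by auto
  then show ?thesis by (simp add: sg_def)
qed

section \<open>Exchanging two rows of the generic matrix\<close>

definition row_swap :: "nat \<Rightarrow> nat \<Rightarrow> nat \<Rightarrow> nat" where
  "row_swap i j n = (case prod_decode n of (k, x) \<Rightarrow> prod_encode ((id(i := j, j := i)) k, x))"

lemma row_swap_var: "row_swap i j (var k v) = var ((id(i := j, j := i)) k) v"
  by (simp add: row_swap_def var_def)

lemma row_swap_involution: "row_swap i j (row_swap i j n) = n"
  by (auto simp: row_swap_def split: prod.splits) (metis prod_decode_inverse)+

text \<open>A permutation of the variables induces one of the monomials, and this one a ring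
  automorphism; hence \<open>map_key\<close> is used twice. Nonzero coefficients stay nonzero, so
  chains keep their supports.\<close>

lemma exists_row_automorphism:
  "\<exists>\<Phi> :: 'f::field mpoly \<Rightarrow> 'f mpoly. (\<forall>x y. \<Phi> (x + y) = \<Phi> x + \<Phi> y) \<and> (\<forall>x y. \<Phi> (x * y) = \<Phi> x * \<Phi> y) \<and>
     \<Phi> 1 = 1 \<and> (\<forall>x. \<Phi> x = 0 \<longleftrightarrow> x = 0) \<and> (\<forall>k v. \<Phi> (X k v) = X ((id(i := j, j := i)) k) v)"
proof -
  let ?s = "row_swap i j"
  have bij_s: "bij ?s" by (rule involuntory_imp_bij) (rule row_swap_involution)
  then have inj_s: "inj ?s" by (rule bij_is_inj)
  define w :: "(nat \<Rightarrow>\<^sub>0 nat) \<Rightarrow> (nat \<Rightarrow>\<^sub>0 nat)" where "w = Poly_Mapping.map_key ?s"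
  have lookup_w: "coef (w m) n = coef m (?s n)" for m n
    by (simp add: w_def map_key.rep_eq[OF inj_s])
  have ww: "w (w m) = m" for m
    by (rule poly_mapping_eqI) (simp add: lookup_w row_swap_involution)
  have bij_w: "bij w" by (rule involuntory_imp_bij) (rule ww)
  have inj_w: "inj w" using bij_w by (rule bij_is_inj)
  have add_w: "w (a + b) = w a + w b" for a b
    by (rule poly_mapping_eqI) (simp add: lookup_w lookup_add)
  have w_mon: "w (mon k v) = mon ((id(i := j, j := i)) k) v" for k v
  proof -
    have "mon k v = Poly_Mapping.single (?s (var ((id(i := j, j := i)) k) v)) 1"
      by (simp add: mon_def row_swap_var)
    then show ?thesis using map_key_single[OF inj_s] by (simp add: w_def mon_def del: fun_upd_apply)
  qed
  define \<Phi> :: "'f mpoly \<Rightarrow> 'f mpoly" where "\<Phi> = Poly_Mapping.map_key w"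
  have single: "\<Phi> (Poly_Mapping.single m a) = Poly_Mapping.single (w m) a" for m a
  proof -
    have "\<Phi> (Poly_Mapping.single (w (w m)) a) = Poly_Mapping.single (w m) a"
      unfolding \<Phi>_def by (rule map_key_single[OF inj_w])
    then show ?thesis by (simp add: ww)
  qed
  have lookup_\<Phi>: "coef (\<Phi> p) m = coef p (w m)" for p m
    by (simp add: \<Phi>_def map_key.rep_eq[OF inj_w])
  have "\<Phi> (\<Phi> p) = p" for p
    by (rule poly_mapping_eqI) (simp add: lookup_\<Phi> ww)
  moreover have "\<Phi> 0 = 0" by (rule poly_mapping_eqI) (simp add: lookup_\<Phi>)
  ultimately have "\<Phi> x = 0 \<longleftrightarrow> x = 0" for x by metis
  moreover have "w 0 = 0" by (rule poly_mapping_eqI) (simp add: lookup_w)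
  then have "\<Phi> 1 = 1" using single[of 0 1] by simp
  moreover have "\<Phi> (x + y) = \<Phi> x + \<Phi> y" for x y
    unfolding \<Phi>_def by (rule map_key_plus[OF inj_w])
  moreover have "\<Phi> (x * y) = \<Phi> x * \<Phi> y" for x y
    unfolding \<Phi>_def by (rule map_key_mult[OF bij_w add_w])
  moreover have "\<Phi> (X k v) = X ((id(i := j, j := i)) k) v" for k v
    by (simp add: X_def single w_mon del: fun_upd_apply)
  ultimately show ?thesis by blast
qed

section \<open>Fresh rows and nonvanishing coordinates\<close>

definition fresh_row :: "nat \<Rightarrow> ('a set \<Rightarrow> 'f::field mpoly) \<Rightarrow> bool" where
  "fresh_row i c \<longleftrightarrow> (\<forall>\<sigma> \<mu> v. coef (c \<sigma>) \<mu> \<noteq> 0 \<longrightarrow> v \<in> V \<longrightarrow> expo \<mu> i v = 0)"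

lemma exists_fresh_row:
  assumes "chain (Pow V) p c"
  shows "\<exists>i\<ge>N. fresh_row i c"
proof -
  define E where "E = (\<Union>\<sigma>\<in>Pow V. \<Union>\<mu>\<in>Poly_Mapping.keys (c \<sigma>). Poly_Mapping.keys \<mu>)"
  have "finite E" by (simp add: E_def)
  then have "finite ((fst \<circ> prod_decode) ` E)" by simp
  then obtain M where M: "\<forall>i\<in>(fst \<circ> prod_decode) ` E. i < M" using finite_nat_set_iff_bounded by blast
  have "fresh_row (max M N) c"
    unfolding fresh_row_def
  proof (intro allI impI, rule ccontr)
    fix \<sigma> \<mu> v
    assume *: "coef (c \<sigma>) \<mu> \<noteq> 0" "expo \<mu> (max M N) v \<noteq> 0"
    then have "c \<sigma> \<noteq> 0" by auto
    then have "\<sigma> \<in> Pow V" using chainD[OF assms] by auto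
    moreover have "\<mu> \<in> Poly_Mapping.keys (c \<sigma>)" "var (max M N) v \<in> Poly_Mapping.keys \<mu>"
      using * by (auto simp: in_keys_iff)
    ultimately have "var (max M N) v \<in> E" by (auto simp: E_def)
    then have "(fst \<circ> prod_decode) (var (max M N) v) < M" using M by blast
    then show False by (simp add: var_def)
  qed
  then show ?thesis by (intro exI[of _ "max M N"]) simp
qed

text \<open>If \<mu> occurs in \<open>c \<sigma>\<close> and \<open>v \<in> \<sigma>\<close>, then
  at \<open>\<sigma> - {v}\<close> the monomial \<open>mon i v + \<mu>\<close> arises from \<sigma>
  alone: its only variable of row \<open>i\<close> is that of \<open>v\<close>.\<close>

lemma bd_fresh_nonzero:
  assumes c: "chain (Pow V) (Suc p) c" "c \<noteq> (\<lambda>_. 0)" and i: "fresh_row i c"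
  shows "bd (X i) c \<noteq> (\<lambda>_. 0)"
proof
  assume zero: "bd (X i) c = (\<lambda>_. 0)"
  obtain \<sigma> where \<sigma>: "c \<sigma> \<noteq> 0" using c by auto
  then have \<sigma>V: "\<sigma> \<subseteq> V" "card \<sigma> = Suc p" using chainD[OF c(1)] by auto
  then obtain v where v: "v \<in> \<sigma>" by fastforce
  obtain \<mu> where \<mu>: "coef (c \<sigma>) \<mu> \<noteq> 0"
    using \<sigma> by (metis poly_mapping_eqI lookup_zero)
  let ?\<tau> = "\<sigma> - {v}"
  have "0 = coef (bd (X i) c ?\<tau>) (mon i v + \<mu>)" by (simp add: zero)
  also have "\<dots> = (\<Sum>u\<in>V - ?\<tau>. sg u ?\<tau> * coef (X i u * c (insert u ?\<tau>)) (mon i v + \<mu>))"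
    using \<sigma>V by (auto simp: bd_def lookup_sum lookup_sg_times)
  also have "\<dots> = (\<Sum>u\<in>{v}. sg u ?\<tau> * coef (X i u * c (insert u ?\<tau>)) (mon i v + \<mu>))"
  proof (rule sum.mono_neutral_right)
    show "\<forall>u\<in>V - ?\<tau> - {v}. sg u ?\<tau> * coef (X i u * c (insert u ?\<tau>)) (mon i v + \<mu>) = 0"
    proof
      fix u assume u: "u \<in> V - ?\<tau> - {v}"
      have "expo (mon i v + \<mu>) i u = 0"
        using u v \<sigma>V \<mu> i by (auto simp: lookup_add expo_mon fresh_row_def)
      then show "sg u ?\<tau> * coef (X i u * c (insert u ?\<tau>)) (mon i v + \<mu>) = 0"
        by (simp add: lookup_X_times)
    qed
  qed (use v \<sigma>V in auto)
  also have "\<dots> = sg v ?\<tau> * coef (c \<sigma>) \<mu>"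
    using v lookup_single_times(1)[of "mon i v" "c \<sigma>" \<mu>] by (simp add: insert_absorb X_def)
  finally have "sg v ?\<tau> * coef (c \<sigma>) \<mu> = 0" by (rule sym)
  then have "coef (c \<sigma>) \<mu> = 0"
    using sg_sq_left[of v ?\<tau> "coef (c \<sigma>) \<mu>"] by (simp only: mult_zero_right)
  with \<mu> show False by contradiction
qed

text \<open>Contraction with one fresh row after the other never reaches zero before degree 0. The
  infinite supply of rows replaces an argument about minors of a generic matrix, and
  \<open>N\<close> keeps the rows clear of an initial segment.\<close>

lemma exists_coord_nonzero:
  assumes "chain (Pow V) p c" "c \<noteq> (\<lambda>_. 0)"
  shows "\<exists>S. finite S \<and> card S = p \<and> (\<forall>q\<in>S. N \<le> q) \<and> coord X S c \<noteq> 0"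
  using assms
proof (induction p arbitrary: c N)
  case 0
  have "c \<sigma> = 0" if "\<sigma> \<noteq> {}" for \<sigma>
    using chainD[OF 0(1), of \<sigma>] that finite_subset[OF _ finite_V, of \<sigma>] by fastforce
  then have "c {} \<noteq> 0" using 0(2) by (metis ext)
  then show ?case by (intro exI[of _ "{}"]) (simp add: coord_def)
next
  case (Suc p)
  obtain i where i: "i \<ge> N" "fresh_row i c" using exists_fresh_row[OF Suc.prems(1)] by blast
  have "chain (Pow V) p (bd (X i) c)" using bd_chain(1)[OF _ Suc.prems(1)] by auto
  then obtain S where S: "finite S" "card S = p" "\<forall>q\<in>S. Suc i \<le> q" "coord X S (bd (X i) c) \<noteq> 0"
    using Suc.IH bd_fresh_nonzero[OF Suc.prems i(2)] by blast
  have "i \<notin> S" using S(3) by auto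
  then show ?case
    using S i coord_insert_min[of S i X c]
    by (intro exI[of _ "insert i S"]) (auto simp: Suc_le_eq)
qed

end

section \<open>Exactness for generic linear forms\<close>

text \<open>\<open>link_exact\<close> is the vanishing of cohomology of links, for functions on all
  sets tested on faces of the link only. If all facets have \<open>D\<close> elements,
  \<open>card \<tau> + p < D\<close> describes the degrees below the top one. For
  \<open>p = 0\<close> it says that the link of a face with fewer than \<open>D\<close> elements has
  a vertex.\<close>

locale cm_complex = vertex_set V e for V :: "'a set" and e +
  fixes K :: "'a set set" and D :: nat and F :: "'f::field itself"
  assumes K_closed: "\<And>\<sigma> \<tau>. \<sigma> \<in> K \<Longrightarrow> \<tau> \<subseteq> \<sigma> \<Longrightarrow> \<tau> \<in> K"
    and K_subset: "K \<subseteq> Pow V"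
    and link_exact: "\<And>\<tau> p (g :: 'a set \<Rightarrow> 'f). \<tau> \<in> K \<Longrightarrow> card \<tau> + p < D \<Longrightarrow>
      (\<And>\<rho>. \<rho> \<inter> \<tau> = {} \<Longrightarrow> \<rho> \<union> \<tau> \<in> K \<Longrightarrow> card \<rho> = Suc p \<Longrightarrow>
        (\<Sum>v\<in>\<rho>. sg v (\<rho> - {v}) * g (\<rho> - {v})) = 0) \<Longrightarrow>
      \<exists>h. \<forall>\<rho>. \<rho> \<inter> \<tau> = {} \<longrightarrow> \<rho> \<union> \<tau> \<in> K \<longrightarrow> card \<rho> = p \<longrightarrow>
        g \<rho> = (\<Sum>v\<in>\<rho>. sg v (\<rho> - {v}) * h (\<rho> - {v}))"
begin

lemma face_subset: "\<sigma> \<in> K \<Longrightarrow> \<sigma> \<subseteq> V"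
  using K_subset by auto

lemma face_finite: "\<sigma> \<in> K \<Longrightarrow> finite \<sigma>"
  using face_subset finite_V by (metis finite_subset)

abbreviation cob :: "('a \<Rightarrow> 'r::comm_ring_1) \<Rightarrow> ('a set \<Rightarrow> 'r) \<Rightarrow> 'a set \<Rightarrow> 'r" where
  "cob \<equiv> om K"

definition unit_chain :: "'a set \<Rightarrow> 'a set \<Rightarrow> 'r::comm_ring_1" where
  "unit_chain \<sigma> \<tau> = (if \<tau> = \<sigma> then 1 else 0)"

text \<open>Evaluation at a face is pairing with its unit chain, so the identities of
  \<open>bd\<close> pass to the transposed operators.\<close>

lemma cob_cob_transpose:
  assumes "\<sigma> \<in> K"
  shows "cob f (cob g \<phi>) \<sigma> = (\<Sum>x\<in>Pow V. \<phi> x * bd g (bd f (unit_chain \<sigma>)) x)"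
proof -
  let ?u = "unit_chain \<sigma> :: 'a set \<Rightarrow> 'b"
  have u: "chain K (card \<sigma>) ?u" using assms by (auto simp: chain_def unit_chain_def)
  have "cob f (cob g \<phi>) \<sigma> = (\<Sum>x\<in>Pow V. cob f (cob g \<phi>) x * ?u x)"
    using face_subset[OF assms] by (simp add: unit_chain_def if_distrib[of "\<lambda>c. _ * c"] cong: if_cong)
  also have "\<dots> = (\<Sum>x\<in>Pow V. cob g \<phi> x * bd f ?u x)"
    by (rule pairing_bd) (use chainD[OF u] in auto)
  also have "\<dots> = (\<Sum>x\<in>Pow V. \<phi> x * bd g (bd f ?u) x)"
    by (rule pairing_bd) (use chainD[OF bd_chain(1)[OF K_closed u]] in auto)
  finally show ?thesis .
qed

lemma cob_anticommute: "cob f (cob g \<phi>) = (\<lambda>\<sigma>. - cob g (cob f \<phi>) \<sigma>)"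
proof
  fix \<sigma>
  show "cob f (cob g \<phi>) \<sigma> = - cob g (cob f \<phi>) \<sigma>"
  proof (cases "\<sigma> \<in> K")
    case True
    show ?thesis
      unfolding cob_cob_transpose[OF True] bd_anticommute[of g f] by (simp add: sum_negf)
  qed (simp add: om_def)
qed

lemma cob_cob: "cob f (cob f \<phi>) = (\<lambda>_. 0)"
proof
  show "cob f (cob f \<phi>) \<sigma> = 0" for \<sigma>
    by (cases "\<sigma> \<in> K") (simp add: cob_cob_transpose bd_bd, simp add: om_def)
qed

lemma cob_add: "cob f (\<lambda>\<sigma>. \<phi> \<sigma> + \<psi> \<sigma>) = (\<lambda>\<sigma>. cob f \<phi> \<sigma> + cob f \<psi> \<sigma>)"
  by (rule ext) (auto simp: om_def sum.distrib distrib_left)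

lemma cob_zero [simp]: "cob f (\<lambda>_. 0) = (\<lambda>_. 0)"
  by (rule ext) (auto simp: om_def)

lemma cob_chain:
  assumes "chain K p \<phi>"
  shows "chain K (Suc p) (cob f \<phi>)"
  unfolding chain_def
proof (intro allI impI)
  fix \<sigma> assume nz: "cob f \<phi> \<sigma> \<noteq> 0"
  then have \<sigma>: "\<sigma> \<in> K" by (auto simp: om_def split: if_splits)
  then have "(\<Sum>v\<in>\<sigma>. sg v (\<sigma> - {v}) * (f v * \<phi> (\<sigma> - {v}))) \<noteq> 0" using nz by (simp add: om_def)
  then obtain v where v: "v \<in> \<sigma>" "sg v (\<sigma> - {v}) * (f v * \<phi> (\<sigma> - {v})) \<noteq> 0"
    by (rule sum.not_neutral_contains_not_neutral)
  then have "\<phi> (\<sigma> - {v}) \<noteq> 0" by auto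
  then have "card (\<sigma> - {v}) = p" using chainD[OF assms] by auto
  then show "\<sigma> \<in> K \<and> card \<sigma> = Suc p"
    using \<sigma> v face_finite[OF \<sigma>] by (metis card_Suc_Diff1)
qed

lemma chain_add: "chain L p \<phi> \<Longrightarrow> chain L p \<psi> \<Longrightarrow> chain L p (\<lambda>\<sigma>. \<phi> \<sigma> + \<psi> \<sigma> :: 'r::comm_ring_1)"
  unfolding chain_def by (metis add.right_neutral)

text \<open>The signs of the ambient complex differ from those of the link by the factors
  \<open>sg v \<tau>\<close>, which the diagonal change of basis \<open>P\<close> absorbs.\<close>

lemma link_exact_twisted:
  fixes g :: "'a set \<Rightarrow> 'f"
  assumes \<tau>: "\<tau> \<in> K" "card \<tau> + p < D"
    and cocycle: "\<And>\<rho>. \<rho> \<inter> \<tau> = {} \<Longrightarrow> \<rho> \<union> \<tau> \<in> K \<Longrightarrow> card \<rho> = Suc p \<Longrightarrow>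
        (\<Sum>v\<in>\<rho>. sg v (\<tau> \<union> (\<rho> - {v})) * g (\<rho> - {v})) = 0"
  shows "\<exists>h. \<forall>\<rho>. \<rho> \<inter> \<tau> = {} \<longrightarrow> \<rho> \<union> \<tau> \<in> K \<longrightarrow> card \<rho> = p \<longrightarrow>
        g \<rho> = (\<Sum>v\<in>\<rho>. sg v (\<tau> \<union> (\<rho> - {v})) * h (\<rho> - {v}))"
proof -
  define P :: "'a set \<Rightarrow> 'f" where "P \<rho> = (\<Prod>v\<in>\<rho>. sg v \<tau>)" for \<rho>
  have P_sq: "P \<rho> * P \<rho> = 1" for \<rho> by (simp add: P_def flip: prod.distrib)
  have twist: "P \<rho> * (\<Sum>v\<in>\<rho>. sg v (\<tau> \<union> (\<rho> - {v})) * h (\<rho> - {v})) =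
      (\<Sum>v\<in>\<rho>. sg v (\<rho> - {v}) * (P (\<rho> - {v}) * h (\<rho> - {v})))"
    if "\<rho> \<inter> \<tau> = {}" "\<rho> \<union> \<tau> \<in> K" for \<rho> h
    unfolding sum_distrib_left
  proof (intro sum.cong refl)
    fix v assume v: "v \<in> \<rho>"
    have "finite \<rho>" using face_finite[OF that(2)] by simp
    then have 1: "P \<rho> = sg v \<tau> * P (\<rho> - {v})" unfolding P_def using v by (rule prod.remove)
    have 2: "sg v (\<tau> \<union> (\<rho> - {v})) = sg v \<tau> * sg v (\<rho> - {v})" by (rule sg_Un) (use that in auto)
    have "P \<rho> * (sg v (\<tau> \<union> (\<rho> - {v})) * h (\<rho> - {v})) =
        (sg v \<tau> * sg v \<tau>) * (sg v (\<rho> - {v}) * (P (\<rho> - {v}) * h (\<rho> - {v})))"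
      unfolding 1 2 by (simp only: mult_ac)
    then show "P \<rho> * (sg v (\<tau> \<union> (\<rho> - {v})) * h (\<rho> - {v})) =
        sg v (\<rho> - {v}) * (P (\<rho> - {v}) * h (\<rho> - {v}))" by (simp only: sg_sq mult_1)
  qed
  have "\<exists>h. \<forall>\<rho>. \<rho> \<inter> \<tau> = {} \<longrightarrow> \<rho> \<union> \<tau> \<in> K \<longrightarrow> card \<rho> = p \<longrightarrow>
      P \<rho> * g \<rho> = (\<Sum>v\<in>\<rho>. sg v (\<rho> - {v}) * h (\<rho> - {v}))"
  proof (rule link_exact[OF \<tau>])
    fix \<rho> assume \<rho>: "\<rho> \<inter> \<tau> = {}" "\<rho> \<union> \<tau> \<in> K" "card \<rho> = Suc p"
    show "(\<Sum>v\<in>\<rho>. sg v (\<rho> - {v}) * (P (\<rho> - {v}) * g (\<rho> - {v}))) = 0"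
      unfolding twist[OF \<rho>(1,2), symmetric] cocycle[OF \<rho>] by simp
  qed
  then obtain h where h: "\<And>\<rho>. \<rho> \<inter> \<tau> = {} \<Longrightarrow> \<rho> \<union> \<tau> \<in> K \<Longrightarrow> card \<rho> = p \<Longrightarrow>
      P \<rho> * g \<rho> = (\<Sum>v\<in>\<rho>. sg v (\<rho> - {v}) * h (\<rho> - {v}))" by blast
  have "g \<rho> = (\<Sum>v\<in>\<rho>. sg v (\<tau> \<union> (\<rho> - {v})) * (P (\<rho> - {v}) * h (\<rho> - {v})))"
    if \<rho>: "\<rho> \<inter> \<tau> = {}" "\<rho> \<union> \<tau> \<in> K" "card \<rho> = p" for \<rho>
  proof -
    have PP: "P \<rho> * (P \<rho> * z) = z" for \<rho> z using P_sq[of \<rho>] by (simp flip: mult.assoc)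
    have "P \<rho> * (\<Sum>v\<in>\<rho>. sg v (\<tau> \<union> (\<rho> - {v})) * (P (\<rho> - {v}) * h (\<rho> - {v}))) = P \<rho> * g \<rho>"
      unfolding twist[OF \<rho>(1,2), of "\<lambda>\<rho>. P \<rho> * h \<rho>"] PP h[OF \<rho>] ..
    from arg_cong[OF this, of "\<lambda>z. P \<rho> * z"] show ?thesis by (simp only: PP)
  qed
  then show ?thesis by (intro exI[of _ "\<lambda>\<rho>. P \<rho> * h \<rho>"]) simp
qed

section \<open>The multigrading by exponents\<close>

definition Mon :: "nat \<Rightarrow> 'a set \<Rightarrow> nat \<Rightarrow>\<^sub>0 nat" where
  "Mon l \<rho> = (\<Sum>v\<in>\<rho>. mon l v)"

definition deg :: "nat \<Rightarrow> (nat \<Rightarrow>\<^sub>0 nat) \<Rightarrow> int" where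
  "deg l \<mu> = (\<Sum>v\<in>V. int (expo \<mu> l v))"

text \<open>The strict bounds are integers, so that they can be lowered without restriction; a bound
  \<open>d l \<le> 0\<close> leaves only the zero cochain.\<close>

definition bnd :: "(nat \<Rightarrow> int) \<Rightarrow> ('a set \<Rightarrow> 'f mpoly) \<Rightarrow> bool" where
  "bnd d \<phi> \<longleftrightarrow> (\<forall>\<sigma> \<mu> l. coef (\<phi> \<sigma>) \<mu> \<noteq> 0 \<longrightarrow> deg l \<mu> < d l)"

lemma expo_Mon:
  assumes "\<rho> \<subseteq> V" "v \<in> V"
  shows "expo (Mon l \<rho>) k v = (if k = l \<and> v \<in> \<rho> then 1 else 0)"
proof -
  have fin: "finite \<rho>" using assms finite_subset finite_V by metis
  have "expo (Mon l \<rho>) k v = (\<Sum>u\<in>\<rho>. if k = l \<and> u = v then 1 else 0)"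
    unfolding Mon_def lookup_sum by (intro sum.cong refl expo_mon) (use assms in auto)
  also have "\<dots> = (if k = l \<and> v \<in> \<rho> then 1 else 0)"
    using fin by (auto simp: sum.delta)
  finally show ?thesis .
qed

lemma deg_add: "deg l (\<mu> + \<nu>) = deg l \<mu> + deg l \<nu>"
  by (simp add: deg_def lookup_add sum.distrib)

lemma deg_Mon:
  assumes "\<rho> \<subseteq> V"
  shows "deg k (Mon l \<rho>) = (if k = l then int (card \<rho>) else 0)"
proof -
  have "deg k (Mon l \<rho>) = (\<Sum>v\<in>V. if k = l \<and> v \<in> \<rho> then 1 else 0)"
    unfolding deg_def by (intro sum.cong refl) (use assms in \<open>simp add: expo_Mon\<close>)
  also have "\<dots> = (if k = l then int (card \<rho>) else 0)"
    using assms by (auto simp: sum.If_cases Int_absorb1)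
  finally show ?thesis .
qed

lemma Mon_remove: "finite \<rho> \<Longrightarrow> v \<in> \<rho> \<Longrightarrow> Mon l \<rho> = mon l v + Mon l (\<rho> - {v})"
  unfolding Mon_def by (rule sum.remove)

lemma Mon_add_diff:
  assumes "\<rho> \<subseteq> V" "\<And>v. v \<in> \<rho> \<Longrightarrow> 0 < expo \<mu> l v"
  shows "(\<mu> - Mon l \<rho>) + Mon l \<rho> = \<mu>"
proof -
  have fin: "finite \<rho>" using assms finite_subset finite_V by metis
  have "coef (Mon l \<rho>) n \<le> coef \<mu> n" for n
  proof (cases "\<exists>v\<in>\<rho>. n = var l v")
    case True
    then obtain v where v: "v \<in> \<rho>" "n = var l v" by auto
    then have "expo (Mon l \<rho>) l v \<le> 1" using assms by (subst expo_Mon) auto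
    then show ?thesis using assms(2)[OF v(1)] v by simp
  next
    case False
    then have "coef (Mon l \<rho>) n = 0"
      unfolding Mon_def lookup_sum by (intro sum.neutral) (auto simp: mon_def lookup_single when_def)
    then show ?thesis by simp
  qed
  then show ?thesis by (intro poly_mapping_eqI) (simp add: lookup_add lookup_minus)
qed

text \<open>A vertex of \<tau> contributes nothing because its variable of row \<open>l\<close> is
  absent from the monomial; a vertex of \<rho> is removed together with its variable.\<close>

lemma lookup_cob:
  fixes \<chi> :: "'a set \<Rightarrow> 'f mpoly"
  assumes "\<tau> \<inter> \<rho> = {}" "\<tau> \<union> \<rho> \<in> K" "\<And>v. v \<in> \<tau> \<Longrightarrow> expo \<kappa> l v = 0"
  shows "coef (cob (X l) \<chi> (\<tau> \<union> \<rho>)) (\<kappa> + Mon l \<rho>) =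
    (\<Sum>v\<in>\<rho>. sg v (\<tau> \<union> (\<rho> - {v})) * coef (\<chi> (\<tau> \<union> (\<rho> - {v}))) (\<kappa> + Mon l (\<rho> - {v})))"
proof -
  have sub: "\<tau> \<subseteq> V" "\<rho> \<subseteq> V" and fin: "finite \<tau>" "finite \<rho>"
    using face_subset[OF assms(2)] face_finite[OF assms(2)] by auto
  let ?\<mu> = "\<kappa> + Mon l \<rho>"
  have "coef (cob (X l) \<chi> (\<tau> \<union> \<rho>)) ?\<mu> = (\<Sum>v\<in>\<tau> \<union> \<rho>. sg v (\<tau> \<union> \<rho> - {v}) *
      coef (X l v * \<chi> (\<tau> \<union> \<rho> - {v})) ?\<mu>)"
    using assms(2) by (simp add: om_def lookup_sum lookup_sg_times)
  also have "\<dots> = (\<Sum>v\<in>\<rho>. sg v (\<tau> \<union> \<rho> - {v}) * coef (X l v * \<chi> (\<tau> \<union> \<rho> - {v})) ?\<mu>)"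
  proof (rule sum.mono_neutral_right)
    show "\<forall>v\<in>\<tau> \<union> \<rho> - \<rho>. sg v (\<tau> \<union> \<rho> - {v}) * coef (X l v * \<chi> (\<tau> \<union> \<rho> - {v})) ?\<mu> = 0"
    proof
      fix v assume v: "v \<in> \<tau> \<union> \<rho> - \<rho>"
      then have "expo ?\<mu> l v = 0" using assms(3) sub by (auto simp: lookup_add expo_Mon)
      then show "sg v (\<tau> \<union> \<rho> - {v}) * coef (X l v * \<chi> (\<tau> \<union> \<rho> - {v})) ?\<mu> = 0"
        by (simp add: lookup_X_times)
    qed
  qed (use fin in auto)
  also have "\<dots> = (\<Sum>v\<in>\<rho>. sg v (\<tau> \<union> (\<rho> - {v})) * coef (\<chi> (\<tau> \<union> (\<rho> - {v}))) (\<kappa> + Mon l (\<rho> - {v})))"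
  proof (intro sum.cong refl)
    fix v assume v: "v \<in> \<rho>"
    then have 1: "\<tau> \<union> \<rho> - {v} = \<tau> \<union> (\<rho> - {v})" using assms(1) by auto
    have 2: "?\<mu> = mon l v + (\<kappa> + Mon l (\<rho> - {v}))"
      using Mon_remove[OF fin(2) v] by (simp add: add.left_commute)
    show "sg v (\<tau> \<union> \<rho> - {v}) * coef (X l v * \<chi> (\<tau> \<union> \<rho> - {v})) ?\<mu> =
        sg v (\<tau> \<union> (\<rho> - {v})) * coef (\<chi> (\<tau> \<union> (\<rho> - {v}))) (\<kappa> + Mon l (\<rho> - {v}))"
      unfolding 1 2 X_def lookup_single_times(1) ..
  qed
  finally show ?thesis .
qed

text \<open>The operator \<open>cob (X l)\<close> is multigraded. The pairs \<open>(\<sigma>, \<mu>)\<close> of a face and a monomial are grouped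
  by \<open>\<tau> = {v \<in> \<sigma>. expo \<mu> l v = 0}\<close> and \<open>\<kappa> = \<mu> - Mon l (\<sigma> - \<tau>)\<close>; on such a group the operator is the
  simplicial coboundary of the link of \<open>\<tau>\<close>.\<close>

lemma cob_exact:
  fixes \<phi> :: "'a set \<Rightarrow> 'f mpoly"
  assumes \<phi>: "chain K (Suc q) \<phi>" "Suc q < D" "cob (X l) \<phi> = (\<lambda>_. 0)" and b: "bnd d \<phi>"
  shows "\<exists>\<psi>. chain K q \<psi> \<and> \<phi> = cob (X l) \<psi> \<and> bnd (d(l := d l - 1)) \<psi>"
proof -
  define g where "g \<tau> \<kappa> \<rho> = coef (\<phi> (\<tau> \<union> \<rho>)) (\<kappa> + Mon l \<rho>)" for \<tau> \<kappa> \<rho>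
  \<comment> \<open>The last clause makes the preimage zero on groups that \<phi> does not meet.
    Thereby \<psi> has finitely many monomials and inherits the degree bounds.\<close>
  define good where "good \<tau> \<kappa> h \<longleftrightarrow>
      (\<forall>\<rho>. \<rho> \<inter> \<tau> = {} \<longrightarrow> \<rho> \<union> \<tau> \<in> K \<longrightarrow> card \<tau> + card \<rho> = Suc q \<longrightarrow>
        g \<tau> \<kappa> \<rho> = (\<Sum>v\<in>\<rho>. sg v (\<tau> \<union> (\<rho> - {v})) * h (\<rho> - {v}))) \<and>
      ((\<forall>\<rho>\<subseteq>V - \<tau>. g \<tau> \<kappa> \<rho> = 0) \<longrightarrow> h = (\<lambda>_. 0))" for \<tau> \<kappa> h
  have ex: "\<exists>h. good \<tau> \<kappa> h" if \<tau>: "\<tau> \<in> K" "\<And>v. v \<in> \<tau> \<Longrightarrow> expo \<kappa> l v = 0" for \<tau> \<kappa>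
  proof (cases "\<forall>\<rho>\<subseteq>V - \<tau>. g \<tau> \<kappa> \<rho> = 0")
    case True
    have "\<rho> \<subseteq> V - \<tau>" if "\<rho> \<inter> \<tau> = {}" "\<rho> \<union> \<tau> \<in> K" for \<rho>
      using that face_subset[of "\<rho> \<union> \<tau>"] by auto
    then have "good \<tau> \<kappa> (\<lambda>_. 0)" unfolding good_def using True by simp
    then show ?thesis by blast
  next
    case False
    then obtain \<rho>1 where \<rho>1: "\<rho>1 \<subseteq> V - \<tau>" "g \<tau> \<kappa> \<rho>1 \<noteq> 0" by blast
    then have "\<phi> (\<tau> \<union> \<rho>1) \<noteq> 0" by (auto simp: g_def)
    then have "card (\<tau> \<union> \<rho>1) = Suc q" "\<tau> \<union> \<rho>1 \<in> K" using chainD[OF \<phi>(1)] by auto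
    moreover from this have "card (\<tau> \<union> \<rho>1) = card \<tau> + card \<rho>1"
      using face_finite[of "\<tau> \<union> \<rho>1"] \<rho>1(1) by (intro card_Un_disjoint) auto
    ultimately obtain p where p: "card \<tau> + p = Suc q" by metis
    have "\<exists>h. \<forall>\<rho>. \<rho> \<inter> \<tau> = {} \<longrightarrow> \<rho> \<union> \<tau> \<in> K \<longrightarrow> card \<rho> = p \<longrightarrow>
        g \<tau> \<kappa> \<rho> = (\<Sum>v\<in>\<rho>. sg v (\<tau> \<union> (\<rho> - {v})) * h (\<rho> - {v}))"
    proof (rule link_exact_twisted[OF \<tau>(1)])
      show "card \<tau> + p < D" using p \<phi>(2) by simp
      fix \<rho> assume \<rho>: "\<rho> \<inter> \<tau> = {}" "\<rho> \<union> \<tau> \<in> K" "card \<rho> = Suc p"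
      have "coef (cob (X l) \<phi> (\<tau> \<union> \<rho>)) (\<kappa> + Mon l \<rho>) =
          (\<Sum>v\<in>\<rho>. sg v (\<tau> \<union> (\<rho> - {v})) * g \<tau> \<kappa> (\<rho> - {v}))"
        unfolding g_def by (rule lookup_cob) (use \<rho> \<tau> in \<open>auto simp: Un_commute\<close>)
      then show "(\<Sum>v\<in>\<rho>. sg v (\<tau> \<union> (\<rho> - {v})) * g \<tau> \<kappa> (\<rho> - {v})) = 0" using \<phi>(3) by simp
    qed
    then obtain h where h: "\<forall>\<rho>. \<rho> \<inter> \<tau> = {} \<longrightarrow> \<rho> \<union> \<tau> \<in> K \<longrightarrow> card \<rho> = p \<longrightarrow>
        g \<tau> \<kappa> \<rho> = (\<Sum>v\<in>\<rho>. sg v (\<tau> \<union> (\<rho> - {v})) * h (\<rho> - {v}))" by blast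
    have "good \<tau> \<kappa> h"
      unfolding good_def
    proof (intro conjI allI impI)
      fix \<rho> assume "\<rho> \<inter> \<tau> = {}" "\<rho> \<union> \<tau> \<in> K" "card \<tau> + card \<rho> = Suc q"
      then show "g \<tau> \<kappa> \<rho> = (\<Sum>v\<in>\<rho>. sg v (\<tau> \<union> (\<rho> - {v})) * h (\<rho> - {v}))" using h p by auto
    qed (use False in blast)
    then show ?thesis by blast
  qed
  define H where "H \<tau> \<kappa> = (SOME h. good \<tau> \<kappa> h)" for \<tau> \<kappa>
  have H: "good \<tau> \<kappa> (H \<tau> \<kappa>)" if "\<tau> \<in> K" "\<And>v. v \<in> \<tau> \<Longrightarrow> expo \<kappa> l v = 0" for \<tau> \<kappa>
    unfolding H_def by (rule someI_ex[OF ex]) (use that in auto)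
  define tp where "tp \<sigma> \<mu> = {v \<in> \<sigma>. expo \<mu> l v = 0}" for \<sigma> \<mu>
  define base where "base \<sigma> \<mu> = \<mu> - Mon l (\<sigma> - tp \<sigma> \<mu>)" for \<sigma> \<mu>
  have base: "base \<sigma> \<mu> + Mon l (\<sigma> - tp \<sigma> \<mu>) = \<mu>" if "\<sigma> \<in> K" for \<sigma> \<mu>
    unfolding base_def by (rule Mon_add_diff) (use face_subset[OF that] in \<open>auto simp: tp_def\<close>)
  have base0: "expo (base \<sigma> \<mu>) l v = 0" if "v \<in> tp \<sigma> \<mu>" for v \<sigma> \<mu>
    using that by (simp add: base_def lookup_minus tp_def)
  have tpK: "tp \<sigma> \<mu> \<in> K" if "\<sigma> \<in> K" for \<sigma> \<mu>
    by (rule K_closed[OF that]) (auto simp: tp_def)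
  define cf where "cf \<sigma> \<mu> = (if \<sigma> \<in> K \<and> card \<sigma> = q
      then H (tp \<sigma> \<mu>) (base \<sigma> \<mu>) (\<sigma> - tp \<sigma> \<mu>) else 0)" for \<sigma> \<mu>
  have cf_nz: "\<exists>\<rho>\<subseteq>V - tp \<sigma> \<mu>. coef (\<phi> (tp \<sigma> \<mu> \<union> \<rho>)) (base \<sigma> \<mu> + Mon l \<rho>) \<noteq> 0"
    if nz: "cf \<sigma> \<mu> \<noteq> 0" for \<sigma> \<mu>
  proof (rule ccontr)
    assume no: "\<not> ?thesis"
    have "\<sigma> \<in> K" using nz by (auto simp: cf_def split: if_splits)
    then have "good (tp \<sigma> \<mu>) (base \<sigma> \<mu>) (H (tp \<sigma> \<mu>) (base \<sigma> \<mu>))"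
      by (intro H tpK base0)
    then have "H (tp \<sigma> \<mu>) (base \<sigma> \<mu>) = (\<lambda>_. 0)"
      using no by (auto simp: good_def g_def)
    then show False using nz by (simp add: cf_def split: if_splits)
  qed
  have fin: "finite {\<mu>. cf \<sigma> \<mu> \<noteq> 0}" for \<sigma>
  proof (cases "\<sigma> \<in> K")
    case True
    \<comment> \<open>Each monomial of \<psi> shares its group with a monomial of \<phi>, from which
      it is recovered by replacing the factor \<open>Mon l \<rho>\<close>.\<close>
    define Z where "Z = (\<Union>\<rho>\<in>Pow V. \<Union>\<tau>\<in>Pow V.
        (\<lambda>m. m - Mon l \<rho> + Mon l (\<sigma> - \<tau>)) ` Poly_Mapping.keys (\<phi> (\<tau> \<union> \<rho>)))"
    have "finite Z" by (simp add: Z_def)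
    moreover have "\<mu> \<in> Z" if nz: "cf \<sigma> \<mu> \<noteq> 0" for \<mu>
    proof -
      obtain \<rho> where \<rho>: "\<rho> \<subseteq> V - tp \<sigma> \<mu>"
        "coef (\<phi> (tp \<sigma> \<mu> \<union> \<rho>)) (base \<sigma> \<mu> + Mon l \<rho>) \<noteq> 0"
        using cf_nz[OF nz] by blast
      have "\<mu> = (base \<sigma> \<mu> + Mon l \<rho>) - Mon l \<rho> + Mon l (\<sigma> - tp \<sigma> \<mu>)"
        using base[OF True] by simp
      moreover have "base \<sigma> \<mu> + Mon l \<rho> \<in> Poly_Mapping.keys (\<phi> (tp \<sigma> \<mu> \<union> \<rho>))"
        using \<rho> by (simp add: in_keys_iff)
      moreover have "tp \<sigma> \<mu> \<in> Pow V" "\<rho> \<in> Pow V" using face_subset[OF tpK[OF True]] \<rho> by auto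
      ultimately show ?thesis unfolding Z_def by blast
    qed
    ultimately show ?thesis by (metis (mono_tags, lifting) finite_subset mem_Collect_eq subsetI)
  qed (simp add: cf_def)
  define \<psi> where "\<psi> \<sigma> = Poly_Mapping.Abs_poly_mapping (cf \<sigma>)" for \<sigma>
  have lookup_\<psi>: "coef (\<psi> \<sigma>) \<mu> = cf \<sigma> \<mu>" for \<sigma> \<mu>
    using fin[of \<sigma>] by (simp add: \<psi>_def)
  have chain: "chain K q \<psi>"
    unfolding chain_def
  proof (intro allI impI)
    fix \<sigma> assume "\<psi> \<sigma> \<noteq> 0"
    then obtain \<mu> where "cf \<sigma> \<mu> \<noteq> 0" by (metis lookup_\<psi> lookup_zero poly_mapping_eqI)
    then show "\<sigma> \<in> K \<and> card \<sigma> = q" by (auto simp: cf_def split: if_splits)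
  qed
  moreover have "\<phi> = cob (X l) \<psi>"
  proof (rule ext, rule poly_mapping_eqI)
    fix \<sigma> \<mu>
    show "coef (\<phi> \<sigma>) \<mu> = coef (cob (X l) \<psi> \<sigma>) \<mu>"
    proof (cases "\<sigma> \<in> K \<and> card \<sigma> = Suc q")
      case False
      then show ?thesis using chainD[OF \<phi>(1), of \<sigma>] chainD[OF cob_chain[OF chain], of "X l" \<sigma>] by fastforce
    next
      case True
      define \<tau> \<rho> \<kappa> where "\<tau> = tp \<sigma> \<mu>" and "\<rho> = \<sigma> - \<tau>" and "\<kappa> = base \<sigma> \<mu>"
      have sets: "\<sigma> = \<tau> \<union> \<rho>" "\<tau> \<inter> \<rho> = {}" by (auto simp: \<tau>_def \<rho>_def tp_def)
      have \<mu>: "\<mu> = \<kappa> + Mon l \<rho>" using base[of \<sigma> \<mu>] True by (simp add: \<tau>_def \<rho>_def \<kappa>_def)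
      have \<kappa>0: "expo \<kappa> l v = 0" if "v \<in> \<tau>" for v using base0 that by (simp add: \<tau>_def \<kappa>_def)
      have \<tau>K: "\<tau> \<in> K" using tpK True by (simp add: \<tau>_def)
      have sub: "\<rho> \<subseteq> V" "\<tau> \<subseteq> V" using face_subset[of \<sigma>] True sets by auto
      have finr: "finite \<rho>" "finite \<tau>" using face_finite[of \<sigma>] True sets by auto
      have cardT: "card \<tau> + card \<rho> = Suc q"
        using True sets finr by (metis card_Un_disjoint)
      have "coef (cob (X l) \<psi> \<sigma>) \<mu> = (\<Sum>v\<in>\<rho>. sg v (\<tau> \<union> (\<rho> - {v})) *
          cf (\<tau> \<union> (\<rho> - {v})) (\<kappa> + Mon l (\<rho> - {v})))"
        unfolding sets(1) \<mu> lookup_\<psi>[symmetric]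
        by (rule lookup_cob) (use sets True \<kappa>0 in auto)
      also have "\<dots> = (\<Sum>v\<in>\<rho>. sg v (\<tau> \<union> (\<rho> - {v})) * H \<tau> \<kappa> (\<rho> - {v}))"
      proof (intro sum.cong refl arg_cong2[where f = times])
        fix v assume v: "v \<in> \<rho>"
        let ?\<sigma> = "\<tau> \<union> (\<rho> - {v})" and ?\<mu> = "\<kappa> + Mon l (\<rho> - {v})"
        have K: "?\<sigma> \<in> K" using K_closed[of \<sigma> ?\<sigma>] True sets by auto
        have "?\<sigma> = \<sigma> - {v}" using sets v by auto
        then have c: "card ?\<sigma> = q" using True v sets by (simp add: card_Diff_singleton)
        \<comment> \<open>Removing \<open>v\<close> together with its variable stays in the group of
          \<tau> and \<kappa>, so the same function \<open>H \<tau> \<kappa>\<close> is read off for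
          every \<open>v\<close>.\<close>
        have tp: "tp ?\<sigma> ?\<mu> = \<tau>"
        proof -
          have "expo ?\<mu> l u = 0 \<longleftrightarrow> u \<in> \<tau>" if "u \<in> ?\<sigma>" for u
          proof -
            have "expo (Mon l (\<rho> - {v})) l u = (if l = l \<and> u \<in> \<rho> - {v} then 1 else 0)"
              by (rule expo_Mon) (use sub that in auto)
            then show ?thesis using \<kappa>0[of u] sets that by (auto simp: lookup_add)
          qed
          then show ?thesis by (auto simp: tp_def)
        qed
        have r: "?\<sigma> - \<tau> = \<rho> - {v}" using sets by auto
        have "base ?\<sigma> ?\<mu> = \<kappa>" by (simp add: base_def tp r)
        then show "cf ?\<sigma> ?\<mu> = H \<tau> \<kappa> (\<rho> - {v})"
          using K c by (simp add: cf_def tp r)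
      qed
      also have "\<dots> = g \<tau> \<kappa> \<rho>"
        using H[OF \<tau>K \<kappa>0] cardT sets True by (auto simp: good_def Un_commute)
      also have "\<dots> = coef (\<phi> \<sigma>) \<mu>" by (simp add: g_def flip: sets(1) \<mu>)
      finally show ?thesis by simp
    qed
  qed
  moreover have "bnd (d(l := d l - 1)) \<psi>"
    unfolding bnd_def lookup_\<psi>
  proof (intro allI impI)
    fix \<sigma> \<mu> k assume nz: "cf \<sigma> \<mu> \<noteq> 0"
    then have \<sigma>: "\<sigma> \<in> K" "card \<sigma> = q" by (auto simp: cf_def split: if_splits)
    define \<tau> where "\<tau> = tp \<sigma> \<mu>"
    obtain \<rho> where \<rho>: "\<rho> \<subseteq> V - \<tau>"
        "coef (\<phi> (\<tau> \<union> \<rho>)) (base \<sigma> \<mu> + Mon l \<rho>) \<noteq> 0"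
      using cf_nz[OF nz] by (auto simp: \<tau>_def)
    have less: "deg k (base \<sigma> \<mu> + Mon l \<rho>) < d k" using b \<rho> by (simp add: bnd_def)
    have fin: "finite \<sigma>" "finite \<rho>" using face_finite[OF \<sigma>(1)] \<rho>(1) finite_subset[of \<rho> V] by auto
    have "\<phi> (\<tau> \<union> \<rho>) \<noteq> 0" using \<rho>(2) by auto
    then have "card (\<tau> \<union> \<rho>) = Suc q" using chainD[OF \<phi>(1)] by auto
    moreover have "card (\<tau> \<union> \<rho>) = card \<tau> + card \<rho>"
      by (rule card_Un_disjoint) (use fin \<rho>(1) in \<open>auto simp: \<tau>_def tp_def\<close>)
    moreover have "card \<sigma> = card \<tau> + card (\<sigma> - \<tau>)"
      using fin card_Un_disjoint[of \<tau> "\<sigma> - \<tau>"] by (simp add: \<tau>_def tp_def Un_absorb1 finite_subset)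
    \<comment> \<open>Within a group, a face of \<psi> has one vertex outside \<tau> fewer than a
      face of \<phi>, hence one variable of row \<open>l\<close> fewer; this lowers the bound by
      one.\<close>
    ultimately have card: "card \<rho> = Suc (card (\<sigma> - \<tau>))" using \<sigma> by simp
    have "deg k \<mu> = deg k (base \<sigma> \<mu>) + deg k (Mon l (\<sigma> - \<tau>))"
      using base[OF \<sigma>(1), of \<mu>] by (metis \<tau>_def deg_add)
    moreover have "deg k (Mon l (\<sigma> - \<tau>)) = (if k = l then int (card (\<sigma> - \<tau>)) else 0)"
      by (rule deg_Mon) (use face_subset[OF \<sigma>(1)] in auto)
    moreover have "deg k (Mon l \<rho>) = (if k = l then int (card \<rho>) else 0)"
      by (rule deg_Mon) (use \<rho>(1) in auto)
    ultimately show "deg k \<mu> < (d(l := d l - 1)) k"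
      using less card by (auto simp: deg_add split: if_splits)
  qed
  ultimately show ?thesis by blast
qed

text \<open>In degree 0 exactness is injectivity: by \<open>link_exact\<close> at the empty face
  there is a vertex \<open>v\<close>, and \<open>X l v\<close> is not a zero divisor.\<close>

lemma cob_exact_0:
  fixes \<phi> :: "'a set \<Rightarrow> 'f mpoly"
  assumes \<phi>: "chain K 0 \<phi>" "0 < D" "cob (X l) \<phi> = (\<lambda>_. 0)"
  shows "\<phi> = (\<lambda>_. 0)"
proof (rule ccontr)
  assume "\<phi> \<noteq> (\<lambda>_. 0)"
  then obtain \<sigma> where "\<phi> \<sigma> \<noteq> 0" by auto
  moreover from this have "\<sigma> \<in> K" "card \<sigma> = 0" using chainD[OF \<phi>(1)] by auto
  ultimately have nz: "\<phi> {} \<noteq> 0" and K: "{} \<in> K" using face_finite[of \<sigma>] by auto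
  have "\<exists>h. \<forall>\<rho>. \<rho> \<inter> {} = {} \<longrightarrow> \<rho> \<union> {} \<in> K \<longrightarrow> card \<rho> = 0 \<longrightarrow>
      (1 :: 'f) = (\<Sum>v\<in>\<rho>. sg v (\<rho> - {v}) * h (\<rho> - {v}))"
  proof (rule link_exact[OF K])
    fix \<rho> assume \<rho>: "\<rho> \<union> {} \<in> K" "card \<rho> = Suc 0"
    then obtain v where v: "\<rho> = {v}" by (auto simp: card_Suc_eq)
    have "cob (X l) \<phi> {v} = X l v * \<phi> {}" using \<rho> v by (simp add: om_def)
    then have "X l v * \<phi> {} = 0" using \<phi>(3) by simp
    moreover have "X l v \<noteq> (0 :: 'f mpoly)" by (rule X_nonzero)
    ultimately show "(\<Sum>v\<in>\<rho>. sg v (\<rho> - {v}) * (1 :: 'f)) = 0" using nz by simp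
  qed (use \<phi>(2) in simp)
  then show False using K by auto
qed

lemma deg_nonneg: "0 \<le> deg l \<mu>"
  by (simp add: deg_def sum_nonneg)

lemma bnd_nonpos:
  assumes "bnd d \<phi>" "d l \<le> 0"
  shows "\<phi> = (\<lambda>_. 0)"
proof (rule ext, rule poly_mapping_eqI)
  fix \<sigma> \<mu>
  show "coef (\<phi> \<sigma>) \<mu> = coef 0 \<mu>"
    using assms deg_nonneg[of l \<mu>] unfolding bnd_def by (metis dual_order.trans lookup_zero not_less)
qed

lemma bnd_zero [simp]: "bnd d (\<lambda>_. 0)"
  by (simp add: bnd_def)

lemma bnd_mono:
  assumes "bnd d \<phi>" "\<And>l. d l \<le> d' l"
  shows "bnd d' \<phi>"
  using assms unfolding bnd_def by (meson order_less_le_trans)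

lemma bnd_add:
  assumes "bnd d \<phi>" "bnd d \<psi>"
  shows "bnd d (\<lambda>\<sigma>. \<phi> \<sigma> + \<psi> \<sigma>)"
  using assms unfolding bnd_def lookup_add by (metis add.right_neutral)

lemma bnd_cob:
  assumes "bnd d \<psi>"
  shows "bnd (d(l := d l + 1)) (cob (X l) \<psi>)"
  unfolding bnd_def
proof (intro allI impI)
  fix \<sigma> \<mu> k assume nz: "coef (cob (X l) \<psi> \<sigma>) \<mu> \<noteq> 0"
  then have \<sigma>: "\<sigma> \<in> K" by (auto simp: om_def split: if_splits)
  then have "(\<Sum>v\<in>\<sigma>. sg v (\<sigma> - {v}) * coef (X l v * \<psi> (\<sigma> - {v})) \<mu>) \<noteq> 0"
    using nz by (simp add: om_def lookup_sum lookup_sg_times)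
  then obtain v where v: "v \<in> \<sigma>" "sg v (\<sigma> - {v}) * coef (X l v * \<psi> (\<sigma> - {v})) \<mu> \<noteq> 0"
    by (rule sum.not_neutral_contains_not_neutral)
  then have pos: "0 < expo \<mu> l v" "coef (\<psi> (\<sigma> - {v})) (\<mu> - mon l v) \<noteq> 0"
    by (auto simp: lookup_X_times split: if_splits)
  have "mon l v = Mon l {v}" by (simp add: Mon_def)
  then have "deg k (mon l v) = (if k = l then 1 else 0)"
    using deg_Mon[of "{v}" k l] v face_subset[OF \<sigma>] by auto
  moreover have "deg k \<mu> = deg k (mon l v) + deg k (\<mu> - mon l v)"
    using mon_add_diff[OF pos(1)] by (metis deg_add)
  moreover have "deg k (\<mu> - mon l v) < d k" using assms pos(2) by (simp add: bnd_def)
  ultimately show "deg k \<mu> < (d(l := d l + 1)) k" by (auto split: if_splits)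
qed

lemma exists_bnd:
  assumes "chain K p \<phi>"
  shows "\<exists>d. bnd d \<phi>"
proof -
  define d where "d l = 1 + (\<Sum>(\<sigma>, \<mu>)\<in>(SIGMA \<sigma>:Pow V. Poly_Mapping.keys (\<phi> \<sigma>)). deg l \<mu>)" for l
  have "bnd d \<phi>"
    unfolding bnd_def
  proof (intro allI impI)
    fix \<sigma> \<mu> l assume nz: "coef (\<phi> \<sigma>) \<mu> \<noteq> 0"
    then have "\<phi> \<sigma> \<noteq> 0" by auto
    then have "\<sigma> \<in> Pow V" using chainD[OF assms] face_subset by auto
    with nz have mem: "(\<sigma>, \<mu>) \<in> (SIGMA \<sigma>:Pow V. Poly_Mapping.keys (\<phi> \<sigma>))" by (auto simp: in_keys_iff)
    have "(case (\<sigma>, \<mu>) of (\<sigma>, \<mu>) \<Rightarrow> deg l \<mu>) \<le>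
        (\<Sum>(\<sigma>, \<mu>)\<in>(SIGMA \<sigma>:Pow V. Poly_Mapping.keys (\<phi> \<sigma>)). deg l \<mu>)"
      by (rule member_le_sum[OF mem]) (auto simp: deg_nonneg)
    then show "deg l \<mu> < d l" by (simp add: d_def)
  qed
  then show ?thesis by blast
qed

text \<open>On the joint kernel of \<open>cob (X 0), \<dots>, cob (X (i - 1))\<close> the operator \<open>cob (X l)\<close> stays exact.
  The inner induction is on the degree in the variables of row \<open>l\<close>.\<close>

lemma joint_kernel_exact_bnd:
  assumes "i \<le> l" "Suc q < D"
    and "chain K (Suc q) \<phi>" "\<forall>a<i. cob (X a) \<phi> = (\<lambda>_. 0)" "cob (X l) \<phi> = (\<lambda>_. 0)" "bnd d \<phi>"
  shows "\<exists>\<psi>. chain K q \<psi> \<and> \<phi> = cob (X l) \<psi> \<and> (\<forall>a<i. cob (X a) \<psi> = (\<lambda>_. 0)) \<and> bnd (d(l := d l - 1)) \<psi>"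
  using assms
proof (induction i arbitrary: l q \<phi> d)
  case 0
  have "\<exists>\<psi>. chain K q \<psi> \<and> \<phi> = cob (X l) \<psi> \<and> bnd (d(l := d l - 1)) \<psi>"
    by (rule cob_exact) (use 0 in auto)
  then show ?case by (simp add: fun_upd_def)
next
  case (Suc i)
  have il: "i \<le> l" "i \<noteq> l" using Suc.prems(1) by auto
  show ?case
    using Suc.prems(3-)
  proof (induction "nat (d l)" arbitrary: \<phi> d rule: less_induct)
    case less
    show ?case
    proof (cases "d l \<le> 0")
      case True
      then have "\<phi> = (\<lambda>_. 0)" using bnd_nonpos less.prems(4) by blast
      then show ?thesis by (intro exI[of _ "\<lambda>_. 0"]) auto
    next
      case False
      obtain \<psi> where \<psi>: "chain K q \<psi>" "\<phi> = cob (X l) \<psi>" "\<forall>a<i. cob (X a) \<psi> = (\<lambda>_. 0)"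
          "bnd (d(l := d l - 1)) \<psi>"
        using Suc.IH[OF il(1) Suc.prems(2) less.prems(1) _ less.prems(3,4)] less.prems(2)
        by (meson less_SucI)
      \<comment> \<open>The obstruction to \<open>cob (X i) \<psi> = 0\<close>. It lies in the joint
        kernel of one more form and has a smaller bound in row \<open>l\<close>, so the inner
        induction applies to it.\<close>
      define \<chi> where "\<chi> = cob (X i) \<psi>"
      define d1 where "d1 = d(l := d l - 1, i := d i + 1)"
      have \<chi>: "chain K (Suc q) \<chi>" unfolding \<chi>_def by (rule cob_chain) fact
      have \<chi>0: "\<forall>a<Suc i. cob (X a) \<chi> = (\<lambda>_. 0)"
      proof (intro allI impI)
        fix a assume "a < Suc i"
        then consider "a < i" | "a = i" by linarith
        then show "cob (X a) \<chi> = (\<lambda>_. 0)"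
        proof cases
          case 1
          then show ?thesis using \<psi>(3) unfolding \<chi>_def cob_anticommute[of "X a"] by simp
        next
          case 2
          then show ?thesis unfolding \<chi>_def by (simp add: cob_cob)
        qed
      qed
      have \<chi>l: "cob (X l) \<chi> = (\<lambda>_. 0)"
        unfolding \<chi>_def cob_anticommute[of "X l"] using less.prems(2) by (simp flip: \<psi>(2))
      have \<chi>b: "bnd d1 \<chi>"
        using bnd_cob[OF \<psi>(4), of i] il by (simp add: \<chi>_def d1_def)
      have "nat (d1 l) < nat (d l)" using False il by (simp add: d1_def)
      from less.hyps[OF this \<chi> \<chi>0 \<chi>l \<chi>b]
      obtain \<psi>' where \<psi>': "chain K q \<psi>'" "\<chi> = cob (X l) \<psi>'" "\<forall>a<Suc i. cob (X a) \<psi>' = (\<lambda>_. 0)"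
          "bnd (d1(l := d1 l - 1)) \<psi>'" by blast
      have "\<exists>\<psi>''. chain K q (cob (X l) \<psi>'') \<and> \<psi>' = cob (X i) \<psi>'' \<and> (\<forall>a<i. cob (X a) \<psi>'' = (\<lambda>_. 0)) \<and>
          bnd (d(l := d l - 2)) \<psi>''"
      \<comment> \<open>There is nothing below degree 0, so injectivity replaces exactness
        there.\<close>
      proof (cases q)
        case 0
        then have "\<psi>' = (\<lambda>_. 0)" using cob_exact_0[of \<psi>' i] \<psi>' Suc.prems(2) by auto
        then show ?thesis by (intro exI[of _ "\<lambda>_. 0"]) auto
      next
        case (Suc q')
        have "Suc q' < D" "chain K (Suc q') \<psi>'" "\<forall>a<i. cob (X a) \<psi>' = (\<lambda>_. 0)"
          "cob (X i) \<psi>' = (\<lambda>_. 0)"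
          using \<psi>' Suc Suc.prems(2) by auto
        from Suc.IH[OF order_refl this \<psi>'(4)]
        obtain \<psi>'' where "chain K q' \<psi>''" "\<psi>' = cob (X i) \<psi>''" "\<forall>a<i. cob (X a) \<psi>'' = (\<lambda>_. 0)"
          "bnd ((d1(l := d1 l - 1))(i := (d1(l := d1 l - 1)) i - 1)) \<psi>''"
          by blast
        moreover have "(d1(l := d1 l - 1))(i := (d1(l := d1 l - 1)) i - 1) = d(l := d l - 2)"
          using il by (auto simp: d1_def fun_eq_iff)
        ultimately show ?thesis using cob_chain[of q' \<psi>'' "X l"] Suc by metis
      qed
      then obtain \<psi>'' where \<psi>'': "chain K q (cob (X l) \<psi>'')" "\<psi>' = cob (X i) \<psi>''"
          "\<forall>a<i. cob (X a) \<psi>'' = (\<lambda>_. 0)" "bnd (d(l := d l - 2)) \<psi>''" by blast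
      \<comment> \<open>The added term is invisible to \<open>cob (X l)\<close>, and by
        anticommutation it cancels the obstruction \<chi>.\<close>
      define \<eta> where "\<eta> \<sigma> = \<psi> \<sigma> + cob (X l) \<psi>'' \<sigma>" for \<sigma>
      have "chain K q \<eta>" unfolding \<eta>_def by (rule chain_add) fact+
      moreover have "\<phi> = cob (X l) \<eta>"
        unfolding \<eta>_def cob_add by (simp add: cob_cob flip: \<psi>(2))
      moreover have "\<forall>a<Suc i. cob (X a) \<eta> = (\<lambda>_. 0)"
      proof (intro allI impI)
        fix a assume "a < Suc i"
        then consider "a < i" | "a = i" by linarith
        then show "cob (X a) \<eta> = (\<lambda>_. 0)"
        proof cases
          case 1
          then show ?thesis using \<psi>(3) \<psi>''(3)
            unfolding \<eta>_def cob_add cob_anticommute[of "X a" "X l"] by simp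
        next
          case 2
          have "cob (X i) (cob (X l) \<psi>'') = (\<lambda>\<sigma>. - \<chi> \<sigma>)"
            unfolding cob_anticommute[of "X i" "X l"] \<psi>'(2) \<psi>''(2) ..
          then show ?thesis unfolding 2 \<eta>_def cob_add by (simp add: \<chi>_def)
        qed
      qed
      moreover have "bnd (d(l := d l - 1)) \<eta>"
        unfolding \<eta>_def
        by (rule bnd_add[OF \<psi>(4)], rule bnd_mono[OF bnd_cob[OF \<psi>''(4), of l]]) auto
      ultimately show ?thesis by blast
    qed
  qed
qed

lemma joint_kernel_exact:
  fixes \<phi> :: "'a set \<Rightarrow> 'f mpoly"
  assumes "Suc q < D" "chain K (Suc q) \<phi>" "\<forall>a<i. cob (X a) \<phi> = (\<lambda>_. 0)" "cob (X i) \<phi> = (\<lambda>_. 0)"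
  shows "\<exists>\<psi>. chain K q \<psi> \<and> \<phi> = cob (X i) \<psi> \<and> (\<forall>a<i. cob (X a) \<psi> = (\<lambda>_. 0))"
  using exists_bnd[OF assms(2)] joint_kernel_exact_bnd[OF order_refl assms] by blast

section \<open>Products of the first generic forms\<close>

primrec cobs :: "nat \<Rightarrow> ('a set \<Rightarrow> 'f mpoly) \<Rightarrow> 'a set \<Rightarrow> 'f mpoly" where
  "cobs 0 \<phi> = \<phi>"
| "cobs (Suc j) \<phi> = cob (X j) (cobs j \<phi>)"

lemma cob_scale: "cob f (\<lambda>\<sigma>. a * \<phi> \<sigma>) = (\<lambda>\<sigma>. a * cob f \<phi> \<sigma>)"
  by (rule ext) (auto simp: om_def sum_distrib_left mult_ac)

lemma cobs_linear: "cobs j (\<lambda>\<sigma>. \<phi> \<sigma> + a * \<psi> \<sigma>) = (\<lambda>\<sigma>. cobs j \<phi> \<sigma> + a * cobs j \<psi> \<sigma>)"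
  by (induction j) (auto simp: cob_add cob_scale)

lemma cobs_chain: "chain K m \<phi> \<Longrightarrow> chain K (m + j) (cobs j \<phi>)"
  by (induction j) (auto intro: cob_chain)

lemma cob_cobs: "cob f (cobs j \<phi>) = (\<lambda>\<sigma>. (- 1) ^ j * cobs j (cob f \<phi>) \<sigma>)"
proof (induction j)
  case (Suc j)
  show ?case
    unfolding cobs.simps cob_anticommute[of f "X j"] Suc cob_scale by simp
qed simp

lemma cob_cobs_zero: "a < j \<Longrightarrow> cob (X a) (cobs j \<phi>) = (\<lambda>_. 0)"
proof (induction j)
  case (Suc j)
  then show ?case
  proof (cases "a = j")
    case True
    then show ?thesis by (simp add: cob_cob)
  next
    case False
    then have "cob (X a) (cobs j \<phi>) = (\<lambda>_. 0)" using Suc by auto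
    then show ?thesis unfolding cobs.simps cob_anticommute[of "X a" "X j"] by simp
  qed
qed simp

text \<open>Each division by a form lowers both the degree and the number of forms by one. As
  \<open>q < j\<close>, degree 0 is reached while a form is left, and there injectivity
  applies.\<close>

lemma joint_kernel_low_degree:
  fixes \<phi> :: "'a set \<Rightarrow> 'f mpoly"
  assumes "q < D" "q < j" "chain K q \<phi>" "\<forall>a<j. cob (X a) \<phi> = (\<lambda>_. 0)"
  shows "\<phi> = (\<lambda>_. 0)"
  using assms
proof (induction j arbitrary: q \<phi>)
  case (Suc j)
  show ?case
  proof (cases q)
    case 0
    then show ?thesis using cob_exact_0[of \<phi> 0] Suc.prems by auto
  next
    case (Suc q')
    then obtain \<psi> where \<psi>: "chain K q' \<psi>" "\<phi> = cob (X j) \<psi>" "\<forall>a<j. cob (X a) \<psi> = (\<lambda>_. 0)"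
      using joint_kernel_exact[of q' \<phi> j] Suc.prems by auto
    then have "\<psi> = (\<lambda>_. 0)" using Suc.IH[of q' \<psi>] Suc.prems Suc by auto
    then show ?thesis using \<psi> by simp
  qed
qed simp

lemma joint_kernel_image:
  fixes \<phi> :: "'a set \<Rightarrow> 'f mpoly"
  assumes "m + j < D" "chain K (m + j) \<phi>" "\<forall>a<j. cob (X a) \<phi> = (\<lambda>_. 0)"
  shows "\<exists>\<psi>. chain K m \<psi> \<and> \<phi> = cobs j \<psi>"
  using assms
proof (induction j arbitrary: \<phi>)
  case 0
  then show ?case by auto
next
  case (Suc j)
  obtain \<psi> where \<psi>: "chain K (m + j) \<psi>" "\<phi> = cob (X j) \<psi>" "\<forall>a<j. cob (X a) \<psi> = (\<lambda>_. 0)"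
    using joint_kernel_exact[of "m + j" \<phi> j] Suc.prems by auto
  then obtain \<psi>' where "chain K m \<psi>'" "\<psi> = cobs j \<psi>'" using Suc.IH[of \<psi>] Suc.prems by auto
  then show ?case using \<psi> by auto
qed

text \<open>In exterior algebra terms: what the product of the first \<open>j\<close> forms
  annihilates lies in the ideal they generate. Exactness is applied only to products with fewer
  forms, so \<open>m + j = D\<close> is still allowed.\<close>

lemma cobs_kernel:
  assumes "m + j \<le> D" "chain K m \<phi>" "cobs j \<phi> = (\<lambda>_. 0)"
  shows "\<exists>\<psi>. \<phi> = (\<lambda>\<sigma>. \<Sum>a<j. cob (X a) (\<psi> a) \<sigma>)"
  using assms
proof (induction j arbitrary: \<phi>)
  case 0
  then show ?case by simp
next
  case (Suc j)
  let ?c = "cobs j \<phi>"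
  have c: "chain K (m + j) ?c" "\<forall>a<j. cob (X a) ?c = (\<lambda>_. 0)" "cob (X j) ?c = (\<lambda>_. 0)"
    using cobs_chain[OF Suc.prems(2)] cob_cobs_zero Suc.prems(3) by auto
  have extend: "\<exists>\<psi>. \<phi> = (\<lambda>\<sigma>. \<Sum>a<Suc j. cob (X a) (\<psi> a) \<sigma>)"
    if "\<phi> = (\<lambda>\<sigma>. (\<Sum>a<j. cob (X a) (\<psi> a) \<sigma>) + cob (X j) \<eta> \<sigma>)" for \<psi> \<eta>
    using that by (intro exI[of _ "\<psi>(j := \<eta>)"]) simp
  have zero: ?case if c0: "?c = (\<lambda>_. 0)"
  proof -
    obtain \<psi> where "\<phi> = (\<lambda>\<sigma>. \<Sum>a<j. cob (X a) (\<psi> a) \<sigma>)"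
      using Suc.IH[OF _ Suc.prems(2) c0] Suc.prems(1) by auto
    then show ?thesis by (intro extend[of \<psi> "\<lambda>_. 0"]) simp
  qed
  show ?case
  proof (cases "m + j")
    case 0
    then show ?thesis using cob_exact_0[of ?c j] c Suc.prems(1) by (intro zero) auto
  next
    case (Suc q)
    then obtain \<psi> where \<psi>: "chain K q \<psi>" "?c = cob (X j) \<psi>" "\<forall>a<j. cob (X a) \<psi> = (\<lambda>_. 0)"
      using joint_kernel_exact[of q ?c j] c Suc.prems by auto
    show ?thesis
    proof (cases m)
      case 0
      \<comment> \<open>Here \<psi> has degree \<open>j - 1\<close> and is killed by
        \<open>j\<close> forms.\<close>
      then have "\<psi> = (\<lambda>_. 0)" using joint_kernel_low_degree[of q j \<psi>] \<psi> Suc Suc.prems by auto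
      then show ?thesis using \<psi> by (intro zero) simp
    next
      case m: (Suc m')
      obtain \<psi>' where \<psi>': "chain K m' \<psi>'" "\<psi> = cobs j \<psi>'"
        using joint_kernel_image[of m' j \<psi>] \<psi> Suc m Suc.prems by auto
      define s :: "'f mpoly" where "s = (- 1) ^ j"
      \<comment> \<open>The correction makes the product of the first \<open>j\<close> forms vanish
        on \<open>\<phi>'\<close>; \<open>s\<close> is the sign of moving \<open>cob (X j)\<close>
        past them.\<close>
      define \<phi>' where "\<phi>' \<sigma> = \<phi> \<sigma> + (- s) * cob (X j) \<psi>' \<sigma>" for \<sigma>
      have "chain K m (cob (X j) \<psi>')" using cob_chain[OF \<psi>'(1)] m by simp
      then have "chain K m \<phi>'"
        using Suc.prems(2) unfolding \<phi>'_def chain_def by (metis add.right_neutral mult_zero_right)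
      moreover have "cobs j \<phi>' = (\<lambda>_. 0)"
        unfolding \<phi>'_def cobs_linear \<psi>(2) \<psi>'(2) cob_cobs by (simp add: s_def)
      ultimately obtain \<xi> where \<xi>: "\<phi>' = (\<lambda>\<sigma>. \<Sum>a<j. cob (X a) (\<xi> a) \<sigma>)"
        using Suc.IH[of \<phi>'] Suc.prems(1) by auto
      have "\<phi> \<sigma> = (\<Sum>a<j. cob (X a) (\<xi> a) \<sigma>) + cob (X j) (\<lambda>\<sigma>. s * \<psi>' \<sigma>) \<sigma>" for \<sigma>
        using fun_cong[OF \<xi>, of \<sigma>] by (simp add: \<phi>'_def cob_scale algebra_simps)
      then show ?thesis by (intro extend[of \<xi> "\<lambda>\<sigma>. s * \<psi>' \<sigma>"] ext)
    qed
  qed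
qed

lemma pairing_con:
  assumes "chain K p c"
  shows "(\<Sum>\<sigma>\<in>Pow V. \<phi> \<sigma> * con X (rev [0..<n]) c \<sigma>) = (\<Sum>\<sigma>\<in>Pow V. cobs n \<phi> \<sigma> * c \<sigma>)"
  using assms
proof (induction n arbitrary: c p)
  case (Suc n)
  have "chain K (p - 1) (bd (X n) c)" by (rule bd_chain(1)[OF K_closed Suc.prems])
  from Suc.IH[OF this] show ?case
    using pairing_bd[of c K "X n" "cobs n \<phi>"] chainD[OF Suc.prems] by simp
qed simp

text \<open>Dual to \<open>cobs_kernel\<close>: a functional vanishing on all \<open>n\<close>-fold
  contractions is annihilated by the product of the forms, hence lies in their ideal, and so pairs
  to zero with every joint cycle. The factor \<open>d\<close> stands for the missing
  fractions.\<close>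

lemma joint_cycles_are_boundaries:
  fixes y :: "'a set \<Rightarrow> 'f mpoly"
  assumes y: "chain K m y" "\<And>i. i < n \<Longrightarrow> bd (X i) y = (\<lambda>_. 0)" and n: "m + n \<le> D"
  shows "\<exists>d c. d \<noteq> 0 \<and> chain K (m + n) c \<and> (\<lambda>\<tau>. d * y \<tau>) = con X [0..<n] c"
proof -
  define P where "P = {\<sigma>\<in>K. card \<sigma> = m + n}"
  have finP: "finite P" using finite_subset[OF K_subset] by (simp add: P_def)
  define ind :: "'a set \<Rightarrow> 'a set \<Rightarrow> 'f mpoly" where "ind \<sigma> \<tau> = (if \<tau> = \<sigma> then 1 else 0)" for \<sigma> \<tau>
  have ind: "chain K (m + n) (ind \<sigma>)" if "\<sigma> \<in> P" for \<sigma>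
    using that by (auto simp: chain_def ind_def P_def)
  \<comment> \<open>Transposition reverses the order of the contractions; \<open>con_perm\<close>
    restores it at the cost of a sign.\<close>
  let ?L = "rev [0..<n]"
  have con_ch: "chain K m (con X ?L c)" if "chain K (m + n) c" for c :: "'a set \<Rightarrow> 'f mpoly"
    using con_chain(1)[OF K_closed that, where L = ?L and X = X] by simp
  consider (span) d \<beta> where "d \<noteq> 0" "\<forall>x\<in>Pow V. d * y x = (\<Sum>\<sigma>\<in>P. \<beta> \<sigma> * con X ?L (ind \<sigma>) x)"
    | (sep) \<phi> where "\<forall>\<sigma>\<in>P. (\<Sum>x\<in>Pow V. \<phi> x * con X ?L (ind \<sigma>) x) = 0" "(\<Sum>x\<in>Pow V. \<phi> x * y x) \<noteq> 0"
    using span_or_separating_functional[OF finP, of "Pow V" y "\<lambda>\<sigma>. con X ?L (ind \<sigma>)"] by auto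
  then show ?thesis
  proof cases
    case span
    define c where "c \<tau> = (\<Sum>\<sigma>\<in>P. \<beta> \<sigma> * ind \<sigma> \<tau>)" for \<tau>
    have c: "chain K (m + n) c"
      unfolding chain_def
    proof (intro allI impI)
      fix \<tau> assume "c \<tau> \<noteq> 0"
      then obtain \<sigma> where "\<sigma> \<in> P" "\<beta> \<sigma> * ind \<sigma> \<tau> \<noteq> 0"
        unfolding c_def by (rule sum.not_neutral_contains_not_neutral)
      then show "\<tau> \<in> K \<and> card \<tau> = m + n" by (auto simp: ind_def P_def split: if_splits)
    qed
    have dy: "d * y x = con X ?L c x" for x
    proof (cases "x \<in> Pow V")
      case True
      then show ?thesis using span(2) unfolding c_def con_sum by blast
    next
      case False
      then have "y x = 0" "con X ?L c x = 0"
        using chainD[OF y(1), of x] chainD[OF con_ch[OF c], of x] face_subset by auto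
      then show ?thesis by simp
    qed
    obtain s where s: "con X ?L c = (\<lambda>\<tau>. s * con X [0..<n] c \<tau>)"
      using con_perm[of ?L "[0..<n]" X c] by auto
    have "(\<lambda>\<tau>. d * y \<tau>) = con X [0..<n] (\<lambda>\<tau>. s * c \<tau>)"
      unfolding con_scale by (rule ext) (simp only: dy s)
    moreover have "chain K (m + n) (\<lambda>\<tau>. s * c \<tau>)"
      using c unfolding chain_def by (metis mult_zero_right)
    ultimately show ?thesis using span(1) by blast
  next
    case sep
    define \<phi>' where "\<phi>' \<sigma> = (if \<sigma> \<in> K \<and> card \<sigma> = m then \<phi> \<sigma> else 0)" for \<sigma>
    have \<phi>': "chain K m \<phi>'" by (auto simp: chain_def \<phi>'_def)
    have same: "(\<Sum>x\<in>Pow V. \<phi> x * z x) = (\<Sum>x\<in>Pow V. \<phi>' x * z x)" if "chain K m z" for z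
      using chainD[OF that] by (intro sum.cong refl) (auto simp: \<phi>'_def)
    have "cobs n \<phi>' = (\<lambda>_. 0)"
    proof
      fix \<sigma>
      show "cobs n \<phi>' \<sigma> = 0"
      proof (cases "\<sigma> \<in> P")
        case True
        then have "\<sigma> \<in> Pow V" using face_subset by (auto simp: P_def)
        then have "cobs n \<phi>' \<sigma> = (\<Sum>x\<in>Pow V. cobs n \<phi>' x * ind \<sigma> x)"
          by (simp add: ind_def if_distrib[of "\<lambda>c. _ * c"] cong: if_cong)
        also have "\<dots> = (\<Sum>x\<in>Pow V. \<phi> x * con X ?L (ind \<sigma>) x)"
          unfolding same[OF con_ch[OF ind[OF True]]] by (rule pairing_con[OF ind[OF True], symmetric])
        finally show ?thesis using sep(1) True by simp
      next
        case False
        then show ?thesis using chainD[OF cobs_chain[OF \<phi>', of n], of \<sigma>] by (auto simp: P_def)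
      qed
    qed
    then obtain \<psi> where \<psi>: "\<phi>' = (\<lambda>\<sigma>. \<Sum>a<n. cob (X a) (\<psi> a) \<sigma>)"
      using cobs_kernel[OF n \<phi>'] by blast
    have "(\<Sum>x\<in>Pow V. \<phi> x * y x) = (\<Sum>a<n. \<Sum>x\<in>Pow V. cob (X a) (\<psi> a) x * y x)"
      unfolding same[OF y(1)] \<psi> sum_distrib_right by (rule sum.swap)
    also have "\<dots> = (\<Sum>a<n. \<Sum>x\<in>Pow V. \<psi> a x * bd (X a) y x)"
      by (intro sum.cong refl pairing_bd) (use chainD[OF y(1)] in auto)
    also have "\<dots> = 0" using y(2) by simp
    finally show ?thesis using sep(2) by contradiction
  qed
qed

end

section \<open>Exterior algebraic shifting\<close>

lemma lexless_linear:
  assumes "R \<noteq> S"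
  shows "lexless R S \<or> lexless S R"
proof -
  define p where "p = (LEAST p. (p \<in> R) \<noteq> (p \<in> S))"
  have ex: "\<exists>p. (p \<in> R) \<noteq> (p \<in> S)" using assms by auto
  have p: "(p \<in> R) \<noteq> (p \<in> S)" unfolding p_def by (rule LeastI_ex[OF ex])
  have "\<forall>q<p. q \<in> R \<longleftrightarrow> q \<in> S" unfolding p_def using not_less_Least by blast
  with p show ?thesis unfolding lexless_def by metis
qed

context cm_complex begin

text \<open>Exterior algebraic shifting in terms of chains: \<open>ext_shift B r\<close> consists of the lexicographically
  first coordinates of the chains supported on \<open>B\<close>. The coordinates range over all finite sets of
  rows of the generic matrix \<open>X\<close>, which has infinitely many rows, so that rows not occurring in a
  given chain are always available.\<close>

definition leading :: "nat set \<Rightarrow> ('a set \<Rightarrow> 'f mpoly) \<Rightarrow> bool" where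
  "leading S c \<longleftrightarrow> coord X S c \<noteq> 0 \<and>
     (\<forall>R. finite R \<longrightarrow> card R = card S \<longrightarrow> lexless R S \<longrightarrow> coord X R c = 0)"

definition ext_shift :: "'a set set \<Rightarrow> nat \<Rightarrow> nat set set" where
  "ext_shift B r = {S. finite S \<and> card S = r \<and> (\<exists>c. chain B r c \<and> leading S c)}"

lemma ext_shift_mono: "B \<subseteq> B' \<Longrightarrow> ext_shift B r \<subseteq> ext_shift B' r"
  unfolding ext_shift_def by (auto intro: chain_mono)

lemma ext_shift_finite: "S \<in> ext_shift B r \<Longrightarrow> finite S"
  and ext_shift_card: "S \<in> ext_shift B r \<Longrightarrow> card S = r"
  by (auto simp: ext_shift_def)

lemma exists_leading:
  fixes c :: "'a set \<Rightarrow> 'f mpoly"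
  assumes "chain B r c" "B \<subseteq> Pow V" "c \<noteq> (\<lambda>_. 0)"
  shows "\<exists>S\<in>ext_shift B r. coord X S c \<noteq> 0"
proof -
  let ?F = "{S. finite S \<and> card S = r \<and> coord X S c \<noteq> 0}"
  have "?F \<noteq> {}"
    using exists_coord_nonzero[OF chain_mono[OF assms(1,2)] assms(3), of 0] by auto
  then have "\<exists>S\<in>?F. \<forall>R\<in>?F. \<not> lexless R S"
    by (intro lexless_minimal[of _ r]) auto
  then obtain S where S: "finite S" "card S = r" "coord X S c \<noteq> 0" "\<forall>R\<in>?F. \<not> lexless R S" by blast
  then have "leading S c" unfolding leading_def by auto
  then show ?thesis using S assms(1) unfolding ext_shift_def by blast
qed

text \<open>\<open>leading\<close> compares sets of equal size only; for other sizes the coordinate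
  vanishes by degree.\<close>

lemma leading_vanish:
  assumes "leading S c" "chain (Pow V) (card S) c" "finite R" "lexless R S"
  shows "coord X R c = 0"
  using assms coord_card[OF assms(2,3)] by (cases "card R = card S") (auto simp: leading_def)

lemma ext_shift_intersecting:
  assumes B: "B \<subseteq> Pow V" "\<And>\<sigma> \<tau>. \<sigma> \<in> B \<Longrightarrow> \<tau> \<in> B \<Longrightarrow> \<sigma> \<inter> \<tau> \<noteq> {}"
    and S: "S \<in> ext_shift B r" and T: "T \<in> ext_shift B r"
  shows "S \<inter> T \<noteq> {}"
proof
  assume disj: "S \<inter> T = {}"
  obtain x where x: "chain B r x" "leading S x" using S by (auto simp: ext_shift_def)
  obtain y where y: "chain B r y" "leading T y" using T by (auto simp: ext_shift_def)
  have fin: "finite (S \<union> T)" using S T by (auto simp: ext_shift_def)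
  have chains: "chain (Pow V) r x" "chain (Pow V) r y" using x y chain_mono B(1) by blast+
  have "wedge x y = (\<lambda>_. 0)"
  proof
    fix \<tau>
    have zero: "x \<alpha> * y (\<tau> - \<alpha>) = 0" for \<alpha>
    proof (rule ccontr)
      assume "x \<alpha> * y (\<tau> - \<alpha>) \<noteq> 0"
      then have "\<alpha> \<in> B" "\<tau> - \<alpha> \<in> B" using chainD[OF x(1)] chainD[OF y(1)] by auto
      from B(2)[OF this] show False by auto
    qed
    show "wedge x y \<tau> = 0"
      by (simp only: wedge_def zero mult_zero_right sum.neutral_const if_cancel)
  qed
  moreover have "\<exists>s. s * s = 1 \<and> coord X (S \<union> T) (wedge x y) = s * (coord X S x * coord X T y)"
  proof (rule coord_wedge[OF chains(1) fin refl disj])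
    show "coord X R x = 0" if "R \<subseteq> S \<union> T" "lexless R S" for R
      using leading_vanish[OF x(2) _ finite_subset[OF that(1) fin] that(2)] chains ext_shift_card[OF S] by simp
    show "coord X R y = 0" if "R \<subseteq> S \<union> T" "lexless R T" for R
      using leading_vanish[OF y(2) _ finite_subset[OF that(1) fin] that(2)] chains ext_shift_card[OF T] by simp
  qed
  ultimately have "coord X S x * coord X T y = 0" by auto
  then show False using x y by (simp add: leading_def)
qed

text \<open>The automorphism exchanging rows \<open>i\<close> and \<open>j\<close>, applied to the
  coefficients of a chain with leading set \<open>T\<close>, permutes the coordinates but leaves the
  support alone.\<close>

lemma ext_shift_shifted:
  assumes T: "T \<in> ext_shift B r" and ij: "i < j" "j \<in> T" "i \<notin> T"
  shows "insert i (T - {j}) \<in> ext_shift B r"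
proof -
  obtain c where c: "chain B r c" "leading T c" using T by (auto simp: ext_shift_def)
  have T': "finite T" "card T = r" using T by (auto simp: ext_shift_def)
  obtain \<Phi> :: "'f mpoly \<Rightarrow> 'f mpoly" where \<Phi>: "\<And>x y. \<Phi> (x + y) = \<Phi> x + \<Phi> y"
    "\<And>x y. \<Phi> (x * y) = \<Phi> x * \<Phi> y" "\<Phi> 1 = 1" "\<And>x. \<Phi> x = 0 \<longleftrightarrow> x = 0"
    "\<And>k v. \<Phi> (X k v) = X ((id(i := j, j := i)) k) v"
    using exists_row_automorphism[of i j] by auto
  let ?s = "id(i := j, j := i)"
  have ss: "?s (?s k) = k" for k by simp
  have inj: "inj ?s" by (rule inj_on_inverseI[of _ ?s]) (rule ss)
  define c' where "c' \<tau> = \<Phi> (c \<tau>)" for \<tau>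
  have coord: "coord X (?s ` R) c' = 0 \<longleftrightarrow> coord X R c = 0" if "finite R" for R
  proof -
    let ?L = "map ?s (sorted_list_of_set R)"
    have "distinct ?L" using inj that by (auto simp: distinct_map intro: inj_on_subset)
    moreover have "set ?L = ?s ` R" using that by simp
    ultimately have "coord X (?s ` R) c' = 0 \<longleftrightarrow> con X ?L c' {} = 0"
      using con_eq_0_iff_coord[of ?L X c'] by simp
    also have "con X ?L c' {} = \<Phi> (con X (sorted_list_of_set R) c {})"
      unfolding c'_def
      using con_map_hom[of \<Phi> X ?s "sorted_list_of_set R" c, OF \<Phi>(1,2,3,5)] by (rule fun_cong)
    finally show ?thesis using \<Phi>(4) by (simp add: coord_def)
  qed
  have S: "insert i (T - {j}) = ?s ` T"
    using ij by (auto simp: image_iff)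
  have card_s: "card (?s ` R) = card R" for R
    by (rule card_image) (rule inj_on_subset[OF inj subset_UNIV])
  have card: "card (?s ` T) = r" unfolding card_s by fact
  have "leading (?s ` T) c'"
    unfolding leading_def
  proof (intro conjI allI impI)
    show "coord X (?s ` T) c' \<noteq> 0" unfolding coord[OF T'(1)] using c(2) by (simp add: leading_def)
    fix R assume R: "finite R" "card R = card (?s ` T)" "lexless R (?s ` T)"
    have "lexless (?s ` R) T" by (rule lexless_transpose) (use ij R S in auto)
    moreover have "card (?s ` R) = card T" using R(2) unfolding card_s .
    ultimately have "coord X (?s ` R) c = 0" using c(2) R(1) by (simp add: leading_def)
    moreover have "?s ` (?s ` R) = R" unfolding image_image ss by (rule image_ident)
    ultimately show "coord X R c' = 0" using coord[OF finite_imageI[OF R(1), of ?s]] by (simp only:)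
  qed
  moreover have "chain B r c'" using c(1) \<Phi>(4) by (simp add: chain_def c'_def)
  moreover have "finite (?s ` T)" using T'(1) by (rule finite_imageI)
  ultimately show ?thesis unfolding S ext_shift_def using card by blast
qed

text \<open>Up to sign, the coordinates of the contraction with \<open>X i\<close> are those of
  \<open>c\<close> on the sets through \<open>i\<close>. This is what makes the shifted family
  closed under subsets.\<close>

lemma ext_shift_remove:
  assumes G: "G \<in> ext_shift K (card G)" "i \<in> G"
  shows "G - {i} \<in> ext_shift K (card (G - {i}))"
proof -
  obtain c where c: "chain K (card G) c" "leading G c" and fin: "finite G"
    using G by (auto simp: ext_shift_def)
  have "leading (G - {i}) (bd (X i) c)"
    unfolding leading_def
  proof (intro conjI allI impI)
    show "coord X (G - {i}) (bd (X i) c) \<noteq> 0"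
      using coord_bd_insert[of "G - {i}" X i c] fin G(2) c(2) by (simp add: insert_absorb leading_def)
    fix R assume R: "finite R" "card R = card (G - {i})" "lexless R (G - {i})"
    show "coord X R (bd (X i) c) = 0"
    proof (cases "i \<in> R")
      case True
      then show ?thesis using coord_bd_insert[OF R(1), of X i c] by simp
    next
      case False
      obtain p where p: "p \<in> R" "p \<notin> G - {i}" "\<forall>q<p. q \<in> R \<longleftrightarrow> q \<in> G - {i}"
        using R(3) by (auto simp: lexless_def)
      have "lexless (insert i R) G"
        unfolding lexless_def using p False G(2) by (intro exI[of _ p]) auto
      moreover have "card (insert i R) = card G"
        using R False fin G(2) by (metis card.insert card.remove)
      ultimately have "coord X (insert i R) c = 0" using c(2) R(1) by (simp add: leading_def)
      then show ?thesis using coord_bd_insert[OF R(1), of X i c] by simp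
    qed
  qed
  moreover have "chain K (card (G - {i})) (bd (X i) c)"
    using bd_chain(1)[OF K_closed c(1)] fin G(2) by simp
  ultimately show ?thesis using fin by (auto simp: ext_shift_def)
qed

lemma ext_shift_subset:
  assumes "G \<in> ext_shift K (card G)" "S \<subseteq> G"
  shows "S \<in> ext_shift K (card S)"
proof -
  have fin: "finite G" using assms ext_shift_finite by blast
  have "finite W \<Longrightarrow> W \<subseteq> G \<Longrightarrow> G - W \<in> ext_shift K (card (G - W))" for W
  proof (induction W rule: finite_induct)
    case (insert i W)
    then have "G - W - {i} \<in> ext_shift K (card (G - W - {i}))" by (intro ext_shift_remove) auto
    moreover have "G - insert i W = G - W - {i}" by auto
    ultimately show ?case by simp
  qed (use assms in simp)
  from this[of "G - S"] show ?thesis using assms fin by (simp add: double_diff)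
qed

text \<open>If \<open>c\<close> has leading set \<open>T\<close>, then its contraction with the first \<open>j\<close> generic forms is a cycle for
  the first \<open>j + 1\<close> forms, hence up to a scalar the contraction of a chain \<open>c'\<close> with these forms,
  and \<open>c'\<close> has leading set \<open>insert j T\<close>.\<close>

lemma ext_shift_insert:
  assumes T: "T \<in> ext_shift K (card T)" and j: "{..<j} \<subseteq> T" "j \<notin> T" and D: "card T < D"
  shows "insert j T \<in> ext_shift K (Suc (card T))"
proof -
  obtain c where c: "chain K (card T) c" "leading T c" and fin: "finite T"
    using T by (auto simp: ext_shift_def)
  define T' where "T' = T - {..<j}"
  have T'1: "T = {..<j} \<union> T'" "finite T'" using j fin by (auto simp: T'_def)
  have "Suc j \<le> q" if "q \<in> T'" for q
    using that j(2) by (cases q j rule: linorder_cases) (auto simp: T'_def)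
  note T' = T'1 this
  define m where "m = card T'"
  have "card ({..<j} \<union> T') = j + m"
    by (subst card_Un_disjoint) (use T'(2) in \<open>auto simp: m_def T'_def\<close>)
  then have cardT: "card T = j + m" by (simp flip: T'(1))
  define y where "y = con X [0..<j] c"
  have y: "chain K m y"
    using con_chain(1)[OF K_closed c(1), where L = "[0..<j]" and X = X] cardT by (simp add: y_def)
  have coord_y: "coord X R y = coord X ({..<j} \<union> R) c" if "finite R" "\<And>q. q \<in> R \<Longrightarrow> j \<le> q" for R
    unfolding y_def by (rule coord_prefix[symmetric]) (use that in auto)
  have cycle: "bd (X i) y = (\<lambda>_. 0)" if i: "i < Suc j" for i
  proof (cases "i = j")
    case False
    then have "\<not> distinct ([0..<j] @ [i])" using i by auto
    then have "con X ([0..<j] @ [i]) c = (\<lambda>_. 0)" by (rule con_not_distinct)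
    then show ?thesis by (simp add: con_append y_def)
  next
    case True
    show ?thesis
    proof (rule ccontr)
      assume nz: "bd (X i) y \<noteq> (\<lambda>_. 0)"
      have "chain (Pow V) (m - 1) (bd (X i) y)"
        using chain_mono[OF bd_chain(1)[OF K_closed y] K_subset] .
      \<comment> \<open>With rows beyond \<open>j\<close>, the set
        \<open>{..<j} \<union> insert j Q\<close> precedes \<open>T\<close>, because
        \<open>T\<close> contains all numbers below \<open>j\<close> but not
        \<open>j\<close>.\<close>
      from exists_coord_nonzero[OF this nz, of "Suc j"]
      obtain Q where Q: "finite Q" "\<forall>q\<in>Q. Suc j \<le> q" "coord X Q (bd (X i) y) \<noteq> 0" by auto
      have "coord X Q (bd (X i) y) = coord X (insert j Q) y"
        unfolding True by (rule coord_insert_min[symmetric]) (use Q in auto)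
      also have "\<dots> = coord X ({..<j} \<union> insert j Q) c"
        by (rule coord_y) (use Q in force)+
      also have "\<dots> = 0"
        by (rule leading_vanish[OF c(2) chain_mono[OF c(1) K_subset]])
          (use Q j in \<open>auto simp: lexless_def intro!: exI[of _ j]\<close>)
      finally show False using Q by simp
    qed
  qed
  obtain d c' where d: "d \<noteq> 0" and c': "chain K (m + Suc j) c'" "(\<lambda>\<tau>. d * y \<tau>) = con X [0..<Suc j] c'"
    using joint_cycles_are_boundaries[OF y cycle, of "Suc j"] cardT D by auto
  have coord_c': "coord X ({..<Suc j} \<union> R) c' = d * coord X R y" if "finite R" "\<And>q. q \<in> R \<Longrightarrow> Suc j \<le> q" for R
  proof -
    have "coord X ({..<Suc j} \<union> R) c' = coord X R (con X [0..<Suc j] c')"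
      by (rule coord_prefix) (use that in auto)
    then show ?thesis by (simp only: c'(2)[symmetric] coord_scale)
  qed
  have ins: "insert j T = {..<Suc j} \<union> T'" using j by (auto simp: T'_def lessThan_Suc)
  have card_ins: "card (insert j T) = Suc (card T)" using j fin by simp
  have "leading (insert j T) c'"
    unfolding leading_def
  proof (intro conjI allI impI)
    have "coord X T' y = coord X T c"
      unfolding arg_cong[OF T'(1), of "\<lambda>T. coord X T c"]
      by (rule coord_y[OF T'(2)]) (rule Suc_leD[OF T'(3)])
    moreover have "coord X (insert j T) c' = d * coord X T' y"
      unfolding ins by (rule coord_c'[OF T'(2)]) (rule T'(3))
    ultimately show "coord X (insert j T) c' \<noteq> 0" using d c(2) by (simp add: leading_def)
    fix R assume R: "finite R" "card R = card (insert j T)" "lexless R (insert j T)"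
    then obtain p where p: "p \<in> R" "p \<notin> insert j T" "\<forall>q<p. q \<in> R \<longleftrightarrow> q \<in> insert j T"
      by (auto simp: lexless_def)
    \<comment> \<open>All numbers up to \<open>j\<close> lie in \<open>insert j T\<close>, so the
      first difference comes later and \<open>R\<close> contains them as well.\<close>
    have "j < p" using p(2) j(1) by (cases j p rule: linorder_cases) auto
    have jT: "x \<in> T" if "x < j" for x using that j(1) by auto
    have prefix: "{..<Suc j} \<subseteq> R" using \<open>j < p\<close> p(3) jT by (auto simp: less_Suc_eq)
    define R' where "R' = R - {..<Suc j}"
    have R': "R = {..<Suc j} \<union> R'" "finite R'" "\<And>q. q \<in> R' \<Longrightarrow> Suc j \<le> q"
      using prefix R(1) by (auto simp: R'_def)
    have "coord X R' y = coord X ({..<j} \<union> R') c"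
      by (rule coord_y[OF R'(2)]) (rule Suc_leD[OF R'(3)])
    moreover have "\<dots> = 0"
    proof (rule leading_vanish[OF c(2) chain_mono[OF c(1) K_subset]])
      show "lexless ({..<j} \<union> R') T"
        unfolding lexless_def
      proof (intro exI[of _ p] conjI allI impI)
        show "p \<in> {..<j} \<union> R'" "p \<notin> T" using p \<open>j < p\<close> by (auto simp: R'_def)
        fix q assume "q < p"
        then show "(q \<in> {..<j} \<union> R') = (q \<in> T)" using p(3) j(2) jT by (auto simp: R'_def less_Suc_eq)
      qed
    qed (use R' in auto)
    moreover have "coord X R c' = d * coord X R' y"
      unfolding arg_cong[OF R'(1), of "\<lambda>R. coord X R c'"] by (rule coord_c'[OF R'(2)]) (rule R'(3))
    ultimately show "coord X R c' = 0" by simp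
  qed
  then show ?thesis using c'(1) cardT card_ins fin by (auto simp: ext_shift_def add.commute)
qed

text \<open>The missing numbers are added in increasing order, so that everything below the new
  number is already present, as \<open>ext_shift_insert\<close> requires.\<close>

lemma ext_shift_Un_prefix:
  assumes S: "S \<in> ext_shift K (card S)" and D: "card (S \<union> {..<j}) \<le> D"
  shows "S \<union> {..<j} \<in> ext_shift K (card (S \<union> {..<j}))"
  using D
proof (induction j)
  case (Suc j)
  have fin: "finite S" using S ext_shift_finite by blast
  have eq: "S \<union> {..<Suc j} = insert j (S \<union> {..<j})" by (auto simp: lessThan_Suc)
  have "card (S \<union> {..<j}) \<le> card (S \<union> {..<Suc j})" by (rule card_mono) (use fin in auto)
  then have IH: "S \<union> {..<j} \<in> ext_shift K (card (S \<union> {..<j}))" using Suc by simp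
  show ?case
  proof (cases "j \<in> S \<union> {..<j}")
    case True
    then show ?thesis using IH unfolding eq by (simp add: insert_absorb)
  next
    case False
    have "insert j (S \<union> {..<j}) \<in> ext_shift K (Suc (card (S \<union> {..<j})))"
      by (rule ext_shift_insert[OF IH]) (use False fin Suc.prems in \<open>auto simp: eq\<close>)
    then show ?thesis unfolding eq using False fin by simp
  qed
qed (use S in simp)

text \<open>With fewer leading sets than faces, some nonzero chain on \<open>B\<close> would have
  coordinate zero at all of them, against \<open>exists_leading\<close>. The subset \<open>P\<close>
  avoids deciding whether \<open>ext_shift B r\<close>, which draws on infinitely many rows, is
  finite.\<close>

lemma ext_shift_large:
  assumes B: "B \<subseteq> Pow V" "\<And>\<sigma>. \<sigma> \<in> B \<Longrightarrow> card \<sigma> = r"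
  shows "\<exists>P\<subseteq>ext_shift B r. finite P \<and> card P = card B"
proof (rule ccontr)
  assume no: "\<not> ?thesis"
  have finB: "finite B" using B(1) finite_subset by fastforce
  have fin: "finite (ext_shift B r)"
    using no infinite_arbitrarily_large by blast
  have "card (ext_shift B r) < card B"
  proof (rule ccontr)
    assume "\<not> ?thesis"
    then obtain P where "P \<subseteq> ext_shift B r" "card P = card B"
      by (metis not_less obtain_subset_with_card_n)
    with no fin show False using finite_subset by blast
  qed
  define ind :: "'a set \<Rightarrow> 'a set \<Rightarrow> 'f mpoly" where "ind \<sigma> \<tau> = (if \<tau> = \<sigma> then 1 else 0)" for \<sigma> \<tau>
  obtain \<alpha> where \<alpha>: "\<exists>\<sigma>\<in>B. \<alpha> \<sigma> \<noteq> 0" "\<forall>S\<in>ext_shift B r. (\<Sum>\<sigma>\<in>B. \<alpha> \<sigma> * coord X S (ind \<sigma>)) = 0"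
    using homogeneous_system_nontrivial[OF fin finB \<open>card _ < card B\<close>, of "\<lambda>S \<sigma>. coord X S (ind \<sigma>)"] by blast
  define c where "c \<tau> = (\<Sum>\<sigma>\<in>B. \<alpha> \<sigma> * ind \<sigma> \<tau>)" for \<tau>
  have c: "c \<tau> = (if \<tau> \<in> B then \<alpha> \<tau> else 0)" for \<tau>
    unfolding c_def ind_def using finB
    by (simp add: if_distrib[of "\<lambda>x. _ * x"] cong: if_cong)
  have "chain B r c" using B(2) by (auto simp: chain_def c)
  moreover have "c \<noteq> (\<lambda>_. 0)" using \<alpha>(1) c by (metis)
  ultimately obtain S where "S \<in> ext_shift B r" "coord X S c \<noteq> 0"
    using exists_leading B(1) by blast
  then show False using \<alpha>(2) unfolding c_def coord_sum by blast
qed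

text \<open>In a near-cone with apex \<open>v\<close>, a chain of the form \<open>bd f c\<close> is determined by its values on the
  link of \<open>v\<close>.\<close>

lemma card_ext_shift_with_0:
  assumes apex: "v \<in> V" "\<And>\<sigma> u. \<sigma> \<in> K \<Longrightarrow> u \<in> \<sigma> \<Longrightarrow> insert v (\<sigma> - {u}) \<in> K"
    and Q: "finite Q" "Q \<subseteq> ext_shift K r" "\<And>S. S \<in> Q \<Longrightarrow> 0 \<in> S"
  shows "card Q \<le> card {\<tau>\<in>K. card \<tau> = r - 1 \<and> v \<notin> \<tau> \<and> insert v \<tau> \<in> K}"
proof (rule ccontr)
  let ?L = "{\<tau>\<in>K. card \<tau> = r - 1 \<and> v \<notin> \<tau> \<and> insert v \<tau> \<in> K}"
  assume "\<not> ?thesis"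
  then have less: "card ?L < card Q" by simp
  have finL: "finite ?L" using finite_subset[OF K_subset] by simp
  have "\<forall>S\<in>Q. \<exists>c. chain K r c \<and> leading S c" using Q(2) by (auto simp: ext_shift_def)
  then obtain c where c: "\<And>S. S \<in> Q \<Longrightarrow> chain K r (c S)" "\<And>S. S \<in> Q \<Longrightarrow> leading S (c S)"
    by metis
  obtain \<alpha> where \<alpha>: "\<exists>S\<in>Q. \<alpha> S \<noteq> 0" "\<forall>\<tau>\<in>?L. (\<Sum>S\<in>Q. \<alpha> S * bd (X 0) (c S) \<tau>) = 0"
    using homogeneous_system_nontrivial[OF finL Q(1) less, of "\<lambda>\<tau> S. bd (X 0) (c S) \<tau>"] by blast
  define w where "w \<tau> = (\<Sum>S\<in>Q. \<alpha> S * c S \<tau>)" for \<tau>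
  have w: "chain K r w"
    unfolding chain_def
  proof (intro allI impI)
    fix \<tau> assume "w \<tau> \<noteq> 0"
    then obtain S where "S \<in> Q" "\<alpha> S * c S \<tau> \<noteq> 0"
      unfolding w_def by (rule sum.not_neutral_contains_not_neutral)
    then show "\<tau> \<in> K \<and> card \<tau> = r" using chainD[OF c(1)] by auto
  qed
  define z where "z = bd (X 0) w"
  have z: "chain K (r - 1) z" unfolding z_def by (rule bd_chain(1)[OF K_closed w])
  have zL: "z \<tau> = 0" if "\<tau> \<in> ?L" for \<tau>
    using \<alpha>(2) that unfolding z_def w_def bd_sum by blast
  \<comment> \<open>If \<open>insert v \<tau>\<close> is not a face, then no
    \<open>insert u \<tau>\<close> is one, as the near-cone property would exchange \<open>u\<close>
    for \<open>v\<close>.\<close>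
  have z1: "z \<tau> = 0" if v: "v \<notin> \<tau>" for \<tau>
  proof (rule ccontr)
    assume nz: "z \<tau> \<noteq> 0"
    then have \<tau>: "\<tau> \<in> K" "card \<tau> = r - 1" using chainD[OF z] by auto
    then have no: "insert v \<tau> \<notin> K" using zL[of \<tau>] nz v by auto
    have "w (insert u \<tau>) = 0" if u: "u \<in> V - \<tau>" for u
    proof (rule ccontr)
      assume "w (insert u \<tau>) \<noteq> 0"
      then have "insert u \<tau> \<in> K" using chainD[OF w] by auto
      from apex(2)[OF this, of u] show False using no u by simp
    qed
    then have "z \<tau> = 0" by (simp add: z_def bd_def)
    with nz show False by contradiction
  qed
  \<comment> \<open>As \<open>z\<close> vanishes on sets without \<open>v\<close>, the equation
    \<open>bd (X 0) z = 0\<close> at \<open>\<tau> - {v}\<close> has a single term left.\<close>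
  have z2: "z \<tau> = 0" for \<tau>
  proof (rule ccontr)
    assume nz: "z \<tau> \<noteq> 0"
    then have v: "v \<in> \<tau>" using z1 by blast
    have sub: "\<tau> \<subseteq> V" using chainD[OF z nz] face_subset by auto
    let ?\<rho> = "\<tau> - {v}"
    have "0 = bd (X 0) z ?\<rho>" by (simp add: z_def bd_bd)
    also have "\<dots> = (\<Sum>u\<in>V - ?\<rho>. sg u ?\<rho> * (X 0 u * z (insert u ?\<rho>)))"
      using sub by (auto simp: bd_def)
    also have "\<dots> = (\<Sum>u\<in>{v}. sg u ?\<rho> * (X 0 u * z (insert u ?\<rho>)))"
      by (rule sum.mono_neutral_right) (use apex(1) z1 in auto)
    also have "\<dots> = sg v ?\<rho> * (X 0 v * z \<tau>)" using v by (simp add: insert_absorb)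
    finally have "sg v ?\<rho> * (X 0 v * z \<tau>) = 0" by (rule sym)
    then have "X 0 v * z \<tau> = 0"
      using sg_sq_left[of v ?\<rho> "X 0 v * z \<tau>"] by (simp only: mult_zero_right)
    moreover have "X 0 v \<noteq> (0 :: 'f mpoly)" by (rule X_nonzero)
    ultimately show False using nz by simp
  qed
  \<comment> \<open>At the lexicographically first set with nonzero weight, the chains of all other
    weighted sets have coordinate zero, so \<open>w\<close> has a nonzero coordinate there; as the
    set contains 0, it is also a coordinate of \<open>z\<close>.\<close>
  let ?F = "{S\<in>Q. \<alpha> S \<noteq> 0}"
  have "\<exists>S\<in>?F. \<forall>R\<in>?F. \<not> lexless R S"
    by (rule lexless_minimal[of _ r]) (use Q(2) \<alpha>(1) in \<open>auto simp: ext_shift_def\<close>)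
  then obtain S where S: "S \<in> Q" "\<alpha> S \<noteq> 0" "\<forall>R\<in>?F. \<not> lexless R S" by blast
  have finS: "finite S" using S Q(2) ext_shift_finite by blast
  have "coord X S w = (\<Sum>R\<in>Q. \<alpha> R * coord X S (c R))" unfolding w_def coord_sum ..
  also have "\<dots> = (\<Sum>R\<in>{S}. \<alpha> R * coord X S (c R))"
  proof (rule sum.mono_neutral_right)
    show "\<forall>R\<in>Q - {S}. \<alpha> R * coord X S (c R) = 0"
    proof
      fix R assume R: "R \<in> Q - {S}"
      show "\<alpha> R * coord X S (c R) = 0"
      proof (cases "\<alpha> R = 0")
        case False
        then have "lexless S R" using lexless_linear[of R S] R S(3) by auto
        moreover have "card S = card R" using R S(1) Q(2) ext_shift_card by blast
        ultimately show ?thesis using c(2)[of R] R finS by (auto simp: leading_def)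
      qed simp
    qed
  qed (use Q S in auto)
  finally have "coord X S w = \<alpha> S * coord X S (c S)" by simp
  then have "coord X S w \<noteq> 0" using S c(2)[OF S(1)] by (simp add: leading_def)
  moreover have "coord X S w = coord X (S - {0}) z"
    using coord_insert_min[of "S - {0}" 0 X w] Q(3)[OF S(1)] finS by (simp add: insert_absorb z_def)
  moreover have "z = (\<lambda>_. 0)" using z2 by auto
  ultimately show False by simp
qed

lemma near_cone_EKR_bound:
  assumes apex: "v \<in> V" "\<And>\<sigma> u. \<sigma> \<in> K \<Longrightarrow> u \<in> \<sigma> \<Longrightarrow> insert v (\<sigma> - {u}) \<in> K"
    and A: "A \<subseteq> K" "\<And>\<sigma>. \<sigma> \<in> A \<Longrightarrow> card \<sigma> = r" "\<And>\<sigma> \<tau>. \<sigma> \<in> A \<Longrightarrow> \<tau> \<in> A \<Longrightarrow> \<sigma> \<inter> \<tau> \<noteq> {}"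
    and r: "2 * r \<le> D"
  shows "card A \<le> card {\<tau>\<in>K. card \<tau> = r - 1 \<and> v \<notin> \<tau> \<and> insert v \<tau> \<in> K}"
proof -
  have AV: "A \<subseteq> Pow V" using A(1) K_subset by auto
  obtain P where P: "P \<subseteq> ext_shift A r" "finite P" "card P = card A"
    using ext_shift_large[OF AV A(2)] by blast
  define P1 where "P1 = {S\<in>P. 0 \<in> S}"
  define P0 where "P0 = {S\<in>P. 0 \<notin> S}"
  have fin: "finite S" and card: "card S = r" if "S \<in> P0" for S
    using that P(1) by (auto simp: P0_def ext_shift_def)
  have notin: "reflect S \<notin> ext_shift A r" if "S \<in> P0" for S
  proof (rule reflect_notin_shifted_intersecting)
    show "insert i (T - {j}) \<in> ext_shift A r" if "T \<in> ext_shift A r" "j \<in> T" "i \<notin> T" "i < j" for T i j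
      by (rule ext_shift_shifted) fact+
    show "S \<inter> T \<noteq> {}" if "S \<in> ext_shift A r" "T \<in> ext_shift A r" for S T
      by (rule ext_shift_intersecting[OF AV A(3)]) (use that in auto)
  qed (use that P(1) fin in \<open>auto simp: P0_def\<close>)
  have zero: "0 \<in> reflect S" if S: "S \<in> P0" for S
  proof -
    \<comment> \<open>Otherwise nothing would be flipped, and \<open>S\<close> itself would be a
      reflected set.\<close>
    have "last_balance S \<noteq> 0"
    proof
      assume "last_balance S = 0"
      then have "reflect S = S" by (simp add: reflect_def)
      then show False using notin[OF S] S P(1) by (auto simp: P0_def)
    qed
    then show ?thesis using S by (auto simp: reflect_def P0_def)
  qed
  have mem: "reflect S \<in> ext_shift K r" if S: "S \<in> P0" for S
  proof -
    let ?G = "S \<union> {..<2 * last_balance S}"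
    have "S \<in> ext_shift K (card S)"
      using S P(1) ext_shift_mono[OF A(1), of r] card[OF S] by (auto simp: P0_def)
    moreover have "card ?G \<le> D"
      using card_Un_prefix[OF fin[OF S]] last_balance(3)[OF fin[OF S]] card[OF S] r by simp
    ultimately have "?G \<in> ext_shift K (card ?G)" by (rule ext_shift_Un_prefix)
    from ext_shift_subset[OF this reflect_subset[OF fin[OF S]]] show ?thesis
      using card_reflect[OF fin[OF S]] card[OF S] by simp
  qed
  let ?Q = "P1 \<union> reflect ` P0"
  have "inj_on reflect P0" by (rule inj_on_inverseI[of _ reflect]) (use reflect_reflect fin in auto)
  then have "card (reflect ` P0) = card P0" by (rule card_image)
  moreover have "P1 \<inter> reflect ` P0 = {}" using notin P(1) by (auto simp: P1_def)
  moreover have "finite P0" "finite P1" using P(2) by (auto simp: P0_def P1_def)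
  ultimately have "card ?Q = card P1 + card P0" by (simp add: card_Un_disjoint)
  also have "\<dots> = card (P1 \<union> P0)"
    by (rule card_Un_disjoint[symmetric]) (use P(2) in \<open>auto simp: P0_def P1_def\<close>)
  also have "P1 \<union> P0 = P" by (auto simp: P0_def P1_def)
  finally have "card A = card ?Q" using P(3) by simp
  also have "\<dots> \<le> card {\<tau>\<in>K. card \<tau> = r - 1 \<and> v \<notin> \<tau> \<and> insert v \<tau> \<in> K}"
  proof (rule card_ext_shift_with_0[OF apex])
    show "?Q \<subseteq> ext_shift K r"
      using P(1) ext_shift_mono[OF A(1), of r] mem by (auto simp: P1_def)
  qed (use P(2) zero in \<open>auto simp: P0_def P1_def\<close>)
  finally show ?thesis .
qed

end

section \<open>Homology and purity of Cohen-Macaulay complexes\<close>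

lemma boundary_of_cycle:
  assumes "reduced_homology_zero (F :: 'f::field itself) K i" "z \<in> (cycles K i :: ('a list \<Rightarrow> 'f) set)"
  shows "\<exists>b\<in>chains K (i + 1). z = boundary K b"
proof -
  have "(\<lambda>_. 0 :: 'f) \<in> boundaries K i"
    unfolding boundaries_def by (rule image_eqI[of _ _ "\<lambda>_. 0"]) (auto simp: boundary_def chains_def)
  then have "(z, z) \<in> homologous K i" using assms(2) by (simp add: homologous_def)
  then have "z \<in> homologous K i `` {z}" by blast
  moreover have "homologous K i `` {z} \<in> reduced_homology K i"
    unfolding reduced_homology_def by (rule quotientI) fact
  ultimately have "z \<in> boundaries K i" using assms(1) by (auto simp: reduced_homology_zero_def)
  then show ?thesis by (auto simp: boundaries_def)
qed

section \<open>From ordered chains to chains on sets\<close>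

context vertex_set begin

text \<open>The sign of the permutation sorting a list of distinct vertices: every entry counts the
  later entries that are smaller.\<close>

primrec lsg :: "'a list \<Rightarrow> 'f::comm_ring_1" where
  "lsg [] = 1"
| "lsg (x # xs) = sg x (set xs) * lsg xs"

definition list_chain :: "('a set \<Rightarrow> 'f::comm_ring_1) \<Rightarrow> 'a list \<Rightarrow> 'f" where
  "list_chain z xs = (if distinct xs \<and> set xs \<subseteq> V then lsg xs * z (set xs) else 0)"

lemma lsg_swap:
  assumes "distinct (xs @ a # b # ys)" "set (xs @ a # b # ys) \<subseteq> V"
  shows "lsg (xs @ a # b # ys) = - (lsg (xs @ b # a # ys) :: 'f::comm_ring_1)"
  using assms
proof (induction xs)
  case Nil
  have "sg b (set ys) * sg a (insert b (set ys)) = - (sg a (set ys) * sg b (insert a (set ys)) :: 'f)"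
    by (rule sg_swap) (use Nil in auto)
  then show ?case
    by simp (metis (no_types, lifting) mult.assoc mult.commute mult_minus_left)
next
  case (Cons x xs)
  have "set (xs @ a # b # ys) = set (xs @ b # a # ys)" by auto
  then show ?case using Cons by simp
qed

lemma list_chain_swap:
  fixes z :: "'a set \<Rightarrow> 'f::comm_ring_1"
  shows "list_chain z (xs @ a # b # ys) = - list_chain z (xs @ b # a # ys)"
proof (cases "distinct (xs @ a # b # ys) \<and> set (xs @ a # b # ys) \<subseteq> V")
  case True
  then have "distinct (xs @ b # a # ys) \<and> set (xs @ b # a # ys) \<subseteq> V" by auto
  moreover have "set (xs @ a # b # ys) = set (xs @ b # a # ys)" by auto
  moreover have "lsg (xs @ a # b # ys) = - (lsg (xs @ b # a # ys) :: 'f)"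
    by (rule lsg_swap) (use True in auto)
  ultimately show ?thesis
    using True by (simp add: list_chain_def del: set_append distinct_append)
next
  case False
  then have "\<not> (distinct (xs @ b # a # ys) \<and> set (xs @ b # a # ys) \<subseteq> V)" by auto
  with False show ?thesis by (simp only: list_chain_def if_False minus_zero)
qed

lemma list_chain_in_chains:
  assumes "chain L p z"
  shows "list_chain z \<in> chains L (int p - 1)"
  unfolding chains_def
proof (intro CollectI conjI allI impI)
  fix xs assume nz: "list_chain z xs \<noteq> 0"
  then have xs: "distinct xs" "z (set xs) \<noteq> 0" by (auto simp: list_chain_def split: if_splits)
  then show "distinct xs" "set xs \<in> L" "int (length xs) = int p - 1 + 1"
    using chainD[OF assms xs(2)] by (auto simp: distinct_card)
qed (rule list_chain_swap)

lemma boundary_list_chain: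
  assumes L: "L \<subseteq> Pow V" "chain L p z"
  shows "boundary L (list_chain z) = list_chain (bd (\<lambda>_. 1) z)"
proof
  fix ys
  have sub: "vertices L \<subseteq> V" using L by (auto simp: vertices_def)
  show "boundary L (list_chain z) ys = list_chain (bd (\<lambda>_. 1) z) ys"
  proof (cases "distinct ys \<and> set ys \<subseteq> V")
    case False
    then have "list_chain w (v # ys) = 0" "list_chain w ys = 0" for v and w :: "'a set \<Rightarrow> 'b"
      by (auto simp: list_chain_def)
    then show ?thesis by (simp add: boundary_def)
  next
    case True
    have "boundary L (list_chain z) ys = (\<Sum>v\<in>V - set ys. list_chain z (v # ys))"
      unfolding boundary_def
    proof (rule sum.mono_neutral_cong)
      show "list_chain z (v # ys) = 0" if v: "v \<in> V - set ys - vertices L" for v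
      proof -
        have "insert v (set ys) \<notin> L" using v by (auto simp: vertices_def)
        then have "z (insert v (set ys)) = 0" using chainD[OF L(2)] by auto
        then show ?thesis by (simp add: list_chain_def)
      qed
      show "list_chain z (v # ys) = 0" if "v \<in> vertices L - (V - set ys)" for v
        using that sub by (auto simp: list_chain_def)
    qed (use sub finite_subset[OF _ finite_V] in auto)
    also have "\<dots> = lsg ys * (\<Sum>v\<in>V - set ys. sg v (set ys) * z (insert v (set ys)))"
      unfolding sum_distrib_left
      by (intro sum.cong) (use True in \<open>auto simp: list_chain_def mult_ac\<close>)
    also have "\<dots> = list_chain (bd (\<lambda>_. 1) z) ys"
      using True by (simp add: list_chain_def bd_def)
    finally show ?thesis .
  qed
qed

lemma alternating_move:
  fixes c :: "'a list \<Rightarrow> 'f::comm_ring_1"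
  assumes alt: "\<And>xs a b ys. c (xs @ a # b # ys) = - c (xs @ b # a # ys)"
    and d: "distinct (xs @ v # ys)" "set (xs @ v # ys) \<subseteq> V"
  shows "lsg (xs @ v # ys) * c (xs @ v # ys) = lsg (v # xs @ ys) * c (v # xs @ ys)"
  using d
proof (induction xs arbitrary: ys rule: rev_induct)
  case (snoc x xs)
  have "lsg ((xs @ [x]) @ v # ys) = - (lsg (xs @ v # x # ys) :: 'f)"
    using lsg_swap[of xs x v ys] snoc.prems by simp
  moreover have "c ((xs @ [x]) @ v # ys) = - c (xs @ v # x # ys)"
    using alt[of xs x v ys] by simp
  moreover have "lsg (xs @ v # x # ys) * c (xs @ v # x # ys) = lsg (v # xs @ x # ys) * c (v # xs @ x # ys)"
    by (rule snoc.IH) (use snoc.prems in auto)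
  ultimately show ?case by simp
qed simp

text \<open>Multiplied by the sorting sign, an alternating function no longer depends on the order
  of its arguments and so descends to sets.\<close>

lemma alternating_reorder:
  fixes c :: "'a list \<Rightarrow> 'f::comm_ring_1"
  assumes "\<And>xs a b ys. c (xs @ a # b # ys) = - c (xs @ b # a # ys)"
    and "distinct xs" "distinct ys" "set xs = set ys" "set xs \<subseteq> V"
  shows "lsg xs * c xs = lsg ys * c ys"
  using assms
proof (induction xs arbitrary: ys c)
  case (Cons x xs)
  then have "x \<in> set ys" by auto
  then obtain ys1 ys2 where ys: "ys = ys1 @ x # ys2" by (meson split_list)
  let ?ys = "ys1 @ ys2"
  have sets: "set xs = set ?ys" using Cons.prems(2-4) unfolding ys by auto
  have "lsg ys * c ys = lsg (x # ?ys) * c (x # ?ys)"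
    unfolding ys by (rule alternating_move[of c, OF Cons.prems(1)]) (use Cons.prems(3-5) ys in auto)
  also have "\<dots> = sg x (set xs) * (lsg ?ys * c (x # ?ys))"
    using sets by (simp add: mult.assoc)
  also have "lsg ?ys * c (x # ?ys) = lsg xs * c (x # xs)"
  proof (rule Cons.IH[of "\<lambda>zs. c (x # zs)", symmetric])
    show "c (x # zs @ a # b # ws) = - c (x # zs @ b # a # ws)" for zs a b ws
      using Cons.prems(1)[of "x # zs" a b ws] by simp
  qed (use Cons.prems(2-5) sets ys in auto)
  finally show ?case by (simp add: mult.assoc)
qed simp

text \<open>The cycle is turned into an alternating one and filled there; the filling is read off at
  one chosen ordering of each face.\<close>

lemma chain_boundary_of_cycle:
  assumes L: "L \<subseteq> Pow V"
    and hom: "reduced_homology_zero (F :: 'f::field itself) L (int p - 1)"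
    and z: "chain L p z" "bd (\<lambda>_. 1) z = (\<lambda>_. 0 :: 'f)"
  shows "\<exists>b. chain L (Suc p) b \<and> bd (\<lambda>_. 1) b = z"
proof -
  have "list_chain z \<in> cycles L (int p - 1)"
    using list_chain_in_chains[OF z(1)] boundary_list_chain[OF L z(1)] z(2)
    by (simp add: cycles_def list_chain_def fun_eq_iff)
  then obtain c where c: "c \<in> chains L (int p - 1 + 1)" "list_chain z = boundary L c"
    using boundary_of_cycle[OF hom] by blast
  define ord where "ord \<tau> = (SOME xs. distinct xs \<and> set xs = \<tau>)" for \<tau> :: "'a set"
  have ord: "distinct (ord \<tau>)" "set (ord \<tau>) = \<tau>" if "\<tau> \<subseteq> V" for \<tau>
  proof -
    have "\<exists>xs. distinct xs \<and> set xs = \<tau>"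
      using finite_distinct_list[OF finite_subset[OF that finite_V]] by blast
    from someI_ex[OF this] show "distinct (ord \<tau>)" "set (ord \<tau>) = \<tau>" by (auto simp: ord_def)
  qed
  define b where "b \<tau> = (if \<tau> \<subseteq> V then lsg (ord \<tau>) * c (ord \<tau>) else 0)" for \<tau>
  have "chain L (Suc p) b"
    unfolding chain_def
  proof (intro allI impI)
    fix \<tau> assume "b \<tau> \<noteq> 0"
    then have \<tau>: "\<tau> \<subseteq> V" "c (ord \<tau>) \<noteq> 0" by (auto simp: b_def split: if_splits)
    from chains_nonzero[OF c(1) \<tau>(2)] show "\<tau> \<in> L \<and> card \<tau> = Suc p"
      using ord[OF \<tau>(1)] distinct_card[of "ord \<tau>"] by auto
  qed
  moreover have "bd (\<lambda>_. 1) b = z"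
  proof
    fix \<tau>
    show "bd (\<lambda>_. 1) b \<tau> = z \<tau>"
    proof (cases "\<tau> \<subseteq> V")
      case False
      then have "z \<tau> = 0" using chainD[OF z(1), of \<tau>] L by auto
      then show ?thesis using False by (simp add: bd_def)
    next
      case True
      let ?ys = "ord \<tau>"
      have lsg_sq: "lsg ys * (lsg ys * x) = (x :: 'f)" for ys x
      proof -
        have "lsg ys * lsg ys = (1 :: 'f)"
        proof (induction ys)
          case (Cons y ys)
          have "lsg (y # ys) * lsg (y # ys) = (sg y (set ys) * sg y (set ys)) * (lsg ys * lsg ys :: 'f)"
            by (simp only: lsg.simps mult_ac)
          then show ?case unfolding Cons by simp
        qed simp
        then show ?thesis by (simp flip: mult.assoc)
      qed
      have "lsg ?ys * z \<tau> = boundary L c ?ys"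
        using fun_cong[OF c(2), of ?ys] True ord[OF True] by (simp add: list_chain_def)
      also have "\<dots> = (\<Sum>v\<in>V - \<tau>. c (v # ?ys))"
        unfolding boundary_def
      proof (rule sum.mono_neutral_cong)
        have "c (v # ?ys) = 0" if v: "v \<notin> vertices L \<or> v \<in> \<tau>" for v
        proof (rule ccontr)
          assume "c (v # ?ys) \<noteq> 0"
          from chains_nonzero[OF c(1) this] show False
            using v ord[OF True] by (auto simp: vertices_def)
        qed
        then show "\<And>v. v \<in> V - \<tau> - vertices L \<Longrightarrow> c (v # ?ys) = 0"
          "\<And>v. v \<in> vertices L - (V - \<tau>) \<Longrightarrow> c (v # ?ys) = 0"
          using L by (auto simp: vertices_def)
        have "vertices L \<subseteq> V" using L by (auto simp: vertices_def)
        then show "finite (vertices L)" using finite_V by (rule finite_subset)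
      qed auto
      also have "\<dots> = (\<Sum>v\<in>V - \<tau>. lsg ?ys * (sg v \<tau> * b (insert v \<tau>)))"
      proof (intro sum.cong refl)
        fix v assume v: "v \<in> V - \<tau>"
        have ins: "insert v \<tau> \<subseteq> V" using v True by auto
        have "b (insert v \<tau>) = lsg (ord (insert v \<tau>)) * c (ord (insert v \<tau>))" using ins by (simp add: b_def)
        also have "\<dots> = lsg (v # ?ys) * c (v # ?ys)"
          by (rule alternating_reorder[of c, OF chains_swap[OF c(1)]]) (use ord[OF ins] ord[OF True] v ins in auto)
        finally have "b (insert v \<tau>) = sg v \<tau> * (lsg ?ys * c (v # ?ys))"
          using ord[OF True] by (simp add: mult.assoc)
        then show "c (v # ?ys) = lsg ?ys * (sg v \<tau> * b (insert v \<tau>))"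
          by (simp only: sg_sq_left lsg_sq)
      qed
      also have "\<dots> = lsg ?ys * bd (\<lambda>_. 1) b \<tau>" using True by (simp add: bd_def sum_distrib_left)
      finally have "lsg ?ys * z \<tau> = lsg ?ys * bd (\<lambda>_. 1) b \<tau>" .
      from arg_cong[OF this, of "\<lambda>x. lsg ?ys * x"] show ?thesis by (simp only: lsg_sq)
    qed
  qed
  ultimately show ?thesis by blast
qed

text \<open>Duality over a field: if \<open>g\<close> were not a coboundary, a functional killing
  all coboundaries would separate it. Such a functional is a cycle, hence a boundary, and its
  pairing with \<open>g\<close> equals that of the coboundary of \<open>g\<close> with a filling,
  which is zero.\<close>

lemma cohomology_exact:
  fixes g :: "'a set \<Rightarrow> 'f::field"
  assumes L: "L \<subseteq> Pow V" and closed: "\<And>\<sigma> \<tau>. \<sigma> \<in> L \<Longrightarrow> \<tau> \<subseteq> \<sigma> \<Longrightarrow> \<tau> \<in> L"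
    and hom: "reduced_homology_zero (F :: 'f itself) L (int p - 1)"
    and cocycle: "\<And>\<rho>. \<rho> \<in> L \<Longrightarrow> card \<rho> = Suc p \<Longrightarrow> (\<Sum>v\<in>\<rho>. sg v (\<rho> - {v}) * g (\<rho> - {v})) = 0"
  shows "\<exists>h. \<forall>\<rho>\<in>L. card \<rho> = p \<longrightarrow> g \<rho> = (\<Sum>v\<in>\<rho>. sg v (\<rho> - {v}) * h (\<rho> - {v}))"
proof -
  define N where "N = {\<rho>\<in>L. card \<rho> = p}"
  define P where "P = {\<theta>\<in>L. Suc (card \<theta>) = p}"
  have finL: "finite L" using finite_subset[OF L] by simp
  then have fin: "finite N" "finite P" by (auto simp: N_def P_def)
  define ind :: "'a set \<Rightarrow> 'a set \<Rightarrow> 'f" where "ind \<sigma> \<tau> = (if \<tau> = \<sigma> then 1 else 0)" for \<sigma> \<tau>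
  let ?one = "\<lambda>_::'a. 1 :: 'f"
  consider (span) d \<beta> where "d \<noteq> 0" "\<forall>\<rho>\<in>N. d * g \<rho> = (\<Sum>\<theta>\<in>P. \<beta> \<theta> * om L ?one (ind \<theta>) \<rho>)"
    | (sep) \<phi> where "\<forall>\<theta>\<in>P. (\<Sum>\<rho>\<in>N. \<phi> \<rho> * om L ?one (ind \<theta>) \<rho>) = 0" "(\<Sum>\<rho>\<in>N. \<phi> \<rho> * g \<rho>) \<noteq> 0"
    using span_or_separating_functional[OF fin(2,1), of g "\<lambda>\<theta>. om L ?one (ind \<theta>)"] by auto
  then show ?thesis
  proof cases
    case span
    define h where "h \<theta> = \<beta> \<theta> / d" for \<theta>
    have "g \<rho> = (\<Sum>v\<in>\<rho>. sg v (\<rho> - {v}) * h (\<rho> - {v}))" if \<rho>: "\<rho> \<in> L" "card \<rho> = p" for \<rho>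
    proof -
      have finr: "finite \<rho>" using \<rho>(1) L finite_subset[OF _ finite_V] by blast
      have inP: "\<rho> - {v} \<in> P" if "v \<in> \<rho>" for v
        using \<rho> closed[of \<rho> "\<rho> - {v}"] card_Suc_Diff1[OF finr that] by (auto simp: P_def)
      have "d * g \<rho> = (\<Sum>\<theta>\<in>P. \<Sum>v\<in>\<rho>. \<beta> \<theta> * (sg v (\<rho> - {v}) * ind \<theta> (\<rho> - {v})))"
        using span(2) \<rho> by (simp add: N_def om_def sum_distrib_left)
      also have "\<dots> = (\<Sum>v\<in>\<rho>. \<Sum>\<theta>\<in>P. \<beta> \<theta> * (sg v (\<rho> - {v}) * ind \<theta> (\<rho> - {v})))"
        by (rule sum.swap)
      also have "\<dots> = (\<Sum>v\<in>\<rho>. d * (sg v (\<rho> - {v}) * h (\<rho> - {v})))"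
      proof (intro sum.cong refl)
        fix v assume v: "v \<in> \<rho>"
        have "(\<Sum>\<theta>\<in>P. \<beta> \<theta> * (sg v (\<rho> - {v}) * ind \<theta> (\<rho> - {v}))) =
            (\<Sum>\<theta>\<in>P. if \<theta> = \<rho> - {v} then \<beta> \<theta> * sg v (\<rho> - {v}) else 0)"
          by (intro sum.cong) (auto simp: ind_def)
        also have "\<dots> = \<beta> (\<rho> - {v}) * sg v (\<rho> - {v})" using inP[OF v] fin(2) by simp
        finally show "(\<Sum>\<theta>\<in>P. \<beta> \<theta> * (sg v (\<rho> - {v}) * ind \<theta> (\<rho> - {v}))) = d * (sg v (\<rho> - {v}) * h (\<rho> - {v}))"
          using span(1) by (simp add: h_def mult_ac)
      qed
      also have "\<dots> = d * (\<Sum>v\<in>\<rho>. sg v (\<rho> - {v}) * h (\<rho> - {v}))" by (simp add: sum_distrib_left)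
      finally show ?thesis using span(1) by simp
    qed
    then show ?thesis by blast
  next
    case sep
    define z where "z \<rho> = (if \<rho> \<in> N then \<phi> \<rho> else 0)" for \<rho>
    have z: "chain L p z" by (auto simp: chain_def z_def N_def)
    have zL: "\<sigma> \<in> L" if "z \<sigma> \<noteq> 0" for \<sigma> using chainD[OF z that] by simp
    have sums: "(\<Sum>\<rho>\<in>N. \<phi> \<rho> * w \<rho>) = (\<Sum>\<rho>\<in>Pow V. w \<rho> * z \<rho>)" for w
      by (rule sum.mono_neutral_cong_left) (use L in \<open>auto simp: z_def N_def mult.commute\<close>)
    have "bd ?one z = (\<lambda>_. 0)"
    proof
      fix \<theta>
      show "bd ?one z \<theta> = 0"
      proof (cases "\<theta> \<in> P")
        case True
        then have "\<theta> \<in> Pow V" using L by (auto simp: P_def)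
        then have "bd ?one z \<theta> = (\<Sum>\<tau>\<in>Pow V. ind \<theta> \<tau> * bd ?one z \<tau>)"
          by (simp add: ind_def if_distrib[of "\<lambda>x. x * _"] cong: if_cong)
        also have "\<dots> = (\<Sum>\<rho>\<in>N. \<phi> \<rho> * om L ?one (ind \<theta>) \<rho>)"
          unfolding sums by (rule pairing_bd[symmetric]) (rule zL)
        finally show ?thesis using sep(1) True by simp
      next
        case False
        show ?thesis
        proof (rule ccontr)
          assume nz: "bd ?one z \<theta> \<noteq> 0"
          then have "p \<noteq> 0" using bd_chain(2)[OF closed z] by fastforce
          moreover have "\<theta> \<in> L" "card \<theta> = p - 1" using chainD[OF bd_chain(1)[OF closed z] nz] by auto
          ultimately show False using False by (simp add: P_def)
        qed
      qed
    qed
    then obtain b where b: "chain L (Suc p) b" "bd ?one b = z"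
      using chain_boundary_of_cycle[OF L hom z] by blast
    have bL: "\<sigma> \<in> L" if "b \<sigma> \<noteq> 0" for \<sigma> using chainD[OF b(1) that] by simp
    have "(\<Sum>\<rho>\<in>N. \<phi> \<rho> * g \<rho>) = (\<Sum>\<rho>\<in>Pow V. om L ?one g \<rho> * b \<rho>)"
      unfolding sums b(2)[symmetric] by (rule pairing_bd[symmetric]) (rule bL)
    also have "\<dots> = 0"
    proof (rule sum.neutral, rule ballI)
      fix \<rho>
      show "om L ?one g \<rho> * b \<rho> = 0"
        using chainD[OF b(1), of \<rho>] cocycle[of \<rho>] by (cases "b \<rho> = 0") (auto simp: om_def)
    qed
    finally show ?thesis using sep(2) by contradiction
  qed
qed

end

section \<open>Facets, links and purity\<close>

definition facet :: "'a set set \<Rightarrow> 'a set \<Rightarrow> bool" where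
  "facet K G \<longleftrightarrow> G \<in> K \<and> (\<forall>H\<in>K. G \<subseteq> H \<longrightarrow> H = G)"

lemma finite_complex: "simplicial_complex K \<Longrightarrow> finite K"
  by (rule finite_subset[of _ "Pow (vertices K)"]) (auto simp: simplicial_complex_def vertices_def)

lemma face_finite_card: "simplicial_complex K \<Longrightarrow> \<sigma> \<in> K \<Longrightarrow> finite \<sigma>"
  by (rule finite_subset[of _ "vertices K"]) (auto simp: simplicial_complex_def vertices_def)

lemma exists_facet:
  assumes "simplicial_complex K" "\<sigma> \<in> K"
  shows "\<exists>G. facet K G \<and> \<sigma> \<subseteq> G"
  using finite_has_maximal2[OF finite_complex[OF assms(1)] assms(2)] by (auto simp: facet_def)

lemma link_closed:
  assumes "simplicial_complex K" "\<rho> \<in> link K \<sigma>" "\<rho>' \<subseteq> \<rho>"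
  shows "\<rho>' \<in> link K \<sigma>"
proof -
  have "\<rho>' \<union> \<sigma> \<subseteq> \<rho> \<union> \<sigma>" "\<rho> \<union> \<sigma> \<in> K" using assms by (auto simp: link_def)
  then have "\<rho>' \<union> \<sigma> \<in> K" using assms(1) unfolding simplicial_complex_def by blast
  then show ?thesis using assms by (auto simp: link_def)
qed

lemma complex_dim_ge: "finite K \<Longrightarrow> \<sigma> \<in> K \<Longrightarrow> int (card \<sigma>) - 1 \<le> complex_dim K"
  unfolding complex_dim_def by (rule Max_ge) (auto simp: face_dim_def)

lemma finite_link: "simplicial_complex K \<Longrightarrow> finite (link K \<sigma>)"
  by (rule finite_subset[of _ "Pow (vertices K)"]) (auto simp: simplicial_complex_def vertices_def link_def)

lemma link_subset_vertices: "link K \<sigma> \<subseteq> Pow (vertices K)"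
  by (auto simp: vertices_def link_def)

text \<open>Cohen-Macaulay complexes are pure. Downward induction on \<open>\<tau>\<close>: the facets through \<open>\<tau> \<union> {v}\<close> have
  the same size for each vertex \<open>v\<close> of the link of \<open>\<tau>\<close>, and this size is constant along the edges of
  the link, which is connected.\<close>

lemma cohen_macaulay_pure:
  assumes K: "simplicial_complex K" and CM: "cohen_macaulay (F :: 'f::field itself) K"
    and "\<tau> \<in> K" "facet K G1" "facet K G2" "\<tau> \<subseteq> G1" "\<tau> \<subseteq> G2"
  shows "card G1 = card G2"
  using assms(3-)
proof (induction "card (vertices K) - card \<tau>" arbitrary: \<tau> G1 G2 rule: less_induct)
  case less
  have finV: "finite (vertices K)" using K by (simp add: simplicial_complex_def)
  obtain e :: "'a \<Rightarrow> nat" where "inj_on e (vertices K)"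
    using finite_imp_inj_to_nat_seg[OF finV] by blast
  then interpret vertex_set "vertices K" e using finV by unfold_locales
  have IH: "card H1 = card H2" if "v \<notin> \<tau>" "insert v \<tau> \<in> K" "facet K H1" "facet K H2"
    "insert v \<tau> \<subseteq> H1" "insert v \<tau> \<subseteq> H2" for v H1 H2
  proof (rule less.hyps[OF _ that(2-6)])
    have "insert v \<tau> \<subseteq> vertices K" using that(2) by (auto simp: vertices_def)
    then have "card (insert v \<tau>) \<le> card (vertices K)" by (rule card_mono[OF finV])
    moreover have "card (insert v \<tau>) = Suc (card \<tau>)"
      using that(1) face_finite_card[OF K less.prems(1)] by simp
    ultimately show "card (vertices K) - card (insert v \<tau>) < card (vertices K) - card \<tau>" by simp
  qed
  have sub: "\<sigma> \<in> K" if "\<sigma> \<subseteq> G" "G \<in> K" for \<sigma> G using K that unfolding simplicial_complex_def by blast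
  have G: "G1 \<in> K" "G2 \<in> K" using less.prems by (auto simp: facet_def)
  let ?L = "link K \<tau>"
  show ?case
  proof (cases "G1 = \<tau> \<or> G2 = \<tau>")
    case True
    then have "G1 = G2" using less.prems by (auto simp: facet_def)
    then show ?thesis by simp
  next
    case False
    then obtain v1 v2 where v1: "v1 \<in> G1" "v1 \<notin> \<tau>" and v2: "v2 \<in> G2" "v2 \<notin> \<tau>"
      using less.prems by blast
    have v12: "insert v1 \<tau> \<in> K" "insert v2 \<tau> \<in> K"
      using sub[of "insert v1 \<tau>" G1] sub[of "insert v2 \<tau>" G2] v1 v2 less.prems G by auto
    show ?thesis
    \<comment> \<open>Connectedness of the link is available in positive dimension only; otherwise
      each facet here is \<tau> with one further vertex.\<close>
    proof (cases "0 < complex_dim ?L")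
      case False
      have "card G = Suc (card \<tau>)" if "G \<in> K" "\<tau> \<subseteq> G" "v \<in> G" "v \<notin> \<tau>" for G v
      proof -
        have "G - \<tau> \<in> ?L" using that by (auto simp: link_def Un_absorb2)
        from complex_dim_ge[OF finite_link[OF K] this] have "card (G - \<tau>) \<le> 1" using False by simp
        moreover have "finite G" using face_finite_card[OF K that(1)] .
        moreover have "card (G - \<tau>) \<noteq> 0" using that \<open>finite G\<close> by auto
        moreover have "card G = card \<tau> + card (G - \<tau>)"
          using that(2) \<open>finite G\<close> by (metis card_Diff_subset card_mono finite_subset le_add_diff_inverse)
        ultimately show ?thesis by linarith
      qed
      then show ?thesis using G less.prems v1 v2 by metis
    next
      case True
      then have hom: "reduced_homology_zero F ?L (int 1 - 1)"
        using CM less.prems(1) by (simp add: cohen_macaulay_def)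
      define U where "U = {v. \<exists>G. facet K G \<and> insert v \<tau> \<subseteq> G \<and> card G = card G1}"
      \<comment> \<open>The indicator of \<open>U\<close>: it is a cocycle since membership in
        \<open>U\<close> is constant along edges, and as the coboundary of a scalar on the empty
        face it is constant.\<close>
      define g :: "'a set \<Rightarrow> 'f" where "g \<rho> = (if \<exists>v\<in>U. \<rho> = {v} then 1 else 0)" for \<rho>
      have "\<exists>h. \<forall>\<rho>\<in>?L. card \<rho> = 1 \<longrightarrow> g \<rho> = (\<Sum>v\<in>\<rho>. sg v (\<rho> - {v}) * h (\<rho> - {v}))"
      proof (rule cohomology_exact[OF link_subset_vertices _ hom])
        show "\<rho>' \<in> ?L" if "\<rho> \<in> ?L" "\<rho>' \<subseteq> \<rho>" for \<rho> \<rho>' using link_closed[OF K that] .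
        fix \<rho> assume \<rho>: "\<rho> \<in> ?L" "card \<rho> = Suc 1"
        then obtain u w where uw: "\<rho> = {u, w}" "u \<noteq> w" by (auto simp: card_Suc_eq)
        have face: "insert u (insert w \<tau>) \<in> K" and out: "u \<notin> \<tau>" "w \<notin> \<tau>"
          using \<rho>(1) uw by (auto simp: link_def)
        obtain H where H: "facet K H" "insert u (insert w \<tau>) \<subseteq> H" using exists_facet[OF K face] by blast
        have faces: "insert u \<tau> \<in> K" "insert w \<tau> \<in> K" using sub[OF _ face] by auto
        have U_iff: "x \<in> U \<longleftrightarrow> card H = card G1"
          if x: "x \<notin> \<tau>" "insert x \<tau> \<in> K" "insert x \<tau> \<subseteq> H" for x
        proof
          assume "x \<in> U"
          then obtain G where "facet K G" "insert x \<tau> \<subseteq> G" "card G = card G1" by (auto simp: U_def)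
          then show "card H = card G1" using IH[OF x(1,2) H(1) _ x(3), of G] by simp
        next
          assume "card H = card G1"
          then show "x \<in> U" using H(1) x(3) unfolding U_def by blast
        qed
        have "u \<in> U \<longleftrightarrow> w \<in> U"
          using U_iff[OF out(1) faces(1)] U_iff[OF out(2) faces(2)] H(2) by simp
        then have "g {u} = g {w}" by (auto simp: g_def)
        moreover have "u \<in> vertices K" "w \<in> vertices K" using face unfolding vertices_def by blast+
        then have "sg u {} * sg w {u} = - (sg w {} * sg u {w} :: 'f)"
          by (intro sg_swap) (use uw in auto)
        moreover have "{u, w} - {u} = {w}" "{u, w} - {w} = {u}" using uw by auto
        ultimately show "(\<Sum>v\<in>\<rho>. sg v (\<rho> - {v}) * g (\<rho> - {v})) = 0"
          using uw by simp
      qed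
      then obtain h where h: "\<And>\<rho>. \<rho> \<in> ?L \<Longrightarrow> card \<rho> = 1 \<Longrightarrow>
          g \<rho> = (\<Sum>v\<in>\<rho>. sg v (\<rho> - {v}) * h (\<rho> - {v}))" by blast
      have const: "g {v} = h {}" if "insert v \<tau> \<in> K" "v \<notin> \<tau>" for v
        using h[of "{v}"] that by (simp add: link_def)
      have "v1 \<in> U" using v1 less.prems by (auto simp: U_def)
      then have "g {v1} = 1" by (simp add: g_def)
      then have "g {v2} = 1" using const v12 v1 v2 by simp
      then have "v2 \<in> U" by (auto simp: g_def split: if_splits)
      then obtain H where H: "facet K H" "insert v2 \<tau> \<subseteq> H" "card H = card G1" by (auto simp: U_def)
      have "card H = card G2" by (rule IH[OF v2(2) v12(2) H(1)]) (use less.prems v2 H in auto)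
      then show ?thesis using H(3) by simp
    qed
  qed
qed

text \<open>Only degrees below -1 have to be checked, where there are no nonzero chains. This
  ensures that the maximum in \<open>depth\<close> is over a nonempty set.\<close>

lemma cohen_macaulay_empty_face: "cohen_macaulay (F :: 'f::field itself) {{} :: 'a set}"
  unfolding cohen_macaulay_def
proof (intro ballI allI impI)
  fix \<sigma> :: "'a set" and i
  assume "\<sigma> \<in> {{}}" and i: "i < complex_dim (link {{}} \<sigma>)"
  then have link: "link {{}} \<sigma> = {{} :: 'a set}" by (auto simp: link_def)
  have "i < - 1" using i unfolding link by (simp add: complex_dim_def face_dim_def)
  have zero: "boundary {{}} c = (\<lambda>_. 0 :: 'f)" for c :: "'a list \<Rightarrow> 'f"
    by (simp add: boundary_def vertices_def)
  have "chains {{}} i = {\<lambda>_ :: 'a list. 0 :: 'f}"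
  proof (intro equalityI subsetI)
    fix c :: "'a list \<Rightarrow> 'f" assume c: "c \<in> chains {{}} i"
    have "c xs = 0" for xs using chains_nonzero(3)[OF c, of xs] \<open>i < - 1\<close> by fastforce
    then show "c \<in> {\<lambda>_. 0}" by auto
  qed (auto simp: chains_def)
  then have cyc: "cycles {{}} i = {\<lambda>_ :: 'a list. 0 :: 'f}" by (auto simp: cycles_def zero)
  have "(\<lambda>_ :: 'a list. 0 :: 'f) \<in> chains {{}} (i + 1)" by (auto simp: chains_def)
  then have bdr: "boundaries {{}} i = {\<lambda>_ :: 'a list. 0 :: 'f}" by (auto simp: boundaries_def zero)
  have "homologous {{}} i = {(\<lambda>_ :: 'a list. 0 :: 'f, \<lambda>_. 0)}"
    by (auto simp: homologous_def cyc bdr)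
  then show "reduced_homology_zero F (link {{}} \<sigma>) i"
    unfolding link reduced_homology_zero_def reduced_homology_def cyc bdr
    by (auto simp: quotient_def)
qed

lemma depth_attained:
  assumes K: "simplicial_complex K" "K \<noteq> {}"
  shows "depth (F :: 'f::field itself) K \<le> complex_dim K \<and> cohen_macaulay F (skeleton (depth F K) K)"
proof -
  let ?S = "{d. - 1 \<le> d \<and> d \<le> complex_dim K \<and> cohen_macaulay F (skeleton d K)}"
  have empty: "{} \<in> K" using K by (auto simp: simplicial_complex_def)
  have "finite ?S" by (rule finite_subset[of _ "{- 1..complex_dim K}"]) auto
  moreover have "skeleton (- 1) K = {{}}"
    using empty face_finite_card[OF K(1)] by (auto simp: skeleton_def face_dim_def)
  then have "- 1 \<in> ?S"
    using complex_dim_ge[OF finite_complex[OF K(1)] empty] cohen_macaulay_empty_face by simp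
  ultimately have "Max ?S \<in> ?S" by (intro Max_in) auto
  then show ?thesis by (simp add: depth_def)
qed

lemma skeleton_complex: "simplicial_complex K \<Longrightarrow> simplicial_complex (skeleton d K)"
  unfolding simplicial_complex_def
proof (elim conjE, intro conjI ballI allI impI)
  assume fin: "finite (vertices K)" and closed: "\<forall>\<sigma>\<in>K. \<forall>\<tau>\<subseteq>\<sigma>. \<tau> \<in> K"
  show "finite (vertices (skeleton d K))"
    by (rule finite_subset[OF _ fin]) (auto simp: vertices_def skeleton_def)
  fix \<sigma> \<tau> assume \<sigma>: "\<sigma> \<in> skeleton d K" "\<tau> \<subseteq> \<sigma>"
  then have "finite \<sigma>" using fin finite_subset[of \<sigma> "vertices K"] by (auto simp: vertices_def skeleton_def)
  from card_mono[OF this \<sigma>(2)] show "\<tau> \<in> skeleton d K"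
    using \<sigma> closed by (auto simp: skeleton_def face_dim_def)
qed

text \<open>By purity, the link of \<tau> has a face with \<open>D - card \<tau>\<close> elements,
  so \<open>card \<tau> + p < D\<close> places degree \<open>p - 1\<close> below its
  dimension.\<close>

lemma cm_skeleton_interpretation:
  assumes K: "simplicial_complex K" and CM: "cohen_macaulay (F :: 'f::field itself) K"
    and top: "T \<in> K" "card T = D" "\<And>\<sigma>. \<sigma> \<in> K \<Longrightarrow> card \<sigma> \<le> D"
    and e: "inj_on e (vertices K)"
  shows "cm_complex TYPE('f) (vertices K) e K D"
proof -
  have finV: "finite (vertices K)" using K by (simp add: simplicial_complex_def)
  interpret vertex_set "vertices K" e using finV e by unfold_locales
  show ?thesis
  proof (unfold_locales)
    show closed: "\<tau> \<in> K" if "\<sigma> \<in> K" "\<tau> \<subseteq> \<sigma>" for \<sigma> \<tau>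
      using K that unfolding simplicial_complex_def by blast
    show "K \<subseteq> Pow (vertices K)" by (auto simp: vertices_def)
    fix \<tau> p and g :: "'a set \<Rightarrow> 'f"
    assume \<tau>: "\<tau> \<in> K" "card \<tau> + p < D"
      and cocycle: "\<And>\<rho>. \<rho> \<inter> \<tau> = {} \<Longrightarrow> \<rho> \<union> \<tau> \<in> K \<Longrightarrow> card \<rho> = Suc p \<Longrightarrow>
        (\<Sum>v\<in>\<rho>. sg v (\<rho> - {v}) * g (\<rho> - {v})) = 0"
    have "facet K T"
      unfolding facet_def
    proof (intro conjI ballI impI)
      fix H assume H: "H \<in> K" "T \<subseteq> H"
      then show "H = T"
        using top(2) top(3)[OF H(1)] card_subset_eq[OF face_finite_card[OF K H(1)] H(2)]
          card_mono[OF face_finite_card[OF K H(1)] H(2)] by simp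
    qed (rule top)
    moreover obtain G where G: "facet K G" "\<tau> \<subseteq> G" using exists_facet[OF K \<tau>(1)] by blast
    moreover have "{} \<in> K" using closed[OF top(1)] by simp
    ultimately have "card G = D"
      using cohen_macaulay_pure[OF K CM, of "{}" G T] top(2) by simp
    moreover have GK: "G \<in> K" using G by (simp add: facet_def)
    ultimately have "card (G - \<tau>) = D - card \<tau>"
      using G(2) face_finite_card[OF K GK] by (metis card_Diff_subset finite_subset)
    moreover have "G - \<tau> \<in> link K \<tau>" using GK G(2) by (auto simp: link_def Un_absorb2)
    ultimately have "int p - 1 < complex_dim (link K \<tau>)"
      using complex_dim_ge[OF finite_link[OF K], of "G - \<tau>" \<tau>] \<tau>(2) by simp
    then have hom: "reduced_homology_zero F (link K \<tau>) (int p - 1)"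
      using CM \<tau>(1) by (simp add: cohen_macaulay_def)
    have "\<exists>h. \<forall>\<rho>\<in>link K \<tau>. card \<rho> = p \<longrightarrow> g \<rho> = (\<Sum>v\<in>\<rho>. sg v (\<rho> - {v}) * h (\<rho> - {v}))"
    proof (rule cohomology_exact[OF link_subset_vertices _ hom])
      show "\<rho>' \<in> link K \<tau>" if "\<rho> \<in> link K \<tau>" "\<rho>' \<subseteq> \<rho>" for \<rho> \<rho>' using link_closed[OF K that] .
      show "(\<Sum>v\<in>\<rho>. sg v (\<rho> - {v}) * g (\<rho> - {v})) = 0" if "\<rho> \<in> link K \<tau>" "card \<rho> = Suc p" for \<rho>
        by (rule cocycle) (use that in \<open>auto simp: link_def\<close>)
    qed
    then obtain h where "\<forall>\<rho>\<in>link K \<tau>. card \<rho> = p \<longrightarrow> g \<rho> = (\<Sum>v\<in>\<rho>. sg v (\<rho> - {v}) * h (\<rho> - {v}))"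
      by blast
    then show "\<exists>h. \<forall>\<rho>. \<rho> \<inter> \<tau> = {} \<longrightarrow> \<rho> \<union> \<tau> \<in> K \<longrightarrow> card \<rho> = p \<longrightarrow>
        g \<rho> = (\<Sum>v\<in>\<rho>. sg v (\<rho> - {v}) * h (\<rho> - {v}))"
      by (intro exI[of _ h]) (simp add: link_def)
  qed
qed

theorem theorem3p3:
  fixes \<Delta> :: "'a set set" and F :: "'f::field itself" and r :: nat
  assumes "simplicial_complex \<Delta>"
    and "near_cone \<Delta>"
    and "0 < r"
    and "real r \<le> (real_of_int (depth F \<Delta>) + 1) / 2"
  shows "r_EKR r \<Delta>"
proof -
  obtain v where v: "v \<in> vertices \<Delta>" "\<And>\<sigma> w. \<sigma> \<in> \<Delta> \<Longrightarrow> w \<in> \<sigma> \<Longrightarrow> (\<sigma> - {w}) \<union> {v} \<in> \<Delta>"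
    using assms(2) by (auto simp: near_cone_def near_cone_apex_def)
  have closed: "\<tau> \<in> \<Delta>" if "\<sigma> \<in> \<Delta>" "\<tau> \<subseteq> \<sigma>" for \<sigma> \<tau>
    using assms(1) that unfolding simplicial_complex_def by blast
  define d where "d = depth F \<Delta>"
  have "\<Delta> \<noteq> {}" using v(1) by (auto simp: vertices_def)
  then have d: "d \<le> complex_dim \<Delta>" "cohen_macaulay F (skeleton d \<Delta>)"
    using depth_attained[OF assms(1)] by (auto simp: d_def)
  have "real (2 * r) \<le> real_of_int (d + 1)" using assms(4) by (simp add: d_def)
  then have rd: "int (2 * r) \<le> d + 1" by linarith
  \<comment> \<open>Depth is a dimension, whereas \<open>D\<close> counts the elements of a largest
    face of the skeleton.\<close>
  define D where "D = nat (d + 1)"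
  have D: "int D = d + 1" "2 * r \<le> D" using rd by (auto simp: D_def)
  define K where "K = skeleton d \<Delta>"
  have K: "simplicial_complex K" unfolding K_def by (rule skeleton_complex[OF assms(1)])
  have memK: "\<sigma> \<in> K \<longleftrightarrow> \<sigma> \<in> \<Delta> \<and> card \<sigma> \<le> D" for \<sigma>
    using D(1) by (auto simp: K_def skeleton_def face_dim_def)
  have "complex_dim \<Delta> \<in> face_dim ` \<Delta>"
    unfolding complex_dim_def
    by (rule Max_in) (use finite_complex[OF assms(1)] \<open>\<Delta> \<noteq> {}\<close> in auto)
  then obtain G where G: "G \<in> \<Delta>" "d \<le> int (card G) - 1" using d(1) by (auto simp: face_dim_def)
  then obtain T where "T \<subseteq> G" "card T = D"
    using D(1) obtain_subset_with_card_n[of D G] by auto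
  then have T: "T \<in> K" "card T = D" using closed G(1) by (auto simp: memK)
  have finV: "finite (vertices K)" using K by (simp add: simplicial_complex_def)
  obtain e :: "'a \<Rightarrow> nat" where e: "inj_on e (vertices K)"
    using finite_imp_inj_to_nat_seg[OF finV] by blast
  interpret cm_complex "vertices K" e K D F
    by (rule cm_skeleton_interpretation[OF K _ T _ e]) (use d(2) memK in \<open>auto simp: K_def\<close>)
  \<comment> \<open>Since \<open>0 < r\<close>, the bound gives \<open>D \<ge> 2\<close>, so the
    skeleton retains the apex.\<close>
  have "{v} \<in> K" using v(1) closed D(2) assms(3) by (auto simp: memK vertices_def)
  then have apexV: "v \<in> vertices K" by (auto simp: vertices_def)
  \<comment> \<open>Exchanging a vertex for the apex does not enlarge a face, so the skeleton is
    again a near-cone.\<close>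
  have apexK: "insert v (\<sigma> - {u}) \<in> K" if "\<sigma> \<in> K" "u \<in> \<sigma>" for \<sigma> u
  proof -
    have "finite \<sigma>" by (rule face_finite_card[OF K that(1)])
    then have "card (insert v (\<sigma> - {u})) \<le> card \<sigma>"
      using card_insert_le_m1[of "card \<sigma>" "\<sigma> - {u}" v] that(2) by (simp add: card_gt_0_iff) blast
    then show ?thesis using that v(2)[of \<sigma> u] by (auto simp: memK)
  qed
  show ?thesis
    unfolding r_EKR_def
  proof (intro allI impI, elim conjE)
    fix A assume A: "A \<subseteq> r_faces \<Delta> r" "intersecting A"
    have "card A \<le> card {\<tau>\<in>K. card \<tau> = r - 1 \<and> v \<notin> \<tau> \<and> insert v \<tau> \<in> K}"
      by (rule near_cone_EKR_bound[OF apexV apexK])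
        (use A D(2) in \<open>auto simp: r_faces_def memK intersecting_def\<close>)
    also have "\<dots> \<le> num_faces (r - 1) (link \<Delta> {v})"
      unfolding num_faces_def r_faces_def
    proof (rule card_mono)
      show "finite {\<sigma> \<in> link \<Delta> {v}. card \<sigma> = r - 1}"
        by (rule finite_subset[OF _ finite_link[OF assms(1)]]) auto
    qed (auto simp: link_def memK)
    also have "\<dots> \<le> Max ((\<lambda>v. num_faces (r - 1) (link \<Delta> {v})) ` vertices \<Delta>)"
      by (rule Max_ge) (use v(1) assms(1) in \<open>auto simp: simplicial_complex_def\<close>)
    finally show "card A \<le> Max ((\<lambda>v. num_faces (r - 1) (link \<Delta> {v})) ` vertices \<Delta>)" .
  qed
qed

end
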